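(* Let $\varphi:\Sigma\to M$ be an isometric immersion in a unimodular Lie group $M$. Assume that $\varphi$ has positive extrinsic curvature $K$ and Gauss map $g:\Sigma\to\mathbb{C}\cup\{\infty\}$. Let $z$ be a conformal parameter for the second fundamental form. Then, when $\mu_1=\mu_2$, the Gauss map satisfies $$g_{z\overline z}=G_1g_zg_{\overline z}+G_2g_z\overline g_{\overline z}+G_3\overline g_zg_{\overline z}+G_4\overline g_z\overline g_{\overline z}+G_5K_zg_{\overline z}+G_6K_z\overline g_{\overline z}+G_7K_{\overline z}g_z+G_8K_{\overline z}\overline g_z,\qquad(\ast)$$ where $G_i=G_i(K)$ and, with $B=1+|g|^2$, $P_{(m_0,m_1,m_2,m_3,m_4)}=\sum_{i=0}^4m_i|g|^{2i}$, $Q=P_{(\mu_1,\,4\mu_3-2\mu_1,\,\mu_1,0,0)}=(B-2)^2\mu_1+4|g|^2\mu_3$ and $$\mathcal D(x)=B^3\Big(B^4x^2+\mu_1^2Q^2+2x\big(P_{(1,0,6,0,1)}\mu_1^2+P_{(0,4,-8,4,0)}\mu_1\mu_3+8|g|^4\mu_3^2\big)\Big),$$ the functions $G_i$ are $$\begin{aligned}G_1(x)=\ &\frac{2\overline g\Big(B^6x^2+2B^2x\big(P_{(0,4,2,1,1)}\mu_1^2+P_{(1,-5,1,3,0)}\mu_1\mu_3+P_{(0,5,3,0,0)}\mu_3^2\big)-32|g|^4(B-2)\mu_1\mu_3^3\Big)}{\mathcal D(x)}\\&-\frac{2\overline g\,\mu_1\Big(\big(1+6|g|^2-|g|^4P_{(13,-10,3,0,1)}\big)\mu_1^3+2(B-2)P_{(-1,-6,18,2,3)}\mu_1^2\mu_3+P_{(0,2,66,-18,14)}\mu_1\mu_3^2\Big)}{\mathcal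 D(x)},\end{aligned}$$ $$G_2(x)=\frac{2ig(B-2)(\mu_3-\mu_1)\big(2B^4x^2+B^4x\mu_1^2-iB^2\sqrt x\,(x+\mu_1^2)P_{(\mu_1,2\mu_3,\mu_1,0,0)}-\mu_1^2Q^2\big)}{B^3\sqrt x\,(x+\mu_1^2)(B^4x+Q^2)},$$ $$G_3(x)=\frac{2ig(B-2)(\mu_1-\mu_3)\big(2B^4x^2+B^4x\mu_1^2+iB^2\sqrt x\,(x+\mu_1^2)P_{(\mu_1,2\mu_3,\mu_1,0,0)}-\mu_1^2Q^2\big)}{B^3\sqrt x\,(x+\mu_1^2)(B^4x+Q^2)},$$ $$G_4(x)=-\frac{4g^3(B-2)(\mu_1-\mu_3)^2\big(-3B^2x+P_{(\mu_1^2,\,8\mu_1\mu_3-6\mu_1^2,\,\mu_1^2,0,0)}\big)}{B^3(x+\mu_1^2)(B^4x+Q^2)},$$ $$G_5(x)=\overline{G}_7(x)=\frac{B^2x+\mu_1Q}{4x(\sqrt x+i\mu_1)(B^2\sqrt x+iQ)},$$ $$G_6(x)=\overline{G}_8(x)=-\frac{ig^2(\mu_1-\mu_3)}{\sqrt x(\sqrt x+i\mu_1)(B^2\sqrt x+iQ)}.$$ Moreover, the integrability equation $$N\times_{\varphi}\Big(\nabla_{\partial_z}\big(\tfrac{1}{\sqrt{K}}\nabla_{\partial_{\overline z}} N\big)+\nabla_{\partial_{\overline z}}\big(\tfrac{1}{\sqrt{K}}\nabla_{\partial_{z}} N\big)\Big)=0$$ is equivalent to equation $(\ast)$.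
   Context: $M$ is a 3-dimensional unimodular Lie group with left invariant metric, Lie algebra $\mathfrak{m}$ and identity $e$. $\{E_1,E_2,E_3\}$ is a positively oriented orthonormal basis of $\mathfrak m$ with $[E_2,E_3]=c_1E_1$, $[E_3,E_1]=c_2E_2$, $[E_1,E_2]=c_3E_3$ ($c_i\in\mathbb R$), extended to a left invariant frame $E_i(q)$, $q\in M$; $\mu_1=\frac{-c_1+c_2+c_3}2$, $\mu_2=\frac{c_1-c_2+c_3}2$, $\mu_3=\frac{c_1+c_2-c_3}2$. $\nabla$ is the Levi-Civita connection of $M$ and $\times_\varphi$ is the cross product in the tangent space of $M$ at the point $\varphi(z)$. The extrinsic curvature $K$ is the determinant of the shape operator. Since $K>0$, $N$ denotes the global unit normal for which $II=\langle -dN,d\varphi\rangle$ is positive definite; a conformal parameter $z=x+iy$ for $II$ is a complex coordinate with $II=2\rho|dz|^2$, $\rho>0$, oriented so that $N$ is a positive multiple of $\varphi_x\times_\varphi\varphi_y$ (so that $\varphi_z=\frac{i}{\sqrt K}N\times_\varphi\nabla_{\partial_z}N$). With $N_i=\langle N,E_i(\varphi)\rangle$, the Gauss map is $g=\frac{N_1+iN_2}{1-N_3}$. Here $\overline g_z=\partial_z(\overline g)$, etc.; formulas in $g$ are understood where $g\neq\infty$.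
   Formalization: Misprints in G_1 corrected: -32|g|^4(B-2)μ_1μ_3^3 becomes +16|g|^4(B-2)μ_1μ_3^3, and the μ_1^2μ_3 and μ_1μ_3^2 terms of the second numerator change sign; in G_8 the factor g^2 is kept and only its cofactor in G_6 is conjugated. *)

theory Defs
  imports "HOL-Analysis.Analysis" "HOL-Algebra.Group"
begin

subsection \<open>Smooth manifolds, tangent vectors and vector fields\<close>

text \<open>The next two notions are only used on open sets.\<close>

primrec Ck_on :: "nat \<Rightarrow> 'a::euclidean_space set \<Rightarrow> ('a \<Rightarrow> 'b::real_normed_vector) \<Rightarrow> bool" where
  "Ck_on 0 S f \<longleftrightarrow> continuous_on S f"
| "Ck_on (Suc k) S f \<longleftrightarrow>
     (\<forall>x\<in>S. f differentiable (at x)) \<and> (\<forall>v. Ck_on k S (\<lambda>x. frechet_derivative f (at x) v))"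

definition smooth_on :: "'a::euclidean_space set \<Rightarrow> ('a \<Rightarrow> 'b::real_normed_vector) \<Rightarrow> bool" where
  "smooth_on S f \<longleftrightarrow> (\<forall>k. Ck_on k S f)"

text \<open>
  The points of a manifold are all the elements of a type, and a chart is a pair of a domain and a
  coordinate map; the values of the coordinate map outside its domain are irrelevant.
\<close>

type_synonym ('m, 'e) atlas = "('m set \<times> ('m \<Rightarrow> 'e)) set"

definition smooth_atlas :: "('m::topological_space, 'e::euclidean_space) atlas \<Rightarrow> bool" where
  "smooth_atlas \<A> \<longleftrightarrow>
     (\<Union>(U, \<kappa>)\<in>\<A>. U) = UNIV \<and>
     (\<forall>(U, \<kappa>)\<in>\<A>. open U \<and> open (\<kappa> ` U) \<and> homeomorphism U (\<kappa> ` U) \<kappa> (inv_into U \<kappa>)) \<and>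
     (\<forall>(U, \<kappa>)\<in>\<A>. \<forall>(V, \<eta>)\<in>\<A>. smooth_on (\<kappa> ` (U \<inter> V)) (\<eta> \<circ> inv_into U \<kappa>))"

definition smooth_map ::
  "('m::topological_space, 'd::euclidean_space) atlas \<Rightarrow> ('n::topological_space, 'e::euclidean_space) atlas
     \<Rightarrow> ('m \<Rightarrow> 'n) \<Rightarrow> bool" where
  "smooth_map \<A> \<B> \<phi> \<longleftrightarrow> continuous_on UNIV \<phi> \<and>
     (\<forall>(U, \<kappa>)\<in>\<A>. \<forall>(V, \<eta>)\<in>\<B>. smooth_on (\<kappa> ` (U \<inter> \<phi> -` V)) (\<eta> \<circ> \<phi> \<circ> inv_into U \<kappa>))"

definition smooth_fun :: "('m::topological_space, 'e::euclidean_space) atlas \<Rightarrow> ('m \<Rightarrow> real) \<Rightarrow> bool" where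
  "smooth_fun \<A> f \<longleftrightarrow> (\<forall>(U, \<kappa>)\<in>\<A>. smooth_on (\<kappa> ` U) (f \<circ> inv_into U \<kappa>))"

definition prod_atlas ::
  "('m, 'd) atlas \<Rightarrow> ('n, 'e) atlas \<Rightarrow> ('m \<times> 'n, 'd \<times> 'e) atlas" where
  "prod_atlas \<A> \<B> = {(U \<times> V, map_prod \<kappa> \<eta>) |U \<kappa> V \<eta>. (U, \<kappa>) \<in> \<A> \<and> (V, \<eta>) \<in> \<B>}"

text \<open>
  Tangent vectors are derivations of the algebra of smooth functions. They are normalised to be
  zero on functions that are not smooth, so that equality of tangent vectors is equality in HOL.
\<close>

type_synonym 'm tangent = "('m \<Rightarrow> real) \<Rightarrow> real"
type_synonym 'm vfield = "'m \<Rightarrow> 'm tangent"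

definition tangent_space ::
  "('m::topological_space, 'e::euclidean_space) atlas \<Rightarrow> 'm \<Rightarrow> 'm tangent set" where
  "tangent_space \<A> q = {v.
     (\<forall>f. \<not> smooth_fun \<A> f \<longrightarrow> v f = 0) \<and>
     (\<forall>f h. smooth_fun \<A> f \<longrightarrow> smooth_fun \<A> h \<longrightarrow> v (\<lambda>r. f r + h r) = v f + v h) \<and>
     (\<forall>c f. smooth_fun \<A> f \<longrightarrow> v (\<lambda>r. c * f r) = c * v f) \<and>
     (\<forall>f h. smooth_fun \<A> f \<longrightarrow> smooth_fun \<A> h \<longrightarrow> v (\<lambda>r. f r * h r) = f q * v h + h q * v f)}"

text \<open>The differential of \<phi>; the atlas is that of the target manifold.\<close>

definition pushforward ::
  "('n::topological_space, 'e::euclidean_space) atlas \<Rightarrow> ('m \<Rightarrow> 'n) \<Rightarrow> 'm tangent \<Rightarrow> 'n tangent" where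
  "pushforward \<B> \<phi> v = (\<lambda>f. if smooth_fun \<B> f then v (f \<circ> \<phi>) else 0)"

definition smooth_vector_fields ::
  "('m::topological_space, 'e::euclidean_space) atlas \<Rightarrow> 'm vfield set" where
  "smooth_vector_fields \<A> = {X. (\<forall>q. X q \<in> tangent_space \<A> q) \<and>
     (\<forall>f. smooth_fun \<A> f \<longrightarrow> smooth_fun \<A> (\<lambda>q. X q f))}"

definition lie_bracket :: "'m vfield \<Rightarrow> 'm vfield \<Rightarrow> 'm vfield" where
  "lie_bracket X Y = (\<lambda>q f. X q (\<lambda>r. Y r f) - Y q (\<lambda>r. X r f))"

subsection \<open>Riemannian metrics and the Levi-Civita connection\<close>

type_synonym 'm metric = "'m \<Rightarrow> 'm tangent \<Rightarrow> 'm tangent \<Rightarrow> real"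

definition riemannian_metric ::
  "('m::topological_space, 'e::euclidean_space) atlas \<Rightarrow> 'm metric \<Rightarrow> bool" where
  "riemannian_metric \<A> ip \<longleftrightarrow>
     (\<forall>q. \<forall>u\<in>tangent_space \<A> q. \<forall>v\<in>tangent_space \<A> q.
        ip q u v = ip q v u \<and>
        (\<forall>w\<in>tangent_space \<A> q. ip q (\<lambda>f. u f + v f) w = ip q u w + ip q v w) \<and>
        (\<forall>c. ip q (\<lambda>f. c * u f) v = c * ip q u v) \<and>
        (u \<noteq> (\<lambda>f. 0) \<longrightarrow> ip q u u > 0)) \<and>
     (\<forall>X\<in>smooth_vector_fields \<A>. \<forall>Y\<in>smooth_vector_fields \<A>.
        smooth_fun \<A> (\<lambda>q. ip q (X q) (Y q)))"

definition levi_civita ::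
  "('m::topological_space, 'e::euclidean_space) atlas \<Rightarrow> 'm metric
     \<Rightarrow> ('m vfield \<Rightarrow> 'm vfield \<Rightarrow> 'm vfield) \<Rightarrow> bool" where
  "levi_civita \<A> ip nab \<longleftrightarrow>
     (\<forall>X\<in>smooth_vector_fields \<A>. \<forall>Y\<in>smooth_vector_fields \<A>.
        nab X Y \<in> smooth_vector_fields \<A> \<and>
        (\<forall>Z\<in>smooth_vector_fields \<A>.
           nab (\<lambda>q f. X q f + Y q f) Z = (\<lambda>q f. nab X Z q f + nab Y Z q f) \<and>
           nab Z (\<lambda>q f. X q f + Y q f) = (\<lambda>q f. nab Z X q f + nab Z Y q f)) \<and>
        (\<forall>h. smooth_fun \<A> h \<longrightarrow>
           nab (\<lambda>q f. h q * X q f) Y = (\<lambda>q f. h q * nab X Y q f) \<and>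
           nab X (\<lambda>q f. h q * Y q f) = (\<lambda>q f. X q h * Y q f + h q * nab X Y q f)) \<and>
        (\<lambda>q f. nab X Y q f - nab Y X q f) = lie_bracket X Y \<and>
        (\<forall>Z\<in>smooth_vector_fields \<A>. \<forall>q.
           X q (\<lambda>r. ip r (Y r) (Z r)) = ip q (nab X Y q) (Z q) + ip q (Y q) (nab X Z q)))"

subsection \<open>Lie groups with a left invariant metric\<close>

definition lie_group ::
  "('m::{t2_space, second_countable_topology}, 'e::euclidean_space) atlas \<Rightarrow> 'm monoid \<Rightarrow> bool" where
  "lie_group \<A> G \<longleftrightarrow> smooth_atlas \<A> \<and> group G \<and> carrier G = UNIV \<and>
     smooth_map (prod_atlas \<A> \<A>) \<A> (\<lambda>(a, b). a \<otimes>\<^bsub>G\<^esub> b) \<and>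
     smooth_map \<A> \<A> (\<lambda>a. inv\<^bsub>G\<^esub> a)"

text \<open>Unimodularity: there is a Haar measure that is both left and right invariant.\<close>

definition unimodular :: "'m::topological_space monoid \<Rightarrow> bool" where
  "unimodular G \<longleftrightarrow> (\<exists>\<mu>. sets \<mu> = sets borel \<and>
     (\<forall>C. compact C \<longrightarrow> emeasure \<mu> C < \<infinity>) \<and>
     (\<forall>U. open U \<longrightarrow> U \<noteq> {} \<longrightarrow> emeasure \<mu> U > 0) \<and>
     (\<forall>a. \<forall>S\<in>sets borel.
        emeasure \<mu> ((\<lambda>r. a \<otimes>\<^bsub>G\<^esub> r) ` S) = emeasure \<mu> S \<and>
        emeasure \<mu> ((\<lambda>r. r \<otimes>\<^bsub>G\<^esub> a) ` S) = emeasure \<mu> S))"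

definition left_invariant_metric ::
  "('m::topological_space, 'e::euclidean_space) atlas \<Rightarrow> 'm monoid \<Rightarrow> 'm metric \<Rightarrow> bool" where
  "left_invariant_metric \<A> G ip \<longleftrightarrow> riemannian_metric \<A> ip \<and>
     (\<forall>a q. \<forall>u\<in>tangent_space \<A> q. \<forall>v\<in>tangent_space \<A> q.
        ip (a \<otimes>\<^bsub>G\<^esub> q) (pushforward \<A> (\<lambda>r. a \<otimes>\<^bsub>G\<^esub> r) u) (pushforward \<A> (\<lambda>r. a \<otimes>\<^bsub>G\<^esub> r) v)
          = ip q u v)"

definition lie_algebra ::
  "('m::topological_space, 'e::euclidean_space) atlas \<Rightarrow> 'm monoid \<Rightarrow> 'm vfield set" where
  "lie_algebra \<A> G = {X \<in> smooth_vector_fields \<A>.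
     \<forall>a q. pushforward \<A> (\<lambda>r. a \<otimes>\<^bsub>G\<^esub> r) (X q) = X (a \<otimes>\<^bsub>G\<^esub> q)}"

text \<open>
  An orthonormal basis of the Lie algebra, the latter being identified with the tangent space
  at the identity. Such a basis also fixes the orientation of the group: it is declared positive.
\<close>

definition orthonormal_frame ::
  "('m::topological_space, 'e::euclidean_space) atlas \<Rightarrow> 'm monoid \<Rightarrow> 'm metric \<Rightarrow> (3 \<Rightarrow> 'm vfield) \<Rightarrow> bool"
where
  "orthonormal_frame \<A> G ip E \<longleftrightarrow>
     (\<forall>i. E i \<in> lie_algebra \<A> G) \<and>
     (\<forall>i j. ip \<one>\<^bsub>G\<^esub> (E i \<one>\<^bsub>G\<^esub>) (E j \<one>\<^bsub>G\<^esub>) = (if i = j then 1 else 0)) \<and>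
     (\<forall>v\<in>tangent_space \<A> \<one>\<^bsub>G\<^esub>. \<exists>c::real^3. v = (\<lambda>f. \<Sum>i\<in>UNIV. c $ i * E i \<one>\<^bsub>G\<^esub> f))"

text \<open>
  Tangent vectors of the group are described by their components in the frame. As the frame is
  orthonormal and positive, the metric and the cross product become those of \<open>real ^ 3\<close>.
\<close>

definition comps :: "'m metric \<Rightarrow> (3 \<Rightarrow> 'm vfield) \<Rightarrow> 'm \<Rightarrow> 'm tangent \<Rightarrow> real^3" where
  "comps ip E q v = (\<chi> i. ip q v (E i q))"

definition conn_coeff ::
  "'m metric \<Rightarrow> (3 \<Rightarrow> 'm vfield) \<Rightarrow> ('m vfield \<Rightarrow> 'm vfield \<Rightarrow> 'm vfield) \<Rightarrow> 'm \<Rightarrow> 3 \<Rightarrow> 3 \<Rightarrow> real^3" where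
  "conn_coeff ip E nab q j i = comps ip E q (nab (E j) (E i) q)"

text \<open>
  \<open>conn_term \<Gamma> a V\<close> has the components of \<open>\<Sum>i. V i * \<nabla>_a E i\<close>, for real or complexified vectors.
\<close>

definition conn_term :: "(3 \<Rightarrow> 3 \<Rightarrow> real^3) \<Rightarrow> 'a::real_normed_field^3 \<Rightarrow> 'a^3 \<Rightarrow> 'a^3" where
  "conn_term \<Gamma> a V = (\<chi> k. \<Sum>j\<in>UNIV. \<Sum>i\<in>UNIV. a $ j * V $ i * of_real (\<Gamma> j i $ k))"

subsection \<open>Immersed surfaces\<close>

text \<open>Surfaces are modelled on the plane of complex numbers.\<close>

definition isometric_immersion ::
  "('s::topological_space, complex) atlas \<Rightarrow> 's metric \<Rightarrow> ('m::topological_space, real^3) atlas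
     \<Rightarrow> 'm metric \<Rightarrow> ('s \<Rightarrow> 'm) \<Rightarrow> bool" where
  "isometric_immersion \<S> h \<A> ip \<phi> \<longleftrightarrow> smooth_map \<S> \<A> \<phi> \<and>
     (\<forall>p. inj_on (pushforward \<A> \<phi>) (tangent_space \<S> p) \<and>
        (\<forall>u\<in>tangent_space \<S> p. \<forall>v\<in>tangent_space \<S> p.
           ip (\<phi> p) (pushforward \<A> \<phi> u) (pushforward \<A> \<phi> v) = h p u v))"

definition unit_normal ::
  "('s::topological_space, complex) atlas \<Rightarrow> ('m::topological_space, real^3) atlas
     \<Rightarrow> 'm metric \<Rightarrow> ('s \<Rightarrow> 'm) \<Rightarrow> ('s \<Rightarrow> 'm tangent) \<Rightarrow> bool" where
  "unit_normal \<S> \<A> ip \<phi> N \<longleftrightarrow>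
     (\<forall>p. N p \<in> tangent_space \<A> (\<phi> p) \<and> ip (\<phi> p) (N p) (N p) = 1 \<and>
        (\<forall>v\<in>tangent_space \<S> p. ip (\<phi> p) (N p) (pushforward \<A> \<phi> v) = 0)) \<and>
     (\<forall>f. smooth_fun \<A> f \<longrightarrow> smooth_fun \<S> (\<lambda>p. N p f))"

text \<open>
  Components of \<open>\<nabla>_X N\<close>, for \<open>X\<close> tangent to the surface at \<open>p\<close> and \<open>N = \<Sum>i. N i * E i\<close> a vector
  field along \<phi>: \<open>\<nabla>_X N = \<Sum>i. X (N i) * E i + N i * \<nabla>_{d\<phi> X} E i\<close>.
\<close>

definition cov_deriv_along ::
  "('m::topological_space, real^3) atlas \<Rightarrow> 'm metric \<Rightarrow> (3 \<Rightarrow> 'm vfield)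
     \<Rightarrow> ('m vfield \<Rightarrow> 'm vfield \<Rightarrow> 'm vfield) \<Rightarrow> ('s \<Rightarrow> 'm) \<Rightarrow> ('s \<Rightarrow> 'm tangent)
     \<Rightarrow> 's \<Rightarrow> 's tangent \<Rightarrow> real^3" where
  "cov_deriv_along \<A> ip E nab \<phi> N p X =
     (\<chi> k. X (\<lambda>s. comps ip E (\<phi> s) (N s) $ k)) +
     conn_term (conn_coeff ip E nab (\<phi> p)) (comps ip E (\<phi> p) (pushforward \<A> \<phi> X)) (comps ip E (\<phi> p) (N p))"

definition second_form ::
  "('m::topological_space, real^3) atlas \<Rightarrow> 'm metric \<Rightarrow> (3 \<Rightarrow> 'm vfield)
     \<Rightarrow> ('m vfield \<Rightarrow> 'm vfield \<Rightarrow> 'm vfield) \<Rightarrow> ('s \<Rightarrow> 'm) \<Rightarrow> ('s \<Rightarrow> 'm tangent)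
     \<Rightarrow> 's \<Rightarrow> 's tangent \<Rightarrow> 's tangent \<Rightarrow> real" where
  "second_form \<A> ip E nab \<phi> N p X Y =
     - (cov_deriv_along \<A> ip E nab \<phi> N p X \<bullet> comps ip E (\<phi> p) (pushforward \<A> \<phi> Y))"

text \<open>
  The extrinsic curvature at \<open>p\<close> is \<open>k\<close>: the shape operator \<open>L\<close>, characterised by
  \<open>d\<phi> (L X) = - \<nabla>_X N\<close>, has determinant \<open>k\<close>, computed from its matrix in a basis \<open>b\<close>.
\<close>

definition has_extrinsic_curvature ::
  "('s::topological_space, complex) atlas \<Rightarrow> ('m::topological_space, real^3) atlas \<Rightarrow> 'm metric
     \<Rightarrow> (3 \<Rightarrow> 'm vfield) \<Rightarrow> ('m vfield \<Rightarrow> 'm vfield \<Rightarrow> 'm vfield) \<Rightarrow> ('s \<Rightarrow> 'm) \<Rightarrow> ('s \<Rightarrow> 'm tangent)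
     \<Rightarrow> 's \<Rightarrow> real \<Rightarrow> bool" where
  "has_extrinsic_curvature \<S> \<A> ip E nab \<phi> N p k \<longleftrightarrow>
     (\<exists>(L :: 's tangent \<Rightarrow> 's tangent) (b :: 2 \<Rightarrow> 's tangent) (A :: real^2^2).
        (\<forall>X\<in>tangent_space \<S> p. L X \<in> tangent_space \<S> p \<and>
           comps ip E (\<phi> p) (pushforward \<A> \<phi> (L X)) = - cov_deriv_along \<A> ip E nab \<phi> N p X) \<and>
        (\<forall>i. b i \<in> tangent_space \<S> p) \<and>
        (\<forall>c::real^2. (\<forall>f. (\<Sum>i\<in>UNIV. c $ i * b i f) = 0) \<longrightarrow> c = 0) \<and>
        (\<forall>X\<in>tangent_space \<S> p. \<exists>c::real^2. X = (\<lambda>f. \<Sum>i\<in>UNIV. c $ i * b i f)) \<and>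
        (\<forall>j. L (b j) = (\<lambda>f. \<Sum>i\<in>UNIV. A $ i $ j * b i f)) \<and>
        k = det A)"

text \<open>
  For a chart \<open>\<zeta> = x + \<i> y\<close> with domain \<open>V\<close>: \<open>coord_vector \<S> V \<zeta> p 1\<close> is \<open>\<partial>/\<partial>x\<close> and
  \<open>coord_vector \<S> V \<zeta> p \<i>\<close> is \<open>\<partial>/\<partial>y\<close>, at the point \<open>p\<close>.
\<close>

definition coord_vector ::
  "('s::topological_space, complex) atlas \<Rightarrow> 's set \<Rightarrow> ('s \<Rightarrow> complex) \<Rightarrow> 's \<Rightarrow> complex \<Rightarrow> 's tangent" where
  "coord_vector \<S> V \<zeta> p v =
     (\<lambda>f. if smooth_fun \<S> f then frechet_derivative (f \<circ> inv_into V \<zeta>) (at (\<zeta> p)) v else 0)"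

text \<open>
  Conformal parameters for the second fundamental form: \<open>II = 2 \<rho> \<bar>dz\<bar>\<^sup>2\<close> with \<open>\<rho> > 0\<close>, oriented by
  requiring \<open>N\<close> to be a positive multiple of the cross product of the coordinate vectors.
\<close>

definition conformal_parameter ::
  "('s::topological_space, complex) atlas \<Rightarrow> ('m::topological_space, real^3) atlas \<Rightarrow> 'm metric
     \<Rightarrow> (3 \<Rightarrow> 'm vfield) \<Rightarrow> ('m vfield \<Rightarrow> 'm vfield \<Rightarrow> 'm vfield) \<Rightarrow> ('s \<Rightarrow> 'm) \<Rightarrow> ('s \<Rightarrow> 'm tangent)
     \<Rightarrow> 's set \<Rightarrow> ('s \<Rightarrow> complex) \<Rightarrow> bool" where
  "conformal_parameter \<S> \<A> ip E nab \<phi> N V \<zeta> \<longleftrightarrow>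
     smooth_atlas (insert (V, \<zeta>) \<S>) \<and>
     (\<forall>p\<in>V. let X = coord_vector \<S> V \<zeta> p 1; Y = coord_vector \<S> V \<zeta> p \<i>;
                 II = second_form \<A> ip E nab \<phi> N p in
        (\<exists>\<rho>>0. II X X = 2 * \<rho> \<and> II Y Y = 2 * \<rho> \<and> II X Y = 0 \<and> II Y X = 0) \<and>
        (\<exists>t>0. comps ip E (\<phi> p) (N p) =
           t *\<^sub>R cross3 (comps ip E (\<phi> p) (pushforward \<A> \<phi> X)) (comps ip E (\<phi> p) (pushforward \<A> \<phi> Y))))"

subsection \<open>Complexified calculus in a parameter\<close>

definition wirt :: "(complex \<Rightarrow> complex) \<Rightarrow> complex \<Rightarrow> complex" where
  "wirt h w = (frechet_derivative h (at w) 1 - \<i> * frechet_derivative h (at w) \<i>) / 2"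

definition wirt_bar :: "(complex \<Rightarrow> complex) \<Rightarrow> complex \<Rightarrow> complex" where
  "wirt_bar h w = (frechet_derivative h (at w) 1 + \<i> * frechet_derivative h (at w) \<i>) / 2"

definition cvec :: "real^3 \<Rightarrow> complex^3" where
  "cvec v = (\<chi> k. complex_of_real (v $ k))"

text \<open>The complex bilinear extension of the cross product.\<close>

definition ccross :: "complex^3 \<Rightarrow> complex^3 \<Rightarrow> complex^3" where
  "ccross u v = vector [u $ 2 * v $ 3 - u $ 3 * v $ 2, u $ 3 * v $ 1 - u $ 1 * v $ 3, u $ 1 * v $ 2 - u $ 2 * v $ 1]"

text \<open>Components of \<open>\<phi>_z\<close> as a function of the parameter.\<close>

definition phi_z ::
  "('s::topological_space, complex) atlas \<Rightarrow> ('m::topological_space, real^3) atlas \<Rightarrow> 'm metric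
     \<Rightarrow> (3 \<Rightarrow> 'm vfield) \<Rightarrow> ('s \<Rightarrow> 'm) \<Rightarrow> 's set \<Rightarrow> ('s \<Rightarrow> complex) \<Rightarrow> complex \<Rightarrow> complex^3" where
  "phi_z \<S> \<A> ip E \<phi> V \<zeta> w = (let p = inv_into V \<zeta> w in
     (\<chi> k. (complex_of_real (comps ip E (\<phi> p) (pushforward \<A> \<phi> (coord_vector \<S> V \<zeta> p 1)) $ k)
          - \<i> * complex_of_real (comps ip E (\<phi> p) (pushforward \<A> \<phi> (coord_vector \<S> V \<zeta> p \<i>)) $ k)) / 2))"

text \<open>
  Covariant derivatives with respect to \<open>\<partial>_z\<close> and its conjugate of the (complexified) vector field
  along \<phi> with components \<open>Y\<close>. Here \<open>\<Gamma>\<close> gives the connection coefficients at the points of \<phi>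
  and \<open>a\<close> the components of \<open>\<phi>_z\<close>. Since \<phi> enters only through \<open>\<Gamma>\<close>, which is constant by left
  invariance, and \<open>a\<close>, these operators make sense for data \<open>a\<close> that are not known to be
  integrable, that is, to come from a map \<phi>.
\<close>

definition nabla_z ::
  "(complex \<Rightarrow> 3 \<Rightarrow> 3 \<Rightarrow> real^3) \<Rightarrow> (complex \<Rightarrow> complex^3) \<Rightarrow> (complex \<Rightarrow> complex^3) \<Rightarrow> complex \<Rightarrow> complex^3" where
  "nabla_z \<Gamma> a Y w = (\<chi> k. wirt (\<lambda>u. Y u $ k) w) + conn_term (\<Gamma> w) (a w) (Y w)"

definition nabla_zbar ::
  "(complex \<Rightarrow> 3 \<Rightarrow> 3 \<Rightarrow> real^3) \<Rightarrow> (complex \<Rightarrow> complex^3) \<Rightarrow> (complex \<Rightarrow> complex^3) \<Rightarrow> complex \<Rightarrow> complex^3" where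
  "nabla_zbar \<Gamma> a Y w = (\<chi> k. wirt_bar (\<lambda>u. Y u $ k) w) + conn_term (\<Gamma> w) (\<chi> k. cnj (a w $ k)) (Y w)"

definition integrability_equation ::
  "(complex \<Rightarrow> 3 \<Rightarrow> 3 \<Rightarrow> real^3) \<Rightarrow> (complex \<Rightarrow> complex^3) \<Rightarrow> (complex \<Rightarrow> real^3) \<Rightarrow> (complex \<Rightarrow> real)
     \<Rightarrow> complex \<Rightarrow> bool" where
  "integrability_equation \<Gamma> a n K w \<longleftrightarrow>
     ccross (cvec (n w))
       (nabla_z \<Gamma> a (\<lambda>u. (1 / sqrt (K u)) *\<^sub>R nabla_zbar \<Gamma> a (\<lambda>s. cvec (n s)) u) w +
        nabla_zbar \<Gamma> a (\<lambda>u. (1 / sqrt (K u)) *\<^sub>R nabla_z \<Gamma> a (\<lambda>s. cvec (n s)) u) w) = 0"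

definition gauss_map :: "real^3 \<Rightarrow> complex" where
  "gauss_map n = (complex_of_real (n $ 1) + \<i> * complex_of_real (n $ 2)) / complex_of_real (1 - n $ 3)"

subsection \<open>The coefficients of the equation of the Gauss map\<close>

definition BB :: "complex \<Rightarrow> real" where
  "BB g = 1 + (cmod g)\<^sup>2"

definition PP :: "complex \<Rightarrow> real \<Rightarrow> real \<Rightarrow> real \<Rightarrow> real \<Rightarrow> real \<Rightarrow> real" where
  "PP g m0 m1 m2 m3 m4 =
     m0 + m1 * (cmod g)^2 + m2 * (cmod g)^4 + m3 * (cmod g)^6 + m4 * (cmod g)^8"

definition QQ :: "real \<Rightarrow> real \<Rightarrow> complex \<Rightarrow> real" where
  "QQ \<mu>1 \<mu>3 g = PP g \<mu>1 (4 * \<mu>3 - 2 * \<mu>1) \<mu>1 0 0"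

definition DD :: "real \<Rightarrow> real \<Rightarrow> complex \<Rightarrow> real \<Rightarrow> real" where
  "DD \<mu>1 \<mu>3 g x = (BB g)^3 * ((BB g)^4 * x\<^sup>2 + \<mu>1\<^sup>2 * (QQ \<mu>1 \<mu>3 g)\<^sup>2 +
     2 * x * (PP g 1 0 6 0 1 * \<mu>1\<^sup>2 + PP g 0 4 (-8) 4 0 * \<mu>1 * \<mu>3 + 8 * (cmod g)^4 * \<mu>3\<^sup>2))"

text \<open>
  Three signs or constants in \<open>G1\<close> differ from the formula published with this theorem, which has
  \<open>- 32 \<bar>g\<bar>\<^sup>4 (B - 2) \<mu>1 \<mu>3\<^sup>3\<close> in the first numerator instead of \<open>+ 16 \<bar>g\<bar>\<^sup>4 (B - 2) \<mu>1 \<mu>3\<^sup>3\<close>, and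
  opposite signs for the last two terms of the second numerator. Those are misprints: already for
  \<open>\<mu>1 = \<mu>3\<close> (round spheres) \<open>G1\<close> has to be \<open>2 * cnj g / B\<close>, as it is here.
\<close>

definition G1 :: "real \<Rightarrow> real \<Rightarrow> complex \<Rightarrow> real \<Rightarrow> complex" where
  "G1 \<mu>1 \<mu>3 g x = (let B = BB g; P = PP g in
     2 * cnj g * complex_of_real (B^6 * x\<^sup>2 +
         2 * B\<^sup>2 * x * (P 0 4 2 1 1 * \<mu>1\<^sup>2 + P 1 (-5) 1 3 0 * \<mu>1 * \<mu>3 + P 0 5 3 0 0 * \<mu>3\<^sup>2)
         + 16 * (cmod g)^4 * (B - 2) * \<mu>1 * \<mu>3^3) / complex_of_real (DD \<mu>1 \<mu>3 g x)
     - 2 * cnj g * complex_of_real (\<mu>1 * ((1 + 6 * (cmod g)\<^sup>2 - (cmod g)^4 * P 13 (-10) 3 0 1) * \<mu>1^3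
         - 2 * (B - 2) * P (-1) (-6) 18 2 3 * \<mu>1\<^sup>2 * \<mu>3
         - P 0 2 66 (-18) 14 * \<mu>1 * \<mu>3\<^sup>2)) / complex_of_real (DD \<mu>1 \<mu>3 g x))"

definition G2 :: "real \<Rightarrow> real \<Rightarrow> complex \<Rightarrow> real \<Rightarrow> complex" where
  "G2 \<mu>1 \<mu>3 g x = (let B = BB g; P = PP g; Q = QQ \<mu>1 \<mu>3 g in
     2 * \<i> * g * complex_of_real ((B - 2) * (\<mu>3 - \<mu>1)) *
       (complex_of_real (2 * B^4 * x\<^sup>2 + B^4 * x * \<mu>1\<^sup>2)
        - \<i> * complex_of_real (B\<^sup>2 * sqrt x * (x + \<mu>1\<^sup>2) * P \<mu>1 (2 * \<mu>3) \<mu>1 0 0)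
        - complex_of_real (\<mu>1\<^sup>2 * Q\<^sup>2))
     / complex_of_real (B^3 * sqrt x * (x + \<mu>1\<^sup>2) * (B^4 * x + Q\<^sup>2)))"

definition G3 :: "real \<Rightarrow> real \<Rightarrow> complex \<Rightarrow> real \<Rightarrow> complex" where
  "G3 \<mu>1 \<mu>3 g x = (let B = BB g; P = PP g; Q = QQ \<mu>1 \<mu>3 g in
     2 * \<i> * g * complex_of_real ((B - 2) * (\<mu>1 - \<mu>3)) *
       (complex_of_real (2 * B^4 * x\<^sup>2 + B^4 * x * \<mu>1\<^sup>2)
        + \<i> * complex_of_real (B\<^sup>2 * sqrt x * (x + \<mu>1\<^sup>2) * P \<mu>1 (2 * \<mu>3) \<mu>1 0 0)
        - complex_of_real (\<mu>1\<^sup>2 * Q\<^sup>2))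
     / complex_of_real (B^3 * sqrt x * (x + \<mu>1\<^sup>2) * (B^4 * x + Q\<^sup>2)))"

definition G4 :: "real \<Rightarrow> real \<Rightarrow> complex \<Rightarrow> real \<Rightarrow> complex" where
  "G4 \<mu>1 \<mu>3 g x = (let B = BB g; P = PP g; Q = QQ \<mu>1 \<mu>3 g in
     - (4 * g^3 * complex_of_real ((B - 2) * (\<mu>1 - \<mu>3)\<^sup>2 *
          (- 3 * B\<^sup>2 * x + P (\<mu>1\<^sup>2) (8 * \<mu>1 * \<mu>3 - 6 * \<mu>1\<^sup>2) (\<mu>1\<^sup>2) 0 0)))
     / complex_of_real (B^3 * (x + \<mu>1\<^sup>2) * (B^4 * x + Q\<^sup>2)))"

definition G5 :: "real \<Rightarrow> real \<Rightarrow> complex \<Rightarrow> real \<Rightarrow> complex" where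
  "G5 \<mu>1 \<mu>3 g x = (let B = BB g; Q = QQ \<mu>1 \<mu>3 g in
     complex_of_real (B\<^sup>2 * x + \<mu>1 * Q) /
       (4 * complex_of_real x * (complex_of_real (sqrt x) + \<i> * complex_of_real \<mu>1)
          * (complex_of_real (B\<^sup>2 * sqrt x) + \<i> * complex_of_real Q)))"

text \<open>
  \<open>G8\<close> is the conjugate of \<open>G6\<close> only in the sense that the factor \<open>g\<^sup>2\<close> is kept and its cofactor
  is conjugated; the equation fails if \<open>g\<^sup>2\<close> is conjugated as well.
\<close>

definition G6_cofactor :: "real \<Rightarrow> real \<Rightarrow> complex \<Rightarrow> real \<Rightarrow> complex" where
  "G6_cofactor \<mu>1 \<mu>3 g x = (let B = BB g; Q = QQ \<mu>1 \<mu>3 g in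
     - (\<i> * complex_of_real (\<mu>1 - \<mu>3)) /
       (complex_of_real (sqrt x) * (complex_of_real (sqrt x) + \<i> * complex_of_real \<mu>1)
          * (complex_of_real (B\<^sup>2 * sqrt x) + \<i> * complex_of_real Q)))"

definition G6 :: "real \<Rightarrow> real \<Rightarrow> complex \<Rightarrow> real \<Rightarrow> complex" where
  "G6 \<mu>1 \<mu>3 g x = g\<^sup>2 * G6_cofactor \<mu>1 \<mu>3 g x"

definition G7 :: "real \<Rightarrow> real \<Rightarrow> complex \<Rightarrow> real \<Rightarrow> complex" where
  "G7 \<mu>1 \<mu>3 g x = cnj (G5 \<mu>1 \<mu>3 g x)"

definition G8 :: "real \<Rightarrow> real \<Rightarrow> complex \<Rightarrow> real \<Rightarrow> complex" where
  "G8 \<mu>1 \<mu>3 g x = g\<^sup>2 * cnj (G6_cofactor \<mu>1 \<mu>3 g x)"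

definition gauss_equation ::
  "real \<Rightarrow> real \<Rightarrow> (complex \<Rightarrow> complex) \<Rightarrow> (complex \<Rightarrow> real) \<Rightarrow> complex \<Rightarrow> bool" where
  "gauss_equation \<mu>1 \<mu>3 g K w \<longleftrightarrow>
     (let gz = wirt g w; gzb = wirt_bar g w;
          cgz = wirt (\<lambda>u. cnj (g u)) w; cgzb = wirt_bar (\<lambda>u. cnj (g u)) w;
          Kz = wirt (\<lambda>u. complex_of_real (K u)) w; Kzb = wirt_bar (\<lambda>u. complex_of_real (K u)) w;
          c = (\<lambda>G. G \<mu>1 \<mu>3 (g w) (K w))
      in wirt_bar (wirt g) w =
           c G1 * gz * gzb + c G2 * gz * cgzb + c G3 * cgz * gzb + c G4 * cgz * cgzb +
           c G5 * Kz * gzb + c G6 * Kz * cgzb + c G7 * Kzb * gz + c G8 * Kzb * cgz)"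

end

theory Submission
  imports Defs
begin

text \<open>
  Stereographic projection gives the null vector \<open>\<epsilon> = (1 - g\<^sup>2, - \<i> (1 + g\<^sup>2), 2 g)\<close>, with \<open>g\<close> conjugated,
  tangent to the sphere at \<open>N\<close>: \<open>N \<times> \<epsilon> = - \<i> \<epsilon>\<close>, and \<open>N\<^sub>z\<close> is a combination of \<open>\<epsilon>\<close> and its conjugate.
  In a unimodular group \<open>\<nabla>\<^sub>a E\<^sub>i = (M a) \<times> E\<^sub>i\<close> with \<open>M = diag (\<mu>\<^sub>1, \<mu>\<^sub>2, \<mu>\<^sub>3)\<close>, so \<open>\<phi>\<^sub>z = \<i> / \<surd>K N \<times> \<nabla>\<^sub>z N\<close> is a
  complex linear 2 by 2 system for the coefficients of \<open>\<phi>\<^sub>z\<close>, whose determinant has positive real-part factors.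
  The integrability equation says that the real vector \<open>2 Re (\<nabla>_{z bar} (\<nabla>\<^sub>z N / \<surd>K))\<close> is normal, that is, orthogonal
  to \<open>\<epsilon>\<close>; this is one complex equation \<open>u X + v X bar = 0\<close> for the difference \<open>X\<close> of the two sides of the equation of
  the Gauss map, with \<open>\<bar>u\<bar> \<noteq> \<bar>v\<bar>\<close>, hence it is equivalent to that equation.
  For an immersion \<open>\<nabla>\<^sub>x N = \<surd>K N \<times> \<phi>\<^sub>y\<close> and \<open>\<nabla>\<^sub>y N = - \<surd>K N \<times> \<phi>\<^sub>x\<close>, and integrability is the vanishing of the torsion.
\<close>

subsection \<open>Functions of class C^k\<close>

text \<open>The formula for \<open>phi_z\<close> is circular: the covariant derivative of N on its
  right side contains \<open>phi_z\<close> through the connection. It has to be solved before a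
  second derivative can be taken, which is why the inverse of the 2 by 2 system and its partial
  derivatives are computed in closed form. The coefficients of the final equation are given, so
  nothing is solved for at the end: they are substituted, and the coefficients of the monomials in
  the first derivatives of g and K are compared. The conjugate equation also enters and couples the
  coefficients in pairs. The equivalence concerns data \<open>n\<close>, \<open>k\<close>,
  \<open>a\<close> on an open set of the plane, not an immersion, because such data need not be
  integrable; an immersion is one source of them. For that source the obstacle is regularity:
  tangent vectors are derivations and K is the determinant of a shape operator given point by point,
  so the smoothness of the components and of K has to be derived.\<close>

lemma frechet_derivative_eqI:
  "(f has_derivative f') (at x) \<Longrightarrow> frechet_derivative f (at x) = f'"
  using frechet_derivative_at by metis

lemma Ck_on_cong:
  assumes "open S" "\<And>x. x \<in> S \<Longrightarrow> f x = g x" "Ck_on k S f"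
  shows "Ck_on k S g"
  using assms(2,3)
proof (induction k arbitrary: f g)
  case 0
  then show ?case by (simp cong: continuous_on_cong)
next
  case (Suc k)
  have D: "(g has_derivative frechet_derivative f (at x)) (at x)" if "x \<in> S" for x
    using that Suc.prems assms(1) has_derivative_transform_within_open[of f _ x UNIV S g]
    by (auto simp: frechet_derivative_works)
  have eq: "frechet_derivative g (at x) = frechet_derivative f (at x)" if "x \<in> S" for x
    using frechet_derivative_eqI[OF D[OF that]] .
  have "Ck_on k S (\<lambda>x. frechet_derivative g (at x) v)" for v
    using Suc.IH[of "\<lambda>x. frechet_derivative f (at x) v"] Suc.prems eq by auto
  then show ?case using D by (auto simp: differentiable_def)
qed

lemma Ck_on_subset: "Ck_on k S f \<Longrightarrow> T \<subseteq> S \<Longrightarrow> Ck_on k T f"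
  by (induction k arbitrary: f) (auto intro: continuous_on_subset)

lemma Ck_on_Suc_imp: "Ck_on (Suc k) S f \<Longrightarrow> Ck_on k S f"
proof (induction k arbitrary: f)
  case 0
  then show ?case
    by (auto intro!: differentiable_imp_continuous_on simp: differentiable_on_def differentiable_at_withinI)
qed auto

lemma Ck_on_Suc_I:
  assumes "open S" "\<And>x. x \<in> S \<Longrightarrow> (f has_derivative f' x) (at x)" "\<And>v. Ck_on k S (\<lambda>x. f' x v)"
  shows "Ck_on (Suc k) S f"
proof -
  have "Ck_on k S (\<lambda>x. frechet_derivative f (at x) v)" for v
    by (rule Ck_on_cong[OF assms(1) _ assms(3)[of v]]) (use assms(2) frechet_derivative_eqI in metis)
  then show ?thesis using assms(2) by (auto simp: differentiable_def)
qed

lemma Ck_on_Suc_D: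
  assumes "Ck_on (Suc k) S f" "x \<in> S"
  shows "(f has_derivative frechet_derivative f (at x)) (at x)"
  using assms by (simp add: frechet_derivative_works)

lemma Ck_on_const: "open S \<Longrightarrow> Ck_on k S (\<lambda>x. c)"
proof (induction k arbitrary: c)
  case (Suc k)
  show ?case by (rule Ck_on_Suc_I[where f'="\<lambda>x v. 0"]) (use Suc in auto)
qed simp

lemma Ck_on_bounded_linear:
  assumes "open S" "bounded_linear h" "Ck_on k S f"
  shows "Ck_on k S (\<lambda>x. h (f x))"
  using assms(3)
proof (induction k arbitrary: f)
  case 0
  then show ?case using assms(2) by (auto intro: bounded_linear.continuous_on)
next
  case (Suc k)
  show ?case
    by (rule Ck_on_Suc_I[OF assms(1), where f'="\<lambda>x v. h (frechet_derivative f (at x) v)"])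
      (use Suc assms(2) in \<open>auto intro!: bounded_linear.has_derivative[OF assms(2)] Ck_on_Suc_D[OF Suc.prems]\<close>)
qed

lemma Ck_on_linear:
  assumes "open S" "bounded_linear h"
  shows "Ck_on k S h"
proof (cases k)
  case 0
  then show ?thesis using assms(2) linear_continuous_on by auto
next
  case (Suc j)
  show ?thesis unfolding Suc
    by (rule Ck_on_Suc_I[where f'="\<lambda>x. h"]) 
      (use assms in \<open>auto intro: Ck_on_const bounded_linear_imp_has_derivative\<close>)
qed

lemma Ck_on_add:
  assumes "open S" "Ck_on k S f" "Ck_on k S g"
  shows "Ck_on k S (\<lambda>x. f x + g x)"
  using assms(2,3)
proof (induction k arbitrary: f g)
  case 0
  then show ?case by (auto intro: continuous_on_add)
next
  case (Suc k)
  show ?case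
    by (rule Ck_on_Suc_I[OF assms(1), where f'="\<lambda>x v. frechet_derivative f (at x) v + frechet_derivative g (at x) v"])
      (use Suc in \<open>auto intro!: has_derivative_add Ck_on_Suc_D\<close>)
qed

lemma Ck_on_minus: "open S \<Longrightarrow> Ck_on k S f \<Longrightarrow> Ck_on k S (\<lambda>x. - f x)"
  using Ck_on_bounded_linear[OF _ bounded_linear_minus[OF bounded_linear_ident]] by auto

lemma Ck_on_diff:
  "open S \<Longrightarrow> Ck_on k S f \<Longrightarrow> Ck_on k S g \<Longrightarrow> Ck_on k S (\<lambda>x. f x - g x)"
  using Ck_on_add[of S k f "\<lambda>x. - g x"] Ck_on_minus[of S k g] by simp

lemma Ck_on_sum:
  "open S \<Longrightarrow> (\<And>i. i \<in> I \<Longrightarrow> Ck_on k S (f i)) \<Longrightarrow> Ck_on k S (\<lambda>x. \<Sum>i\<in>I. f i x)"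
  by (induction I rule: infinite_finite_induct) (auto intro: Ck_on_const Ck_on_add)

lemma Ck_on_bilinear:
  assumes "open S" "bounded_bilinear p" "Ck_on k S f" "Ck_on k S g"
  shows "Ck_on k S (\<lambda>x. p (f x) (g x))"
  using assms(3,4)
proof (induction k arbitrary: f g)
  case 0
  then show ?case using assms(2) by (auto intro: bounded_bilinear.continuous_on)
next
  case (Suc k)
  show ?case
  proof (rule Ck_on_Suc_I[OF assms(1)])
    show "((\<lambda>x. p (f x) (g x)) has_derivative
       (\<lambda>v. p (f x) (frechet_derivative g (at x) v) + p (frechet_derivative f (at x) v) (g x))) (at x)"
      if "x \<in> S" for x
      using bounded_bilinear.FDERIV[OF assms(2) Ck_on_Suc_D[OF Suc.prems(1) that] Ck_on_Suc_D[OF Suc.prems(2) that]] .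
    show "Ck_on k S (\<lambda>x. p (f x) (frechet_derivative g (at x) v) + p (frechet_derivative f (at x) v) (g x))" for v
      using Suc assms(1) Ck_on_Suc_imp[OF Suc.prems(1)] Ck_on_Suc_imp[OF Suc.prems(2)] by (auto intro!: Ck_on_add)
  qed
qed

lemmas Ck_on_mult = Ck_on_bilinear[OF _ bounded_bilinear_mult]
lemmas Ck_on_scaleR = Ck_on_bilinear[OF _ bounded_bilinear_scaleR]

text \<open>The derivative \<open>- inverse f * f' * inverse f\<close> contains the same reciprocal
  at one order less, so the induction keeps \<open>f\<close> fixed.\<close>

lemma Ck_on_inverse:
  fixes f :: "'a::euclidean_space \<Rightarrow> 'b::real_normed_field"
  assumes "open S" "Ck_on k S f" "\<And>x. x \<in> S \<Longrightarrow> f x \<noteq> 0"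
  shows "Ck_on k S (\<lambda>x. inverse (f x))"
  using assms(2)
proof (induction k)
  case 0
  then show ?case using assms(3) by (auto intro!: continuous_on_inverse)
next
  case (Suc k)
  show ?case
  proof (rule Ck_on_Suc_I[OF assms(1)])
    show "((\<lambda>x. inverse (f x)) has_derivative
       (\<lambda>v. - (inverse (f x) * frechet_derivative f (at x) v * inverse (f x)))) (at x)"
      if "x \<in> S" for x
      using Deriv.has_derivative_inverse[OF assms(3)[OF that] Ck_on_Suc_D[OF Suc.prems that]] .
    show "Ck_on k S (\<lambda>x. - (inverse (f x) * frechet_derivative f (at x) v * inverse (f x)))" for v
      using Suc assms(1) Ck_on_Suc_imp[OF Suc.prems] by (auto intro!: Ck_on_mult Ck_on_minus)
  qed
qed

text \<open>The derivative of the composition evaluates the derivative of \<open>g\<close> in the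
  moving direction \<open>?f' x v\<close>, whereas \<open>Ck_on\<close> controls fixed directions
  only. Expansion in the basis turns it into a finite sum of products, and the induction hypothesis
  applies to each basis direction.\<close>

lemma Ck_on_compose:
  fixes f :: "'a::euclidean_space \<Rightarrow> 'b::euclidean_space" and g :: "'b \<Rightarrow> 'c::real_normed_vector"
  assumes "open S" "f ` S \<subseteq> T" "Ck_on k T g" "Ck_on k S f"
  shows "Ck_on k S (\<lambda>x. g (f x))"
  using assms(3,4)
proof (induction k arbitrary: g)
  case 0
  then show ?case using assms(2) continuous_on_compose2 by auto
next
  case (Suc k)
  let ?f' = "\<lambda>x. frechet_derivative f (at x)" and ?g' = "\<lambda>y. frechet_derivative g (at y)"
  show ?case
  proof (rule Ck_on_Suc_I[OF assms(1)])
    fix x assume x: "x \<in> S"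
    have f: "(f has_derivative ?f' x) (at x)" using Ck_on_Suc_D[OF Suc.prems(2) x] .
    have g: "(g has_derivative ?g' (f x)) (at (f x))" using Ck_on_Suc_D[OF Suc.prems(1)] x assms(2) by auto
    interpret g: bounded_linear "?g' (f x)" using g has_derivative_bounded_linear by blast
    have "(\<lambda>v. ?g' (f x) (?f' x v)) = (\<lambda>v. \<Sum>b\<in>Basis. (?f' x v \<bullet> b) *\<^sub>R ?g' (f x) b)"
    proof
      fix v
      have "?g' (f x) (?f' x v) = ?g' (f x) (\<Sum>b\<in>Basis. (?f' x v \<bullet> b) *\<^sub>R b)"
        by (simp only: euclidean_representation)
      also have "\<dots> = (\<Sum>b\<in>Basis. (?f' x v \<bullet> b) *\<^sub>R ?g' (f x) b)" by (simp add: g.sum g.scaleR)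
      finally show "?g' (f x) (?f' x v) = (\<Sum>b\<in>Basis. (?f' x v \<bullet> b) *\<^sub>R ?g' (f x) b)" .
    qed
    then show "((\<lambda>x. g (f x)) has_derivative (\<lambda>v. \<Sum>b\<in>Basis. (?f' x v \<bullet> b) *\<^sub>R ?g' (f x) b)) (at x)"
      using has_derivative_compose[OF f g] by simp
  next
    fix v
    show "Ck_on k S (\<lambda>x. \<Sum>b\<in>Basis. (?f' x v \<bullet> b) *\<^sub>R ?g' (f x) b)"
    proof (intro Ck_on_sum Ck_on_scaleR assms(1))
      fix b :: 'b
      show "Ck_on k S (\<lambda>x. ?f' x v \<bullet> b)"
        using Suc.prems(2) by (intro Ck_on_bounded_linear[OF assms(1) bounded_linear_inner_left]) simp
      show "Ck_on k S (\<lambda>x. ?g' (f x) b)"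
        using Suc.IH[of "\<lambda>y. ?g' y b"] Suc.prems Ck_on_Suc_imp[OF Suc.prems(2)] by simp
    qed
  qed
qed

subsection \<open>Symmetry of second derivatives\<close>

text \<open>The second difference is symmetric in \<open>u\<close> and \<open>v\<close>. The mean
  value theorem, used once in each direction, identifies it with a mixed derivative at a nearby
  point; exchanging \<open>u\<close> and \<open>v\<close> then gives the other mixed
  derivative.\<close>

lemma second_difference_mvt:
  fixes f :: "'a::euclidean_space \<Rightarrow> real"
  assumes "Ck_on 2 (ball x e) f" "norm u + norm v < e / h" "0 < h"
  shows "\<exists>y. dist y x \<le> h * (norm u + norm v) \<and>
     f (x + h *\<^sub>R u + h *\<^sub>R v) - f (x + h *\<^sub>R u) - f (x + h *\<^sub>R v) + f x
       = h^2 * frechet_derivative (\<lambda>y. frechet_derivative f (at y) u) (at y) v"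
proof -
  let ?D = "\<lambda>y. frechet_derivative f (at y)" and ?D2 = "\<lambda>y. frechet_derivative (\<lambda>z. frechet_derivative f (at z) u) (at y)"
  have C2: "Ck_on (Suc (Suc 0)) (ball x e) f" using assms(1) by (simp add: numeral_2_eq_2)
  then have C1: "Ck_on (Suc 0) (ball x e) (\<lambda>y. ?D y u)" by simp
  have hb: "h * (norm u + norm v) < e" using assms(2,3) by (simp add: field_simps)
  have near: "dist (x + s *\<^sub>R u + t *\<^sub>R v) x \<le> h * (norm u + norm v)" if "0 \<le> s" "s \<le> h" "0 \<le> t" "t \<le> h" for s t
  proof -
    have "norm (s *\<^sub>R u + t *\<^sub>R v) \<le> s * norm u + t * norm v" using that norm_triangle_ineq[of "s *\<^sub>R u" "t *\<^sub>R v"] by simp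
    also have "\<dots> \<le> h * norm u + h * norm v" using that by (intro add_mono mult_right_mono) auto
    finally show ?thesis by (simp add: dist_norm algebra_simps)
  qed
  then have inb: "x + s *\<^sub>R u + t *\<^sub>R v \<in> ball x e" if "0 \<le> s" "s \<le> h" "0 \<le> t" "t \<le> h" for s t
    using that hb by (force simp: dist_commute)
  have df: "((\<lambda>s. f (x + s *\<^sub>R u + t *\<^sub>R v)) has_real_derivative ?D (x + s *\<^sub>R u + t *\<^sub>R v) u) (at s)"
    if "0 \<le> s" "s \<le> h" "0 \<le> t" "t \<le> h" for s t
  proof -
    have d: "(f has_derivative ?D (x + s *\<^sub>R u + t *\<^sub>R v)) (at (x + s *\<^sub>R u + t *\<^sub>R v))"
      using Ck_on_Suc_D[OF C2 inb[OF that]] .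
    interpret bounded_linear "?D (x + s *\<^sub>R u + t *\<^sub>R v)" using d has_derivative_bounded_linear by blast
    have "((\<lambda>s. x + s *\<^sub>R u + t *\<^sub>R v) has_derivative (\<lambda>\<sigma>. \<sigma> *\<^sub>R u)) (at s)"
      by (auto intro!: derivative_eq_intros)
    from has_derivative_compose[OF this d] show ?thesis
      by (simp add: scaleR has_field_derivative_def mult.commute[of _ "?D _ u"] mult_commute_abs)
  qed
  have dD: "((\<lambda>t. ?D (x + s *\<^sub>R u + t *\<^sub>R v) u) has_real_derivative ?D2 (x + s *\<^sub>R u + t *\<^sub>R v) v) (at t)"
    if "0 \<le> s" "s \<le> h" "0 \<le> t" "t \<le> h" for s t
  proof -
    have d: "((\<lambda>y. ?D y u) has_derivative ?D2 (x + s *\<^sub>R u + t *\<^sub>R v)) (at (x + s *\<^sub>R u + t *\<^sub>R v))"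
      using Ck_on_Suc_D[OF C1 inb[OF that]] .
    interpret bounded_linear "?D2 (x + s *\<^sub>R u + t *\<^sub>R v)" using d has_derivative_bounded_linear by blast
    have "((\<lambda>t. x + s *\<^sub>R u + t *\<^sub>R v) has_derivative (\<lambda>\<sigma>. \<sigma> *\<^sub>R v)) (at t)"
      by (auto intro!: derivative_eq_intros)
    from has_derivative_compose[OF this d] show ?thesis
      by (simp add: scaleR has_field_derivative_def mult.commute[of _ "?D2 _ v"] mult_commute_abs)
  qed
  \<comment> \<open>The theorem is applied to the increment in \<open>v\<close> as a function of the
    coefficient of \<open>u\<close>. The terms \<open>0 *\<^sub>R v\<close> keep both halves in the
    shape covered by \<open>df\<close>.\<close>
  have "\<exists>s. 0 < s \<and> s < h \<and> (f (x + h *\<^sub>R u + h *\<^sub>R v) - f (x + h *\<^sub>R u + 0 *\<^sub>R v)) - (f (x + 0 *\<^sub>R u + h *\<^sub>R v) - f (x + 0 *\<^sub>R u + 0 *\<^sub>R v))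
     = (h - 0) * (?D (x + s *\<^sub>R u + h *\<^sub>R v) u - ?D (x + s *\<^sub>R u + 0 *\<^sub>R v) u)"
    using assms(3) by (intro MVT2[where f="\<lambda>s. f (x + s *\<^sub>R u + h *\<^sub>R v) - f (x + s *\<^sub>R u + 0 *\<^sub>R v)"] DERIV_diff df) auto
  then obtain s where s: "0 < s" "s < h"
    "f (x + h *\<^sub>R u + h *\<^sub>R v) - f (x + h *\<^sub>R u) - f (x + h *\<^sub>R v) + f x
     = h * (?D (x + s *\<^sub>R u + h *\<^sub>R v) u - ?D (x + s *\<^sub>R u + 0 *\<^sub>R v) u)" by auto
  have "\<exists>t. 0 < t \<and> t < h \<and> ?D (x + s *\<^sub>R u + h *\<^sub>R v) u - ?D (x + s *\<^sub>R u + 0 *\<^sub>R v) u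
     = (h - 0) * ?D2 (x + s *\<^sub>R u + t *\<^sub>R v) v"
    using assms(3) s by (intro MVT2 dD) auto
  then obtain t where t: "0 < t" "t < h" "?D (x + s *\<^sub>R u + h *\<^sub>R v) u - ?D (x + s *\<^sub>R u + 0 *\<^sub>R v) u
     = h * ?D2 (x + s *\<^sub>R u + t *\<^sub>R v) v" by auto
  show ?thesis
    using s t near[of s t] by (intro exI[of _ "x + s *\<^sub>R u + t *\<^sub>R v"]) (simp add: power2_eq_square)
qed

lemma second_derivative_symmetric_real:
  fixes f :: "'a::euclidean_space \<Rightarrow> real"
  assumes "open S" "Ck_on 2 S f" "x \<in> S"
  shows "frechet_derivative (\<lambda>y. frechet_derivative f (at y) u) (at x) v =
         frechet_derivative (\<lambda>y. frechet_derivative f (at y) v) (at x) u" (is "?F u v x = ?F v u x")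
proof (rule ccontr)
  let ?F = "\<lambda>u v y. frechet_derivative (\<lambda>y. frechet_derivative f (at y) u) (at y) v"
  assume "?F u v x \<noteq> ?F v u x"
  \<comment> \<open>Half of the supposed gap: at the points \<open>y\<close> and \<open>z\<close>
    found below the two mixed derivatives agree, and each is closer than this to its value at
    \<open>x\<close>.\<close>
  define \<epsilon> where "\<epsilon> = \<bar>?F u v x - ?F v u x\<bar> / 2"
  have \<epsilon>: "\<epsilon> > 0" using \<open>?F u v x \<noteq> ?F v u x\<close> by (simp add: \<epsilon>_def)
  have cont: "isCont (?F u v) x" for u v
  proof -
    have "continuous_on S (?F u v)" using assms(2) by (simp add: numeral_2_eq_2)
    then show ?thesis using assms(1,3) by (simp add: continuous_on_eq_continuous_at)
  qed
  obtain d1 where d1: "d1 > 0" "\<And>y. dist y x < d1 \<Longrightarrow> \<bar>?F u v y - ?F u v x\<bar> < \<epsilon>"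
    using cont[of u v] \<epsilon> unfolding continuous_at_eps_delta dist_real_def by blast
  obtain d2 where d2: "d2 > 0" "\<And>y. dist y x < d2 \<Longrightarrow> \<bar>?F v u y - ?F v u x\<bar> < \<epsilon>"
    using cont[of v u] \<epsilon> unfolding continuous_at_eps_delta dist_real_def by blast
  obtain d3 where d3: "d3 > 0" "ball x d3 \<subseteq> S" using assms(1,3) open_contains_ball by blast
  define d where "d = min d1 (min d2 d3)"
  have d: "d > 0" "d \<le> d1" "d \<le> d2" "ball x d \<subseteq> S" using d1 d2 d3 by (auto simp: d_def)
  \<comment> \<open>This step keeps all points of the second difference within \<open>d\<close> of
    \<open>x\<close>; the summand 1 covers the case \<open>u = v = 0\<close>.\<close>
  define h where "h = d / (2 * (norm u + norm v + 1))"
  have h: "h > 0" using d(1) by (auto simp: h_def intro!: divide_pos_pos add_nonneg_pos)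
  have n1: "norm u + norm v + 1 > 0" by (simp add: add_nonneg_pos)
  have "h * (norm u + norm v + 1) = d / 2" using n1 by (simp add: h_def field_simps)
  then have hd: "h * (norm u + norm v) < d" using d(1) h by (simp add: algebra_simps)
  then have hd': "norm u + norm v < d / h" "norm v + norm u < d / h" using h by (simp_all add: field_simps)
  have C: "Ck_on 2 (ball x d) f" using assms(2) d(4) Ck_on_subset by blast
  obtain y where y: "dist y x \<le> h * (norm u + norm v)"
     "f (x + h *\<^sub>R u + h *\<^sub>R v) - f (x + h *\<^sub>R u) - f (x + h *\<^sub>R v) + f x = h^2 * ?F u v y"
    using second_difference_mvt[OF C hd'(1) h] by blast
  obtain z where z: "dist z x \<le> h * (norm v + norm u)"
     "f (x + h *\<^sub>R v + h *\<^sub>R u) - f (x + h *\<^sub>R v) - f (x + h *\<^sub>R u) + f x = h^2 * ?F v u z"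
    using second_difference_mvt[OF C hd'(2) h] by blast
  have "h^2 * ?F u v y = h^2 * ?F v u z" using y(2) z(2) by (simp add: algebra_simps)
  then have "?F u v y = ?F v u z" using h by simp
  moreover have "\<bar>?F u v y - ?F u v x\<bar> < \<epsilon>" using d1(2)[of y] y(1) hd d by linarith
  moreover have "\<bar>?F v u z - ?F v u x\<bar> < \<epsilon>" using d2(2)[of z] z(1) hd d by (simp add: add.commute)
  ultimately show False unfolding \<epsilon>_def by (simp add: abs_if split: if_splits)
qed

lemma second_derivative_symmetric:
  fixes f :: "'a::euclidean_space \<Rightarrow> 'b::euclidean_space"
  assumes "open S" "Ck_on 2 S f" "x \<in> S"
  shows "frechet_derivative (\<lambda>y. frechet_derivative f (at y) u) (at x) v =
         frechet_derivative (\<lambda>y. frechet_derivative f (at y) v) (at x) u"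
proof (rule euclidean_eqI)
  fix b :: 'b assume "b \<in> Basis"
  let ?h = "\<lambda>y. f y \<bullet> b"
  have C: "Ck_on (Suc (Suc 0)) S f" using assms(2) by (simp add: numeral_2_eq_2)
  have 1: "frechet_derivative ?h (at y) u = frechet_derivative f (at y) u \<bullet> b" if "y \<in> S" for y u
    using frechet_derivative_eqI[OF bounded_linear.has_derivative[OF bounded_linear_inner_left Ck_on_Suc_D[OF C that]], of b]
    by simp
  have 2: "frechet_derivative (\<lambda>y. frechet_derivative ?h (at y) u) (at x) v
      = frechet_derivative (\<lambda>y. frechet_derivative f (at y) u) (at x) v \<bullet> b" for u v
  proof -
    have "Ck_on (Suc 0) S (\<lambda>y. frechet_derivative f (at y) u)" using C by simp
    from bounded_linear.has_derivative[OF bounded_linear_inner_left Ck_on_Suc_D[OF this assms(3)], of b]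
    have "((\<lambda>y. frechet_derivative ?h (at y) u) has_derivative
       (\<lambda>v. frechet_derivative (\<lambda>y. frechet_derivative f (at y) u) (at x) v \<bullet> b)) (at x)"
      by (rule has_derivative_transform_within_open[OF _ assms(1,3)]) (simp add: 1)
    then show ?thesis using frechet_derivative_eqI by metis
  qed
  show "frechet_derivative (\<lambda>y. frechet_derivative f (at y) u) (at x) v \<bullet> b =
         frechet_derivative (\<lambda>y. frechet_derivative f (at y) v) (at x) u \<bullet> b"
    unfolding 2[symmetric]
    by (rule second_derivative_symmetric_real[OF assms(1) _ assms(3)])
      (rule Ck_on_bounded_linear[OF assms(1) bounded_linear_inner_left assms(2)])
qed

subsection \<open>Wirtinger derivatives\<close>

text \<open>Real differentiability, with the differential split into its complex linear and
  conjugate linear parts. Both Wirtinger derivatives travel together because conjugation exchanges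
  them.\<close>

definition has_wirt :: "(complex \<Rightarrow> complex) \<Rightarrow> complex \<Rightarrow> complex \<Rightarrow> complex \<Rightarrow> bool" where
  "has_wirt f w p q \<longleftrightarrow> (f has_derivative (\<lambda>h. p * h + q * cnj h)) (at w)"

lemma has_wirtD:
  assumes "has_wirt f w p q"
  shows "wirt f w = p" "wirt_bar f w = q"
proof -
  have "frechet_derivative f (at w) = (\<lambda>h. p * h + q * cnj h)"
    using assms frechet_derivative_eqI unfolding has_wirt_def by blast
  then show "wirt f w = p" "wirt_bar f w = q"
    by (simp_all add: wirt_def wirt_bar_def algebra_simps)
qed

lemma linear_complex_wirt:
  assumes "bounded_linear D"
  shows "D = (\<lambda>h. ((D 1 - \<i> * D \<i>) / 2) * h + ((D 1 + \<i> * D \<i>) / 2) * cnj h)"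
proof
  fix h :: complex
  interpret bounded_linear D by fact
  have "h = Re h *\<^sub>R 1 + Im h *\<^sub>R \<i>" by (simp add: complex_eq_iff)
  then have "D h = D (Re h *\<^sub>R 1 + Im h *\<^sub>R \<i>)" by (rule arg_cong)
  also have "\<dots> = of_real (Re h) * D 1 + of_real (Im h) * D \<i>"
    by (simp only: add scaleR) (simp add: scaleR_conv_of_real)
  also have "\<dots> = ((D 1 - \<i> * D \<i>) / 2) * h + ((D 1 + \<i> * D \<i>) / 2) * cnj h"
    by (auto simp: complex_eq_iff field_simps)
  finally show "D h = ((D 1 - \<i> * D \<i>) / 2) * h + ((D 1 + \<i> * D \<i>) / 2) * cnj h" .
qed

lemma has_wirtI:
  assumes "(f has_derivative D) (at w)"
  shows "has_wirt f w (wirt f w) (wirt_bar f w)"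
  using assms linear_complex_wirt[OF has_derivative_bounded_linear[OF assms]] frechet_derivative_eqI[OF assms]
  unfolding has_wirt_def wirt_def wirt_bar_def by simp

lemma has_wirt_cong:
  "has_wirt f w p q \<Longrightarrow> open S \<Longrightarrow> w \<in> S \<Longrightarrow> (\<And>u. u \<in> S \<Longrightarrow> f u = g u) \<Longrightarrow> has_wirt g w p q"
  unfolding has_wirt_def using has_derivative_transform_within_open by blast

lemma has_wirt_const: "has_wirt (\<lambda>u. c) w 0 0"
  by (simp add: has_wirt_def)

lemma has_wirt_add:
  "has_wirt f w p q \<Longrightarrow> has_wirt g w p' q' \<Longrightarrow> has_wirt (\<lambda>u. f u + g u) w (p + p') (q + q')"
  unfolding has_wirt_def by (drule has_derivative_add, assumption) (simp add: algebra_simps)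

lemma has_wirt_mult:
  "has_wirt f w p q \<Longrightarrow> has_wirt g w p' q' \<Longrightarrow>
   has_wirt (\<lambda>u. f u * g u) w (p * g w + f w * p') (q * g w + f w * q')"
  unfolding has_wirt_def by (drule has_derivative_mult, assumption) (simp add: algebra_simps)

lemma has_wirt_cmult: "has_wirt f w p q \<Longrightarrow> has_wirt (\<lambda>u. c * f u) w (c * p) (c * q)"
  using has_wirt_mult[OF has_wirt_const] by fastforce

lemma has_wirt_diff:
  "has_wirt f w p q \<Longrightarrow> has_wirt g w p' q' \<Longrightarrow> has_wirt (\<lambda>u. f u - g u) w (p - p') (q - q')"
  using has_wirt_add[OF _ has_wirt_cmult[of g w p' q' "-1"]] by fastforce

lemma has_wirt_cnj: "has_wirt f w p q \<Longrightarrow> has_wirt (\<lambda>u. cnj (f u)) w (cnj q) (cnj p)"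
  unfolding has_wirt_def
  by (drule bounded_linear.has_derivative[OF bounded_linear_cnj]) (simp add: add.commute)

lemma has_wirt_inverse:
  assumes "has_wirt f w p q" "f w \<noteq> 0"
  shows "has_wirt (\<lambda>u. inverse (f u)) w (- (p / (f w)^2)) (- (q / (f w)^2))"
proof -
  have "((\<lambda>u. inverse (f u)) has_derivative (\<lambda>h. - (inverse (f w) * (p * h + q * cnj h) * inverse (f w)))) (at w)"
    using Deriv.has_derivative_inverse[of f w, OF assms(2)] assms(1) unfolding has_wirt_def by blast
  moreover have "(\<lambda>h. - (inverse (f w) * (p * h + q * cnj h) * inverse (f w)))
      = (\<lambda>h. - (p / (f w)^2) * h + - (q / (f w)^2) * cnj h)"
    using assms(2) by (auto simp: field_simps power2_eq_square)
  ultimately show ?thesis unfolding has_wirt_def by simp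
qed

lemma has_wirt_divide:
  assumes "has_wirt f w p q" "has_wirt g w p' q'" "g w \<noteq> 0"
  shows "has_wirt (\<lambda>u. f u / g u) w ((p * g w - f w * p') / (g w)^2) ((q * g w - f w * q') / (g w)^2)"
  using has_wirt_mult[OF assms(1) has_wirt_inverse[OF assms(2,3)]] assms(3)
  by (simp add: divide_simps power2_eq_square algebra_simps)

lemma wirt_bar_wirt_commute:
  assumes "open S" "Ck_on 2 S f" "w \<in> S"
  shows "wirt_bar (wirt f) w = wirt (wirt_bar f) w"
proof -
  let ?D = "\<lambda>v u. frechet_derivative f (at u) v"
  have C: "Ck_on (Suc (Suc 0)) S f" using assms(2) by (simp add: numeral_2_eq_2)
  have d: "(?D v has_derivative frechet_derivative (?D v) (at w)) (at w)" for v
    using Ck_on_Suc_D[OF _ assms(3), of 0 "?D v"] C by simp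
  have "((\<lambda>u. (?D 1 u - \<i> * ?D \<i> u) / 2) has_derivative
     (\<lambda>h. (frechet_derivative (?D 1) (at w) h - \<i> * frechet_derivative (?D \<i>) (at w) h) / 2)) (at w)"
    by (auto intro!: derivative_eq_intros d)
  from frechet_derivative_eqI[OF this] have 1: "frechet_derivative (wirt f) (at w) =
     (\<lambda>h. (frechet_derivative (?D 1) (at w) h - \<i> * frechet_derivative (?D \<i>) (at w) h) / 2)"
    unfolding wirt_def .
  have "((\<lambda>u. (?D 1 u + \<i> * ?D \<i> u) / 2) has_derivative
     (\<lambda>h. (frechet_derivative (?D 1) (at w) h + \<i> * frechet_derivative (?D \<i>) (at w) h) / 2)) (at w)"
    by (auto intro!: derivative_eq_intros d)
  from frechet_derivative_eqI[OF this] have 2: "frechet_derivative (wirt_bar f) (at w) =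
     (\<lambda>h. (frechet_derivative (?D 1) (at w) h + \<i> * frechet_derivative (?D \<i>) (at w) h) / 2)"
    unfolding wirt_bar_def .
  show ?thesis
    unfolding wirt_def[of "wirt_bar f"] wirt_bar_def[of "wirt f"] 1 2
    using second_derivative_symmetric[OF assms, of 1 \<i>] by (simp add: field_simps)
qed

lemma Ck_on_wirt:
  assumes "open S" "Ck_on (Suc k) S f"
  shows "Ck_on k S (wirt f)" "Ck_on k S (wirt_bar f)"
proof -
  have "Ck_on k S (\<lambda>u. (1/2) * (frechet_derivative f (at u) 1 - \<i> * frechet_derivative f (at u) \<i>))"
    using assms by (intro Ck_on_mult Ck_on_diff Ck_on_const) auto
  then show "Ck_on k S (wirt f)" by (simp add: wirt_def[abs_def])
  have "Ck_on k S (\<lambda>u. (1/2) * (frechet_derivative f (at u) 1 + \<i> * frechet_derivative f (at u) \<i>))"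
    using assms by (intro Ck_on_mult Ck_on_add Ck_on_const) auto
  then show "Ck_on k S (wirt_bar f)" by (simp add: wirt_bar_def[abs_def])
qed

subsection \<open>The coefficients of the linear system and their derivatives\<close>

text \<open>The system for the frame coefficients of \<open>phi_z\<close> has diagonal entries
  \<open>(1+t)^2*(r-a) - 2*n*t\<close> and off-diagonal entries \<open>2*n*g^2\<close>,
  \<open>2*n*(cnj g)^2\<close>, hence eigenvalues \<open>(1+t)^2*(r-a)\<close> and
  \<open>(1+t)^2*(r-a) - 4*n*t\<close>. \<open>coef_m\<close> is the diagonal entry of the inverse,
  the mean of the reciprocal eigenvalues; \<open>coef_l\<close> is the off-diagonal entry without
  its factor \<open>g^2\<close> or \<open>(cnj g)^2\<close>. The suffixes \<open>_t\<close> and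
  \<open>_r\<close> mark partial derivatives.\<close>

definition coef_m where "coef_m a n t r = (1/((1+t)^2*(r-a)) + 1/((1+t)^2*(r-a) - 4*n*t))/2" for a n t r :: complex
definition coef_l where "coef_l a n t r = - (2*n/((1+t)^2*(r-a)*((1+t)^2*(r-a) - 4*n*t)))" for a n t r :: complex
definition coef_m_t where "coef_m_t a n t r =
  (-2/((1+t)^3*(r-a)) - (2*(1+t)*(r-a)-4*n)/((1+t)^2*(r-a) - 4*n*t)^2)/2" for a n t r :: complex
definition coef_m_r where "coef_m_r a n t r =
  (-1/((1+t)^2*(r-a)^2) - (1+t)^2/((1+t)^2*(r-a) - 4*n*t)^2)/2" for a n t r :: complex
definition coef_l_t where "coef_l_t a n t r = 2*n*(2/((1+t)^3*(r-a)*((1+t)^2*(r-a) - 4*n*t))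
  + (2*(1+t)*(r-a)-4*n)/((1+t)^2*(r-a)*((1+t)^2*(r-a) - 4*n*t)^2))" for a n t r :: complex
definition coef_l_r where "coef_l_r a n t r = 2*n*(1/((1+t)^2*(r-a)^2*((1+t)^2*(r-a) - 4*n*t))
  + 1/((r-a)*((1+t)^2*(r-a) - 4*n*t)^2))" for a n t r :: complex

text \<open>Here \<open>B\<close> stands for \<open>1 + t\<close>, \<open>D\<close> for
  \<open>r - a\<close> and \<open>F\<close> for the second eigenvalue; \<open>e\<close> is the
  variation of the first eigenvalue \<open>B^2 * D\<close> when \<open>t\<close> and
  \<open>r\<close> vary by \<open>x\<close> and \<open>y\<close>. The left sides are what the
  product and reciprocal rules deliver, the right sides the partial derivatives.\<close>

lemma coef_derivative_identity:
  fixes B D F e n x y :: complex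
  assumes nz: "B \<noteq> 0" "D \<noteq> 0" "F \<noteq> 0" and e: "e = (x*B+B*x)*D+B*B*y"
  shows "1/2 * (-(e/(B*B*D)^2) + -((e - 4*n*x)/F^2))
     = (-2/(B^3*D) - (2*B*D-4*n)/F^2)/2 * x + (-1/(B^2*D^2) - B^2/F^2)/2 * y"
    and "-2*n*(-((e * F + B*B*D * (e - 4*n*x))/(B*B*D*F)^2))
     = 2*n*(2/(B^3*D*F) + (2*B*D-4*n)/(B^2*D*F^2)) * x + 2*n*(1/(B^2*D^2*F) + 1/(D*F^2)) * y"
  unfolding e
  subgoal apply (simp add: divide_simps nz) by algebra
  subgoal apply (simp add: divide_simps nz) by algebra
  done

lemma coef_derivative_aux:
  fixes a n t r x y :: complex
  assumes "1+t \<noteq> 0" "r-a \<noteq> 0" "(1+t)^2*(r-a) - 4*n*t \<noteq> 0"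
  defines "E \<equiv> (1+t)*(1+t)*(r-a)" and "e \<equiv> (x*(1+t)+(1+t)*x)*(r-a) + (1+t)*(1+t)*y"
  shows "1/2 * (-(e/E^2) + -((e - 4*n*x)/(E-4*n*t)^2)) = coef_m_t a n t r * x + coef_m_r a n t r * y"
    and "-2*n*(-((e * (E-4*n*t) + E * (e - 4*n*x))/(E*(E-4*n*t))^2)) = coef_l_t a n t r * x + coef_l_r a n t r * y"
proof -
  show "1/2 * (-(e/E^2) + -((e - 4*n*x)/(E-4*n*t)^2)) = coef_m_t a n t r * x + coef_m_r a n t r * y"
    unfolding coef_m_t_def coef_m_r_def E_def using coef_derivative_identity(1)[OF assms(1-3) e_def[THEN meta_eq_to_obj_eq]]
    by (simp only: power2_eq_square)
  show "-2*n*(-((e * (E-4*n*t) + E * (e - 4*n*x))/(E*(E-4*n*t))^2)) = coef_l_t a n t r * x + coef_l_r a n t r * y"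
    unfolding coef_l_t_def coef_l_r_def E_def using coef_derivative_identity(2)[OF assms(1-3) e_def[THEN meta_eq_to_obj_eq]]
    by (simp only: power2_eq_square)
qed

lemma has_wirt_coef:
  assumes t: "has_wirt t w tz tb" and r: "has_wirt r w rz rb"
    and nz: "1 + t w \<noteq> 0" "r w - a \<noteq> 0" "(1 + t w)^2*(r w - a) - 4*n*t w \<noteq> 0"
  shows "has_wirt (\<lambda>u. coef_m a n (t u) (r u)) w
      (coef_m_t a n (t w) (r w) * tz + coef_m_r a n (t w) (r w) * rz)
      (coef_m_t a n (t w) (r w) * tb + coef_m_r a n (t w) (r w) * rb)"
    and "has_wirt (\<lambda>u. coef_l a n (t u) (r u)) w
      (coef_l_t a n (t w) (r w) * tz + coef_l_r a n (t w) (r w) * rz)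
      (coef_l_t a n (t w) (r w) * tb + coef_l_r a n (t w) (r w) * rb)"
proof -
  let ?E = "\<lambda>u. (1 + t u)*(1 + t u)*(r u - a)"
  have B: "has_wirt (\<lambda>u. 1 + t u) w tz tb" using has_wirt_add[OF has_wirt_const t] by simp
  have D: "has_wirt (\<lambda>u. r u - a) w rz rb" using has_wirt_diff[OF r has_wirt_const] by simp
  note E = has_wirt_mult[OF has_wirt_mult[OF B B] D]
  note F = has_wirt_diff[OF E has_wirt_cmult[OF t, of "4*n"]]
  have nz': "?E w \<noteq> 0" "?E w - 4*n*t w \<noteq> 0"
    using nz by (simp_all add: power2_eq_square)
  have m: "coef_m a n (t u) (r u) = (1/2) * (inverse (?E u) + inverse (?E u - 4*n*t u))" for u
    unfolding coef_m_def by (simp add: inverse_eq_divide power2_eq_square)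
  have l: "coef_l a n (t u) (r u) = -2*n* inverse (?E u * (?E u - 4*n*t u))" for u
    unfolding coef_l_def by (simp add: inverse_eq_divide power2_eq_square)
  have "has_wirt (\<lambda>u. (1/2) * (inverse (?E u) + inverse (?E u - 4*n*t u))) w
      (coef_m_t a n (t w) (r w) * tz + coef_m_r a n (t w) (r w) * rz)
      (coef_m_t a n (t w) (r w) * tb + coef_m_r a n (t w) (r w) * rb)"
    using has_wirt_cmult[OF has_wirt_add[OF has_wirt_inverse[OF E nz'(1)] has_wirt_inverse[OF F nz'(2)]], of "1/2"]
    unfolding coef_derivative_aux(1)[OF nz] .
  then show "has_wirt (\<lambda>u. coef_m a n (t u) (r u)) w
      (coef_m_t a n (t w) (r w) * tz + coef_m_r a n (t w) (r w) * rz)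
      (coef_m_t a n (t w) (r w) * tb + coef_m_r a n (t w) (r w) * rb)" unfolding m .
  have "has_wirt (\<lambda>u. -2*n* inverse (?E u * (?E u - 4*n*t u))) w
      (coef_l_t a n (t w) (r w) * tz + coef_l_r a n (t w) (r w) * rz)
      (coef_l_t a n (t w) (r w) * tb + coef_l_r a n (t w) (r w) * rb)"
    using has_wirt_cmult[OF has_wirt_inverse[OF has_wirt_mult[OF E F]], of "-2*n"] nz'
    unfolding coef_derivative_aux(2)[OF nz] mult_eq_0_iff by blast
  then show "has_wirt (\<lambda>u. coef_l a n (t u) (r u)) w
      (coef_l_t a n (t w) (r w) * tz + coef_l_r a n (t w) (r w) * rz)
      (coef_l_t a n (t w) (r w) * tb + coef_l_r a n (t w) (r w) * rb)" unfolding l .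
qed

subsection \<open>Identities between the coefficients\<close>

text \<open>The coefficients \<open>G1\<close>, \<open>G2\<close>, \<open>G4\<close>,
  \<open>G5\<close> and \<open>G6_cofactor\<close> without their monomial in \<open>g\<close> and
  \<open>cnj g\<close>, over denominators that are factored over the complex numbers.
  \<open>G3\<close> is \<open>gcoef2\<close> at \<open>-a\<close>, \<open>-n\<close>.\<close>

definition gcoef1 where "gcoef1 a n t r =
  (2*((1+t)^6*r^4 - 2*(1+t)^2*r^2*((4*t+2*t^2+t^3+t^4)*a^2 + (1-5*t+t^2+3*t^3)*a*(a+n) + (5*t+3*t^2)*(a+n)^2)
       + 16*t^2*(t-1)*a*(a+n)^3)
     - 2*a*((1+6*t-t^2*(13-10*t+3*t^2+t^4))*a^3 - 2*(t-1)*(-1-6*t+18*t^2+2*t^3+3*t^4)*a^2*(a+n)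
       - (2*t+66*t^2-18*t^3+14*t^4)*a*(a+n)^2))
   / ((1+t)^3*(r-a)*(r+a)*((1+t)^2*(r-a) - 4*n*t)*((1+t)^2*(r+a) + 4*n*t))" for a n t r :: complex
definition gcoef4 where "gcoef4 a n t r =
  4*(t-1)*n^2*(-3*(1+t)^2*r^2 - (a^2+(8*a*(a+n)-6*a^2)*t+a^2*t^2))
   / ((1+t)^3*(r-a)*(r+a)*((1+t)^2*(r-a) - 4*n*t)*((1+t)^2*(r+a) + 4*n*t))" for a n t r :: complex
definition gcoef2 where "gcoef2 a n t r =
  2*n*(t-1)*(2*(1+t)^4*r^4 - (1+t)^4*r^2*a^2 - (1+t)^2*r*(r^2-a^2)*(a+2*(a+n)*t+a*t^2) - a^2*((1+t)^2*a+4*n*t)^2)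
   / ((1+t)^3*r*(r-a)*(r+a)*((1+t)^2*(r-a) - 4*n*t)*((1+t)^2*(r+a) + 4*n*t))" for a n t r :: complex
definition gcoef5 where "gcoef5 a n t r =
  ((1+t)^2*r^2 - a*((1+t)^2*a+4*n*t))/(4*r^2*(r+a)*((1+t)^2*(r+a) + 4*n*t))" for a n t r :: complex
definition gcoef6 where "gcoef6 a n t r =
  n/(r*(r+a)*((1+t)^2*(r+a) + 4*n*t))" for a n t r :: complex

text \<open>
  Here \<open>a = \<i> \<mu>1\<close>, \<open>n = \<i> (\<mu>3 - \<mu>1)\<close>, \<open>t = \<bar>g\<bar>\<^sup>2\<close> and \<open>r = \<surd>K\<close>, so that conjugation changes the signs of \<open>a\<close> and \<open>n\<close>
  only and the identities below hold for independent complex variables.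
\<close>

locale gauss_coeffs =
  fixes a n t r B D1 C1 D2 C2 :: complex
  assumes B: "1 + t = B" and D1: "r - a = D1" and C1: "r + a = C1"
    and D2: "B^2*D1 - 4*n*t = D2" and C2: "B^2*C1 + 4*n*t = C2"
    and nz: "B \<noteq> 0" "D1 \<noteq> 0" "C1 \<noteq> 0" "D2 \<noteq> 0" "C2 \<noteq> 0" "r \<noteq> 0"
begin

lemma coefs:
  "coef_m a n t r = (1/(B^2*D1)+1/D2)/2" "coef_m (-a) (-n) t r = (1/(B^2*C1)+1/C2)/2"
  "coef_l a n t r = - (2*n/(B^2*D1*D2))" "coef_l (-a) (-n) t r = 2*n/(B^2*C1*C2)"
  "coef_m_t a n t r = (-2/(B^3*D1) - (2*B*D1-4*n)/D2^2)/2"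
  "coef_m_t (-a) (-n) t r = (-2/(B^3*C1) - (2*B*C1+4*n)/C2^2)/2"
  "coef_l_t a n t r = 2*n*(2/(B^3*D1*D2) + (2*B*D1-4*n)/(B^2*D1*D2^2))"
  "coef_l_t (-a) (-n) t r = -2*n*(2/(B^3*C1*C2) + (2*B*C1+4*n)/(B^2*C1*C2^2))"
  "coef_m_r a n t r = (-1/(B^2*D1^2)-B^2/D2^2)/2"
  "coef_m_r (-a) (-n) t r = (-1/(B^2*C1^2)-B^2/C2^2)/2"
  "coef_l_r a n t r = 2*n*(1/(B^2*D1^2*D2)+1/(D1*D2^2))"
  "coef_l_r (-a) (-n) t r = -2*n*(1/(B^2*C1^2*C2)+1/(C1*C2^2))"
  by (simp_all add: coef_m_def coef_l_def coef_m_t_def coef_m_r_def coef_l_t_def coef_l_r_def B D1 C1 D2 C2)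

text \<open>\<open>coef_m + t * coef_l\<close> and \<open>coef_m - t * coef_l\<close> are the
  reciprocals of the two eigenvalues. Adding the values at \<open>-a\<close>, \<open>-n\<close>
  gives these fractions, since \<open>D1 + C1 = 2*r\<close> and \<open>D2 + C2 = 2*B^2*r\<close>.
  That both are nonzero is what makes the final equation nondegenerate.\<close>

lemma coef_sums:
  "coef_m a n t r + coef_m (-a) (-n) t r + t * (coef_l a n t r + coef_l (-a) (-n) t r) = 2*r/(B^2*D1*C1)"
  "coef_m a n t r + coef_m (-a) (-n) t r - t * (coef_l a n t r + coef_l (-a) (-n) t r) = 2*B^2*r/(D2*C2)"
  unfolding coefs
  subgoal apply (simp add: divide_simps nz)
    unfolding D2[symmetric] C2[symmetric] D1[symmetric] C1[symmetric]
    by algebra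
  subgoal apply (simp add: divide_simps nz)
    unfolding D2[symmetric] C2[symmetric] D1[symmetric] C1[symmetric]
    by algebra
  done

lemma sols:
  "gcoef2 a n t r = 2*n*(t-1)*(2*B^4*r^4 - B^4*r^2*a^2 - B^2*r*(r^2-a^2)*(a+2*(a+n)*t+a*t^2) - a^2*(B^2*a+4*n*t)^2) / (B^3*r*D1*C1*D2*C2)"
  "gcoef2 (-a) (-n) t r = -2*n*(t-1)*(2*B^4*r^4 - B^4*r^2*a^2 + B^2*r*(r^2-a^2)*(a+2*(a+n)*t+a*t^2) - a^2*(B^2*a+4*n*t)^2) / (B^3*r*D1*C1*D2*C2)"
  "gcoef5 a n t r = (B^2*r^2 - a*(B^2*a+4*n*t))/(4*r^2*C1*C2)"
  "gcoef5 (-a) (-n) t r = (B^2*r^2 - a*(B^2*a+4*n*t))/(4*r^2*D1*D2)"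
  "gcoef6 a n t r = n/(r*C1*C2)" "gcoef6 (-a) (-n) t r = - (n/(r*D1*D2))"
proof -
  have neg: "r - - a = C1" "r + - a = D1" "B^2*C1 - 4*(-n)*t = C2" "B^2*D1 + 4*(-n)*t = D2"
    by (simp_all add: C1 D1 C2 D2)
  have q: "(B^2*(-a)+4*(-n)*t)^2 = (B^2*a+4*n*t)^2" "- a * (B^2*(-a)+4*(-n)*t) = a * (B^2*a+4*n*t)"
     "(- a) + 2*((-a)+(-n))*t+(-a)*t^2 = - (a+2*(a+n)*t+a*t^2)"
    by (simp_all add: power2_eq_square algebra_simps)
  show "gcoef2 a n t r = 2*n*(t-1)*(2*B^4*r^4 - B^4*r^2*a^2 - B^2*r*(r^2-a^2)*(a+2*(a+n)*t+a*t^2) - a^2*(B^2*a+4*n*t)^2) / (B^3*r*D1*C1*D2*C2)"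
    unfolding gcoef2_def B D1 C1 D2 C2 ..
  show "gcoef2 (-a) (-n) t r = -2*n*(t-1)*(2*B^4*r^4 - B^4*r^2*a^2 + B^2*r*(r^2-a^2)*(a+2*(a+n)*t+a*t^2) - a^2*(B^2*a+4*n*t)^2) / (B^3*r*D1*C1*D2*C2)"
    unfolding gcoef2_def B neg
    apply (rule arg_cong2[where f="(/)"]) apply (rule right_minus_eq[THEN iffD1]) apply algebra by (simp only: ac_simps)
  show "gcoef5 a n t r = (B^2*r^2 - a*(B^2*a+4*n*t))/(4*r^2*C1*C2)"
    unfolding gcoef5_def B D1 C1 D2 C2 ..
  show "gcoef5 (-a) (-n) t r = (B^2*r^2 - a*(B^2*a+4*n*t))/(4*r^2*D1*D2)"
    unfolding gcoef5_def B q by (simp add: D1 D2)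
  show "gcoef6 a n t r = n/(r*C1*C2)" "gcoef6 (-a) (-n) t r = - (n/(r*D1*D2))"
    unfolding gcoef6_def B by (simp_all add: D1 D2 C1 C2)
qed

lemma sols_even:
  "gcoef1 a n t r = (2*(B^6*r^4 - 2*B^2*r^2*((4*t+2*t^2+t^3+t^4)*a^2 + (1-5*t+t^2+3*t^3)*a*(a+n) + (5*t+3*t^2)*(a+n)^2)
       + 16*t^2*(t-1)*a*(a+n)^3)
     - 2*a*((1+6*t-t^2*(13-10*t+3*t^2+t^4))*a^3 - 2*(t-1)*(-1-6*t+18*t^2+2*t^3+3*t^4)*a^2*(a+n)
       - (2*t+66*t^2-18*t^3+14*t^4)*a*(a+n)^2)) / (B^3*D1*C1*D2*C2)"
  "gcoef4 a n t r = 4*(t-1)*n^2*(-3*B^2*r^2 - (a^2+(8*a*(a+n)-6*a^2)*t+a^2*t^2)) / (B^3*D1*C1*D2*C2)"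
  unfolding gcoef1_def gcoef4_def B D1 C1 D2 C2 by (rule refl)+

text \<open>The number of each identity is that of the coefficient \<open>G1\<close> to
  \<open>G6\<close> whose monomial it belongs to: once the equation of the Gauss map is substituted,
  the integrability expression has this left side as its coefficient there. Conjugating the equation
  exchanges monomials, so the unknowns occur in the pairs 1 and 4, 2 and 3, 5 and 6.\<close>

lemma id1: "B*(coef_m a n t r + coef_m (-a) (-n) t r)*gcoef1 a n t r + B*t^2*(coef_l a n t r + coef_l (-a) (-n) t r)*gcoef4 a n t r
   + (B*(coef_m_t a n t r + coef_m_t (-a) (-n) t r)
      - 2*n*(t-1)*t*(coef_m a n t r * coef_l (-a) (-n) t r - coef_m (-a) (-n) t r * coef_l a n t r)) = 0"
  unfolding coefs sols_even
  apply (simp add: divide_simps nz)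
  unfolding D2[symmetric] C2[symmetric] unfolding D1[symmetric] C1[symmetric] B[symmetric]
  by algebra

lemma id4: "B*(coef_m a n t r + coef_m (-a) (-n) t r)*gcoef4 a n t r + B*(coef_l a n t r + coef_l (-a) (-n) t r)*gcoef1 a n t r
   + (B*(coef_l_t a n t r + coef_l_t (-a) (-n) t r) + 2*(coef_l a n t r + coef_l (-a) (-n) t r)
      - 2*n*(t-1)*(coef_l a n t r * coef_m (-a) (-n) t r - coef_l (-a) (-n) t r * coef_m a n t r)) = 0"
  unfolding coefs sols_even
  apply (simp add: divide_simps nz)
  unfolding D2[symmetric] C2[symmetric] unfolding D1[symmetric] C1[symmetric] B[symmetric]
  by algebra

lemma id2: "B*(coef_m a n t r + coef_m (-a) (-n) t r)*gcoef2 a n t r + B*t*(coef_l a n t r + coef_l (-a) (-n) t r)*gcoef2 (-a) (-n) t r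
   + (B*(coef_m_t a n t r + 2*coef_l (-a) (-n) t r + t*coef_l_t (-a) (-n) t r) + 2*coef_m a n t r
      - 2*n*(t-1)*(coef_m a n t r * coef_m (-a) (-n) t r - t^2*coef_l a n t r * coef_l (-a) (-n) t r)) = 0"
  unfolding coefs sols
  apply (simp add: divide_simps nz)
  unfolding D2[symmetric] C2[symmetric] unfolding D1[symmetric] C1[symmetric] B[symmetric]
  by algebra

text \<open>Derivatives of K enter only through \<open>r\<close>, the square root of K; this
  explains the partial derivative in \<open>r\<close> and the factor \<open>1/(2*r)\<close>.\<close>

lemma id5: "B*(coef_m a n t r + coef_m (-a) (-n) t r)*gcoef5 a n t r + B*t^2*(coef_l a n t r + coef_l (-a) (-n) t r)*gcoef6 a n t r
   + B*coef_m_r (-a) (-n) t r/(2*r) = 0"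
  unfolding coefs sols
  apply (simp add: divide_simps nz)
  unfolding D2[symmetric] C2[symmetric] unfolding D1[symmetric] C1[symmetric] B[symmetric]
  by algebra

lemma id6: "B*(coef_m a n t r + coef_m (-a) (-n) t r)*gcoef6 a n t r + B*(coef_l a n t r + coef_l (-a) (-n) t r)*gcoef5 a n t r
   + B*coef_l_r (-a) (-n) t r/(2*r) = 0"
  unfolding coefs sols
  apply (simp add: divide_simps nz)
  unfolding D2[symmetric] C2[symmetric] unfolding D1[symmetric] C1[symmetric] B[symmetric]
  by algebra

text \<open>Complex conjugation in disguise: it negates \<open>a\<close> and \<open>n\<close>,
  exchanging \<open>D1\<close> with \<open>C1\<close> and \<open>D2\<close> with \<open>C2\<close>.
  The identities for the conjugate monomials follow from this symmetry without a new
  computation.\<close>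

lemma conj_locale: "gauss_coeffs (-a) (-n) t r B C1 D1 C2 D2"
  using nz by unfold_locales (simp_all add: B C1 D1 C2 D2)

lemma sols_even': "gcoef1 (-a) (-n) t r = gcoef1 a n t r" "gcoef4 (-a) (-n) t r = gcoef4 a n t r"
  unfolding sols_even gauss_coeffs.sols_even[OF conj_locale]
  subgoal apply (rule arg_cong2[where f="(/)"]) apply (rule right_minus_eq[THEN iffD1]) apply algebra by (simp add: ac_simps)
  subgoal apply (rule arg_cong2[where f="(/)"]) apply (rule right_minus_eq[THEN iffD1]) apply algebra by (simp add: ac_simps)
  done

end

subsection \<open>The null frame of the sphere\<close>

text \<open>The imaginary unit is kept as a variable \<open>j\<close> with \<open>j^2 = -1\<close>.
  Once its even powers are removed by these rules, the frame identities are polynomial identities in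
  which \<open>j\<close> is an indeterminate.\<close>

lemma square_minus_one_simps:
  fixes j x :: complex
  assumes "j^2 = -1"
  shows "j * j = -1" "j * (j * x) = - x"
  using assms by (simp_all add: power2_eq_square mult.assoc[symmetric])

text \<open>The first summands combine the null vector and its conjugate, both orthogonal to
  \<open>n\<close>; the remaining ones form a cross product with \<open>n\<close>. Orthogonality
  therefore holds for every \<open>a\<close>, before the equation that determines \<open>a\<close>
  is used.\<close>

lemma frame_orthogonal:
  fixes g h B p p' j \<mu> \<nu> a1 a2 a3 n1 n2 n3 N1 N2 N3 :: complex
  assumes j: "j^2 = -1" and B: "B = 1 + g*h" "B \<noteq> 0"
    and n: "n1 = (g+h)/B" "n2 = -j*(g-h)/B" "n3 = (g*h-1)/B"
    and N: "N1 = ((1-h^2)*p+(1-g^2)*p')/B^2 + (\<mu>*a2*n3 - \<nu>*a3*n2)"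
      "N2 = (-j*(1+h^2)*p+j*(1+g^2)*p')/B^2 + (\<nu>*a3*n1 - \<mu>*a1*n3)"
      "N3 = (2*h*p+2*g*p')/B^2 + (\<mu>*a1*n2 - \<mu>*a2*n1)"
  shows "n1*N1+n2*N2+n3*N3 = 0"
proof -
  have "n1*N1+n2*N2+n3*N3 = 
     (((g+h)*((1-h^2)*p+(1-g^2)*p') + (-j*(g-h))*(-j*(1+h^2)*p+j*(1+g^2)*p') + (g*h-1)*(2*h*p+2*g*p')))/B^3
     + (n1*(\<mu>*a2*n3 - \<nu>*a3*n2) + n2*(\<nu>*a3*n1 - \<mu>*a1*n3) + n3*(\<mu>*a1*n2 - \<mu>*a2*n1))"
    unfolding N unfolding n(1,2,3) using B(2) by (simp add: field_simps power2_eq_square power3_eq_cube)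
  also have "((g+h)*((1-h^2)*p+(1-g^2)*p') + (-j*(g-h))*(-j*(1+h^2)*p+j*(1+g^2)*p') + (g*h-1)*(2*h*p+2*g*p')) = 0"
    by (simp only: algebra_simps power2_eq_square power3_eq_cube square_minus_one_simps[OF j]
       mult_minus_left mult_minus_right minus_minus mult_1_left mult_1_right; algebra)
  also have "n1*(\<mu>*a2*n3 - \<nu>*a3*n2) + n2*(\<nu>*a3*n1 - \<mu>*a1*n3) + n3*(\<mu>*a1*n2 - \<mu>*a2*n1) = 0"
    by algebra
  finally show ?thesis by simp
qed

text \<open>The null vector pairs to 0 with itself and to \<open>2*B^2\<close> with its conjugate,
  so the coefficients of a tangent vector are its crossed pairings. For an arbitrary vector the
  error is its normal component, which \<open>orth\<close> removes.\<close>

lemma frame_complete: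
  fixes g h B j n1 n2 n3 N1 N2 N3 :: complex
  assumes j: "j^2 = -1" and B: "B = 1 + g*h" "B \<noteq> 0"
    and n: "n1 = (g+h)/B" "n2 = -j*(g-h)/B" "n3 = (g*h-1)/B"
    and orth: "n1*N1+n2*N2+n3*N3 = 0"
  defines "X \<equiv> (1-g^2)*N1 + j*(1+g^2)*N2 + 2*g*N3" and "Y \<equiv> (1-h^2)*N1 - j*(1+h^2)*N2 + 2*h*N3"
  shows "2*B^2*N1 = X*(1-h^2) + Y*(1-g^2)" 
    "2*B^2*N2 = X*(-j*(1+h^2)) + Y*(j*(1+g^2))"
    "2*B^2*N3 = X*(2*h) + Y*(2*g)"
proof -
  have o: "(g+h)*N1 + (-j*(g-h))*N2 + (g*h-1)*N3 = 0"
  proof -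
    have k: "g + h = n1*B" "-j*(g-h) = n2*B" "g*h-1 = n3*B" using n B(2) by simp_all
    have "(g+h)*N1 + (-j*(g-h))*N2 + (g*h-1)*N3 = B*(n1*N1+n2*N2+n3*N3)"
      unfolding k by (simp add: algebra_simps)
    then show ?thesis using orth by simp
  qed
  have "2*B^2*N1 - (X*(1-h^2) + Y*(1-g^2)) - 2*(g+h)*((g+h)*N1 + (-j*(g-h))*N2 + (g*h-1)*N3) = 0"
    unfolding X_def Y_def B by (simp only: algebra_simps power2_eq_square power3_eq_cube square_minus_one_simps[OF j]
       mult_minus_left mult_minus_right minus_minus mult_1_left mult_1_right; algebra)
  then show "2*B^2*N1 = X*(1-h^2) + Y*(1-g^2)" unfolding o by simp
  have "2*B^2*N2 - (X*(-j*(1+h^2)) + Y*(j*(1+g^2))) - 2*(-j*(g-h))*((g+h)*N1 + (-j*(g-h))*N2 + (g*h-1)*N3) = 0"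
    unfolding X_def Y_def B by (simp only: algebra_simps power2_eq_square power3_eq_cube square_minus_one_simps[OF j]
       mult_minus_left mult_minus_right minus_minus mult_1_left mult_1_right; algebra)
  then show "2*B^2*N2 = X*(-j*(1+h^2)) + Y*(j*(1+g^2))" unfolding o by simp
  have "2*B^2*N3 - (X*(2*h) + Y*(2*g)) - 2*(g*h-1)*((g+h)*N1 + (-j*(g-h))*N2 + (g*h-1)*N3) = 0"
    unfolding X_def Y_def B by (simp only: algebra_simps power2_eq_square power3_eq_cube square_minus_one_simps[OF j]
       mult_minus_left mult_minus_right minus_minus mult_1_left mult_1_right; algebra)
  then show "2*B^2*N3 = X*(2*h) + Y*(2*g)" unfolding o by simp
qed

text \<open>Rotation by \<open>n\<close> is diagonal in the null frame, with eigenvalue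
  \<open>- j\<close> on the null vector and \<open>j\<close> on its conjugate. The extra factor
  \<open>j\<close> leaves a mere change of sign of \<open>C\<close>.\<close>

lemma frame_rotate:
  fixes g h B j n1 n2 n3 A C :: complex
  assumes j: "j^2 = -1" and B: "B = 1 + g*h" "B \<noteq> 0"
    and n: "n1 = (g+h)/B" "n2 = -j*(g-h)/B" "n3 = (g*h-1)/B"
    and M: "M1 = A*(1-h^2) + C*(1-g^2)" "M2 = A*(-j*(1+h^2)) + C*(j*(1+g^2))" "M3 = A*(2*h) + C*(2*g)"
  shows "j*(n2*M3-n3*M2) = A*(1-h^2) - C*(1-g^2)" "j*(n3*M1-n1*M3) = A*(-j*(1+h^2)) - C*(j*(1+g^2))"
    "j*(n1*M2-n2*M1) = A*(2*h) - C*(2*g)"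
proof -
  have k: "g + h = n1*B" "-j*(g-h) = n2*B" "g*h-1 = n3*B" using n B(2) by simp_all
  have "B*(j*(n2*M3-n3*M2)) = j*((n2*B)*M3-(n3*B)*M2)" by (simp add: algebra_simps)
  also have "\<dots> = B*(A*(1-h^2) - C*(1-g^2))" unfolding k[symmetric] unfolding M B
    apply (rule right_minus_eq[THEN iffD1]) by (simp only: algebra_simps power2_eq_square power3_eq_cube square_minus_one_simps[OF j]
       mult_minus_left mult_minus_right minus_minus mult_1_left mult_1_right; algebra)
  finally show "j*(n2*M3-n3*M2) = A*(1-h^2) - C*(1-g^2)" using B(2) by simp
  have "B*(j*(n3*M1-n1*M3)) = j*((n3*B)*M1-(n1*B)*M3)" by (simp add: algebra_simps)
  also have "\<dots> = B*(A*(-j*(1+h^2)) - C*(j*(1+g^2)))" unfolding k[symmetric] unfolding M B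
    apply (rule right_minus_eq[THEN iffD1]) by (simp only: algebra_simps power2_eq_square power3_eq_cube square_minus_one_simps[OF j]
       mult_minus_left mult_minus_right minus_minus mult_1_left mult_1_right; algebra)
  finally show "j*(n3*M1-n1*M3) = A*(-j*(1+h^2)) - C*(j*(1+g^2))" using B(2) by simp
  have "B*(j*(n1*M2-n2*M1)) = j*((n1*B)*M2-(n2*B)*M1)" by (simp add: algebra_simps)
  also have "\<dots> = B*(A*(2*h) - C*(2*g))" unfolding k[symmetric] unfolding M B
    apply (rule right_minus_eq[THEN iffD1]) by (simp only: algebra_simps power2_eq_square power3_eq_cube square_minus_one_simps[OF j]
       mult_minus_left mult_minus_right minus_minus mult_1_left mult_1_right; algebra)
  finally show "j*(n1*M2-n2*M1) = A*(2*h) - C*(2*g)" using B(2) by simp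
qed

text \<open>\<open>N1\<close>, \<open>N2\<close>, \<open>N3\<close> contain \<open>a\<close>, and
  \<open>a\<close> is a rotation of them. In the null frame the rotation only changes a sign, so
  both vectors are expressed by the same \<open>A\<close> and \<open>C\<close>; pairing the formula
  for the vector with the frame leaves the linear system for \<open>A\<close> and \<open>C\<close>.
  Its off-diagonal entries measure the anisotropy \<open>\<nu> - \<mu>\<close>.\<close>

lemma frame_solve:
  fixes g h B p p' j \<mu> \<nu> r a1 a2 a3 n1 n2 n3 N1 N2 N3 :: complex
  assumes j: "j^2 = -1" and B: "B = 1 + g*h" "B \<noteq> 0" and r: "r \<noteq> 0"
    and n: "n1 = (g+h)/B" "n2 = -j*(g-h)/B" "n3 = (g*h-1)/B"
    and N: "N1 = ((1-h^2)*p+(1-g^2)*p')/B^2 + (\<mu>*a2*n3 - \<nu>*a3*n2)"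
      "N2 = (-j*(1+h^2)*p+j*(1+g^2)*p')/B^2 + (\<nu>*a3*n1 - \<mu>*a1*n3)"
      "N3 = (2*h*p+2*g*p')/B^2 + (\<mu>*a1*n2 - \<mu>*a2*n1)"
    and a: "a1 = j/r*(n2*N3-n3*N2)" "a2 = j/r*(n3*N1-n1*N3)" "a3 = j/r*(n1*N2-n2*N1)"
  obtains A C where
    "a1 = A*(1-h^2) - C*(1-g^2)" "a2 = A*(-j*(1+h^2)) - C*(j*(1+g^2))" "a3 = A*(2*h) - C*(2*g)"
    "N1 = r*(A*(1-h^2) + C*(1-g^2))" "N2 = r*(A*(-j*(1+h^2)) + C*(j*(1+g^2)))" "N3 = r*(A*(2*h) + C*(2*g))"
    "p = (B^2*(r-j*\<mu>) - 2*j*(\<nu>-\<mu>)*(g*h))*A + 2*j*(\<nu>-\<mu>)*g^2*C"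
    "p' = (B^2*(r-j*\<mu>) - 2*j*(\<nu>-\<mu>)*(g*h))*C + 2*j*(\<nu>-\<mu>)*h^2*A"
proof -
  note orth = frame_orthogonal[OF j B n N]
  define A where "A = ((1-g^2)*N1 + j*(1+g^2)*N2 + 2*g*N3)/(2*B^2*r)"
  define C where "C = ((1-h^2)*N1 - j*(1+h^2)*N2 + 2*h*N3)/(2*B^2*r)"
  have AX: "(1-g^2)*N1 + j*(1+g^2)*N2 + 2*g*N3 = 2*B^2*(r*A)"
    and CY: "(1-h^2)*N1 - j*(1+h^2)*N2 + 2*h*N3 = 2*B^2*(r*C)"
    using B(2) r by (simp_all add: A_def C_def)
  have NN: "N1 = (r*A)*(1-h^2) + (r*C)*(1-g^2)" "N2 = (r*A)*(-j*(1+h^2)) + (r*C)*(j*(1+g^2))" "N3 = (r*A)*(2*h) + (r*C)*(2*g)"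
  proof -
    have *: "x = y" if "2*B^2*x = 2*B^2*y" for x y using that B(2) by simp
    show "N1 = (r*A)*(1-h^2) + (r*C)*(1-g^2)"
      by (rule *) (use frame_complete(1)[OF j B n orth, unfolded AX CY] in \<open>simp only: distrib_left mult.assoc\<close>)
    show "N2 = (r*A)*(-j*(1+h^2)) + (r*C)*(j*(1+g^2))"
      by (rule *) (use frame_complete(2)[OF j B n orth, unfolded AX CY] in \<open>simp only: distrib_left mult.assoc\<close>)
    show "N3 = (r*A)*(2*h) + (r*C)*(2*g)"
      by (rule *) (use frame_complete(3)[OF j B n orth, unfolded AX CY] in \<open>simp only: distrib_left mult.assoc\<close>)
  qed
  have aa: "a1 = A*(1-h^2) - C*(1-g^2)" "a2 = A*(-j*(1+h^2)) - C*(j*(1+g^2))" "a3 = A*(2*h) - C*(2*g)"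
    using frame_rotate[OF j B n NN] r unfolding a by (simp_all add: field_simps)
  have k: "g + h = n1*B" "-j*(g-h) = n2*B" "g*h-1 = n3*B" using n B(2) by simp_all
  have BN: "B^2*N1 = ((1-h^2)*p+(1-g^2)*p') + B*(\<mu>*a2*(g*h-1) - \<nu>*a3*(-j*(g-h)))"
    "B^2*N2 = (-j*(1+h^2)*p+j*(1+g^2)*p') + B*(\<nu>*a3*(g+h) - \<mu>*a1*(g*h-1))"
    "B^2*N3 = (2*h*p+2*g*p') + B*(\<mu>*a1*(-j*(g-h)) - \<mu>*a2*(g+h))"
  proof -
    have *: "B^2*(x/B^2 + (u*m1 - v * m2)) = x + B*(u*(m1*B) - v * (m2*B))" for x u v m1 m2
      using B(2) by (simp add: distrib_left right_diff_distrib power2_eq_square ac_simps)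
    show "B^2*N1 = ((1-h^2)*p+(1-g^2)*p') + B*(\<mu>*a2*(g*h-1) - \<nu>*a3*(-j*(g-h)))"
      "B^2*N2 = (-j*(1+h^2)*p+j*(1+g^2)*p') + B*(\<nu>*a3*(g+h) - \<mu>*a1*(g*h-1))"
      "B^2*N3 = (2*h*p+2*g*p') + B*(\<mu>*a1*(-j*(g-h)) - \<mu>*a2*(g+h))"
      unfolding N * k by (rule refl)+
  qed
  have "2*B^2*(B^2*(r*A)) = (1-g^2)*(B^2*N1) + j*(1+g^2)*(B^2*N2) + 2*g*(B^2*N3)"
    unfolding mult.left_commute[of _ "B^2"] distrib_left[symmetric] AX by (simp add: ac_simps)
  also have "\<dots> = 2*B^2*(p + (B^2*j*\<mu> + 2*j*(\<nu>-\<mu>)*(g*h))*A - 2*j*(\<nu>-\<mu>)*g^2*C)"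
    unfolding BN unfolding aa B apply (rule right_minus_eq[THEN iffD1]) by (simp only: algebra_simps power2_eq_square power3_eq_cube square_minus_one_simps[OF j]
       mult_minus_left mult_minus_right minus_minus mult_1_left mult_1_right; algebra)
  finally have "B^2*(r*A) = p + (B^2*j*\<mu> + 2*j*(\<nu>-\<mu>)*(g*h))*A - 2*j*(\<nu>-\<mu>)*g^2*C"
    using B(2) by simp
  then have p: "p = (B^2*(r-j*\<mu>) - 2*j*(\<nu>-\<mu>)*(g*h))*A + 2*j*(\<nu>-\<mu>)*g^2*C"
    by (simp add: algebra_simps)
  have "2*B^2*(B^2*(r*C)) = (1-h^2)*(B^2*N1) - j*(1+h^2)*(B^2*N2) + 2*h*(B^2*N3)"
    unfolding mult.left_commute[of _ "B^2"] distrib_left[symmetric] right_diff_distrib[symmetric] CY by (simp add: ac_simps)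
  also have "\<dots> = 2*B^2*(p' + (B^2*j*\<mu> + 2*j*(\<nu>-\<mu>)*(g*h))*C - 2*j*(\<nu>-\<mu>)*h^2*A)"
    unfolding BN unfolding aa B apply (rule right_minus_eq[THEN iffD1]) by (simp only: algebra_simps power2_eq_square power3_eq_cube square_minus_one_simps[OF j]
       mult_minus_left mult_minus_right minus_minus mult_1_left mult_1_right; algebra)
  finally have "B^2*(r*C) = p' + (B^2*j*\<mu> + 2*j*(\<nu>-\<mu>)*(g*h))*C - 2*j*(\<nu>-\<mu>)*h^2*A"
    using B(2) by simp
  then have p': "p' = (B^2*(r-j*\<mu>) - 2*j*(\<nu>-\<mu>)*(g*h))*C + 2*j*(\<nu>-\<mu>)*h^2*A"
    by (simp add: algebra_simps)
  show ?thesis using that[OF aa _ _ _ p p'] NN by (simp add: algebra_simps)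
qed

text \<open>The off-diagonal entries multiply to \<open>(2*n*t)^2\<close>, so the determinant is the
  product \<open>B^2 * D1 * D2\<close> of the eigenvalues.\<close>

lemma (in gauss_coeffs) invert_system:
  assumes t: "t = g*h" and p: "p = (B^2*D1 - 2*n*t)*A + 2*n*g^2*C" and p': "p' = (B^2*D1 - 2*n*t)*C + 2*n*h^2*A"
  shows "A = coef_m a n t r * p + g^2 * coef_l a n t r * p'" "C = coef_m a n t r * p' + h^2 * coef_l a n t r * p"
  unfolding coefs
  subgoal apply (simp add: divide_simps nz)
    unfolding p p' D2[symmetric] t by algebra
  subgoal apply (simp add: divide_simps nz)
    unfolding p p' D2[symmetric] t by algebra
  done

text \<open>Pairing with the conjugate null vector kills that vector and its derivatives. Hence
  \<open>Az'\<close> and \<open>Cb\<close> drop out and only \<open>Ab\<close> and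
  \<open>Cz'\<close> survive; the derivatives of the null vector itself give the terms with
  \<open>p'\<close> and \<open>q'\<close>, and the connection contributes only through the
  anisotropy.\<close>

lemma frame_pairing:
  fixes g h B p q p' q' j \<mu> \<nu> A A' C C' Ab Cb Az' Cz' :: complex
  assumes j: "j^2 = -1" and B: "B = 1 + g*h"
    and a: "a1 = A*(1-h^2) - C*(1-g^2)" "a2 = A*(-j*(1+h^2)) - C*(j*(1+g^2))" "a3 = A*(2*h) - C*(2*g)"
    and b: "b1 = A*(1-h^2) + C*(1-g^2)" "b2 = A*(-j*(1+h^2)) + C*(j*(1+g^2))" "b3 = A*(2*h) + C*(2*g)"
    and a': "a1' = A'*(1-g^2) - C'*(1-h^2)" "a2' = A'*(j*(1+g^2)) - C'*(-j*(1+h^2))" "a3' = A'*(2*g) - C'*(2*h)"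
    and b': "b1' = C'*(1-h^2) + A'*(1-g^2)" "b2' = C'*(-j*(1+h^2)) + A'*(j*(1+g^2))" "b3' = C'*(2*h) + A'*(2*g)"
    and V: "V1 = (Cz'*(1-h^2) + C'*(-2*h*p') + (Az'*(1-g^2) + A'*(-2*g*p)) + (\<mu>*a2*b3' - \<nu>*a3*b2'))
        + (Ab*(1-h^2) + A*(-2*h*q') + (Cb*(1-g^2) + C*(-2*g*q)) + (\<mu>*a2'*b3 - \<nu>*a3'*b2))"
    "V2 = (Cz'*(-j*(1+h^2)) + C'*(-j*(2*h*p')) + (Az'*(j*(1+g^2)) + A'*(j*(2*g*p))) + (\<nu>*a3*b1' - \<mu>*a1*b3'))
        + (Ab*(-j*(1+h^2)) + A*(-j*(2*h*q')) + (Cb*(j*(1+g^2)) + C*(j*(2*g*q))) + (\<nu>*a3'*b1 - \<mu>*a1'*b3))"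
    "V3 = (Cz'*(2*h) + C'*(2*p') + (Az'*(2*g) + A'*(2*p)) + (\<mu>*a1*b2' - \<mu>*a2*b1'))
        + (Ab*(2*h) + A*(2*q') + (Cb*(2*g) + C*(2*q)) + (\<mu>*a1'*b2 - \<mu>*a2'*b1))"
  shows "(1-g^2)*V1 + j*(1+g^2)*V2 + 2*g*V3
    = 2*B*(B*(Ab+Cz') + 2*g*(p'*C'+q'*A) - 2*j*(\<nu>-\<mu>)*g*(g*h-1)*(A*A'-C*C'))"
  unfolding V unfolding a b a' b' B
  apply (rule right_minus_eq[THEN iffD1]) by (simp only: algebra_simps power2_eq_square power3_eq_cube square_minus_one_simps[OF j]
       mult_minus_left mult_minus_right minus_minus mult_1_left mult_1_right; algebra)

subsection \<open>The coefficients of the equation of the Gauss map\<close>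

lemma PP_poly: "PP g m0 m1 m2 m3 m4 = m0 + m1*(cmod g)^2 + m2*((cmod g)^2)^2 + m3*((cmod g)^2)^3 + m4*((cmod g)^2)^4"
  unfolding PP_def by (simp add: power_mult[symmetric])

lemma square_minus_one_products:
  fixes j c X Y :: complex
  assumes j: "j^2 = -1"
  shows "(j*X)^2 = - (X^2)" "c*(j*X)*(j*Y) = - (c*X*Y)" "c*(j*X)*(j*Y)^3 = c*X*Y^3"
    "2*(j*X)*(c*(j*X)^3 - d*(j*X)^2*(j*Y) - e*(j*X)*(j*Y)^2) = 2*X*(c*X^3 - d*X^2*Y - e*X*Y^2)"
    "(X - j*Y)*(X + j*Y) = X^2 + Y^2" "c*(X - j*Y)*(X + j*Y) = c*(X^2 + Y^2)"
proof -
  have j4: "j^4 = 1" using j by (simp add: power4_eq_xxxx power2_eq_square)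
  show "(j*X)^2 = - (X^2)" using j by (simp add: power_mult_distrib)
  have "c*(j*X)*(j*Y) = j^2*(c*X*Y)" by algebra
  then show "c*(j*X)*(j*Y) = - (c*X*Y)" using j by simp
  have "c*(j*X)*(j*Y)^3 = j^4*(c*X*Y^3)" by algebra
  then show "c*(j*X)*(j*Y)^3 = c*X*Y^3" using j4 by simp
  have "2*(j*X)*(c*(j*X)^3 - d*(j*X)^2*(j*Y) - e*(j*X)*(j*Y)^2) = j^4*(2*X*(c*X^3 - d*X^2*Y - e*X*Y^2))" by algebra
  then show "2*(j*X)*(c*(j*X)^3 - d*(j*X)^2*(j*Y) - e*(j*X)*(j*Y)^2) = 2*X*(c*X^3 - d*X^2*Y - e*X*Y^2)" using j4 by simp
  have "(X - j*Y)*(X + j*Y) = X^2 - j^2*Y^2" by algebra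
  then show 1: "(X - j*Y)*(X + j*Y) = X^2 + Y^2" using j by simp
  then show "c*(X - j*Y)*(X + j*Y) = c*(X^2 + Y^2)" by (simp only: mult.assoc)
qed

lemma imaginary_linear:
  fixes j T S M R :: complex
  shows "j*M + j*(R-M) = j*R"
    "j*M+2*(j*R)*T+j*M*T^2 = j*(M+2*R*T+M*T^2)"
    "(1+T)^2*(j*M)+4*(j*(R-M))*T = j*((1+T)^2*M+4*(R-M)*T)"
    "-(j*M)+2*(-(j*M)+-(j*(R-M)))*T+-(j*M)*T^2 = - (j*(M+2*R*T+M*T^2))"
    "(1+T)^2*(-(j*M))+4*(-(j*(R-M)))*T = - (j*((1+T)^2*M+4*(R-M)*T))"
    "(1+T)^2*(S-j*M) - 4*(j*(R-M))*T = (1+T)^2*S - j*((1+T)^2*M+4*(R-M)*T)"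
    "(1+T)^2*(S+j*M) + 4*(j*(R-M))*T = (1+T)^2*S + j*((1+T)^2*M+4*(R-M)*T)"
    "(1+T)^2*(S - - (j*M)) - 4*(- (j*(R-M)))*T = (1+T)^2*S + j*((1+T)^2*M+4*(R-M)*T)"
    "(1+T)^2*(S + - (j*M)) + 4*(- (j*(R-M)))*T = (1+T)^2*S - j*((1+T)^2*M+4*(R-M)*T)"
    "S - - (j*M) = S + j*M" "S + - (j*M) = S - j*M"
  by algebra+

text \<open>The real denominators split over the complex numbers: \<open>x + \<mu>1^2\<close> is
  \<open>(r-a)*(r+a)\<close>, and \<open>B^4*x + Q^2\<close> is the product of the second eigenvalue
  \<open>B^2*r - j*Q\<close> and its conjugate. The polynomial defining \<open>DD\<close> is
  \<open>B^3\<close> times both, expanded.\<close>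

lemma gauss_coefficients_poly:
  fixes j T S M R :: complex
  assumes j: "j^2 = -1"
  shows "2*((1+T)^6*(S^2)^2 + 2*(1+T)^2*S^2*((4*T+2*T^2+T^3+T^4)*M^2 + (1+(-5)*T+T^2+3*T^3)*M*R + (5*T+3*T^2)*R^2)
       + 16*T^2*(1+T-2)*M*R^3) - 2*(M*((1+6*T-T^2*(13+(-10)*T+3*T^2+T^4))*M^3
         - 2*(1+T-2)*(-1+(-6)*T+18*T^2+2*T^3+3*T^4)*M^2*R - (2*T+66*T^2+(-18)*T^3+14*T^4)*M*R^2))
     = 2*((1+T)^6*S^4 - 2*(1+T)^2*S^2*((4*T+2*T^2+T^3+T^4)*(j*M)^2 + (1-5*T+T^2+3*T^3)*(j*M)*(j*M+j*(R-M)) + (5*T+3*T^2)*(j*M+j*(R-M))^2)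
       + 16*T^2*(T-1)*(j*M)*(j*M+j*(R-M))^3)
     - 2*(j*M)*((1+6*T-T^2*(13-10*T+3*T^2+T^4))*(j*M)^3 - 2*(T-1)*(-1-6*T+18*T^2+2*T^3+3*T^4)*(j*M)^2*(j*M+j*(R-M))
       - (2*T+66*T^2-18*T^3+14*T^4)*(j*M)*(j*M+j*(R-M))^2)" (is ?N1)
    and "(1+T)^3*((1+T)^4*(S^2)^2 + M^2*(M + (4*R-2*M)*T + M*T^2)^2 +
       2*S^2*((1+6*T^2+T^4)*M^2 + (4*T+(-8)*T^2+4*T^3)*M*R + 8*T^2*R^2))
     = (1+T)^3*(S-j*M)*(S+j*M)*((1+T)^2*(S-j*M) - 4*(j*(R-M))*T)*((1+T)^2*(S+j*M) + 4*(j*(R-M))*T)" (is ?D)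
    and "(S^2+M^2)*((1+T)^4*S^2+(M + (4*R-2*M)*T + M*T^2)^2)
     = (S-j*M)*(S+j*M)*((1+T)^2*(S-j*M) - 4*(j*(R-M))*T)*((1+T)^2*(S+j*M) + 4*(j*(R-M))*T)" (is ?E)
    and "(S^2+M^2)*((1+T)^4*S^2+(M + (4*R-2*M)*T + M*T^2)^2)
     = (S - - (j*M))*(S + - (j*M))*((1+T)^2*(S - - (j*M)) - 4*(- (j*(R-M)))*T)*((1+T)^2*(S + - (j*M)) + 4*(- (j*(R-M)))*T)" (is ?E')
    and "(1+T)^2*S + j*(M + (4*R-2*M)*T + M*T^2) = (1+T)^2*(S+j*M) + 4*(j*(R-M))*T" (is ?C)
  subgoal unfolding imaginary_linear(1) unfolding square_minus_one_products(3,4)[OF j] unfolding square_minus_one_products(1,2)[OF j] by algebra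
  subgoal
  proof -
    let ?Q = "(1+T)^2*M+4*(R-M)*T"
    have "(1+T)^3*(S-j*M)*(S+j*M)*((1+T)^2*(S-j*M) - 4*(j*(R-M))*T)*((1+T)^2*(S+j*M) + 4*(j*(R-M))*T) = (1+T)^3*((S-j*M)*(S+j*M))*(((1+T)^2*S - j*?Q)*((1+T)^2*S + j*?Q))"
      unfolding imaginary_linear(8,9) unfolding imaginary_linear(6,7,10,11) by (simp only: ac_simps)
    then show ?thesis unfolding square_minus_one_products(5)[OF j] by algebra
  qed
  subgoal
  proof -
    let ?Q = "(1+T)^2*M+4*(R-M)*T"
    have "(S-j*M)*(S+j*M)*((1+T)^2*(S-j*M) - 4*(j*(R-M))*T)*((1+T)^2*(S+j*M) + 4*(j*(R-M))*T) = ((S-j*M)*(S+j*M))*(((1+T)^2*S - j*?Q)*((1+T)^2*S + j*?Q))"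
      unfolding imaginary_linear(8,9) unfolding imaginary_linear(6,7,10,11) by (simp only: ac_simps)
    then show ?thesis unfolding square_minus_one_products(5)[OF j] by algebra
  qed
  subgoal
  proof -
    let ?Q = "(1+T)^2*M+4*(R-M)*T"
    have "(S - - (j*M))*(S + - (j*M))*((1+T)^2*(S - - (j*M)) - 4*(- (j*(R-M)))*T)*((1+T)^2*(S + - (j*M)) + 4*(- (j*(R-M)))*T) = ((S-j*M)*(S+j*M))*(((1+T)^2*S - j*?Q)*((1+T)^2*S + j*?Q))"
      unfolding imaginary_linear(8,9) unfolding imaginary_linear(6,7,10,11) by (simp only: ac_simps)
    then show ?thesis unfolding square_minus_one_products(5)[OF j] by algebra
  qed
  subgoal by algebra
  done

lemma gauss_Q_poly: "M + (4*R-2*M)*T + M*T^2 = (1+T)^2*M + 4*(R-M)*T" for T M R :: complex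
  by algebra

lemma gauss_coefficients_poly2:
  fixes j T S M R :: complex
  assumes j: "j^2 = -1"
  shows "2*j*((1+T-2)*(R-M))*((2*(1+T)^4*(S^2)^2 + (1+T)^4*S^2*M^2) - j*((1+T)^2*S*(S^2+M^2)*(M+2*R*T+M*T^2)) - M^2*((1+T)^2*M+4*(R-M)*T)^2)
     = 2*(j*(R-M))*(T-1)*(2*(1+T)^4*S^4 - (1+T)^4*S^2*(j*M)^2 - (1+T)^2*S*(S^2-(j*M)^2)*(j*M+2*(j*M+j*(R-M))*T+j*M*T^2) - (j*M)^2*((1+T)^2*(j*M)+4*(j*(R-M))*T)^2)"
   and "2*j*((1+T-2)*(M-R))*((2*(1+T)^4*(S^2)^2 + (1+T)^4*S^2*M^2) + j*((1+T)^2*S*(S^2+M^2)*(M+2*R*T+M*T^2)) - M^2*((1+T)^2*M+4*(R-M)*T)^2)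
     = 2*(-(j*(R-M)))*(T-1)*(2*(1+T)^4*S^4 - (1+T)^4*S^2*(-(j*M))^2 - (1+T)^2*S*(S^2-(-(j*M))^2)*(-(j*M)+2*(-(j*M)+-(j*(R-M)))*T+-(j*M)*T^2) - (-(j*M))^2*((1+T)^2*(-(j*M))+4*(-(j*(R-M)))*T)^2)"
   and "-(4*((1+T-2)*(M-R)^2*(-3*(1+T)^2*S^2 + (M^2 + (8*M*R-6*M^2)*T + M^2*T^2))))
     = 4*(T-1)*(j*(R-M))^2*(-3*(1+T)^2*S^2 - ((j*M)^2+(8*(j*M)*(j*M+j*(R-M))-6*(j*M)^2)*T+(j*M)^2*T^2))"
   and "(1+T)^2*S^2 + M*((1+T)^2*M+4*(R-M)*T) = (1+T)^2*S^2 - j*M*((1+T)^2*(j*M)+4*(j*(R-M))*T)"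
  subgoal unfolding imaginary_linear(1) unfolding imaginary_linear(2-5) unfolding square_minus_one_products(1)[OF j] power2_minus unfolding square_minus_one_products(1)[OF j] by algebra
  subgoal unfolding imaginary_linear(1) unfolding imaginary_linear(2-5) unfolding square_minus_one_products(1)[OF j] power2_minus unfolding square_minus_one_products(1)[OF j] by algebra
  subgoal unfolding imaginary_linear(1) unfolding square_minus_one_products(1)[OF j] square_minus_one_products(2)[OF j] by algebra
  subgoal unfolding imaginary_linear(3) using square_minus_one_products(2)[OF j, of 1 M] by simp
  done

lemmas of_real_push = of_real_add of_real_mult of_real_diff of_real_power of_real_numeral of_real_1 of_real_minus of_real_0

lemma G_eq_gcoef:
  assumes "x > 0" and t: "t = complex_of_real ((cmod g)^2)" and r: "r = complex_of_real (sqrt x)"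
    and a: "a = \<i> * complex_of_real \<mu>1" and n: "n = \<i> * complex_of_real (\<mu>3 - \<mu>1)"
  shows "G1 \<mu>1 \<mu>3 g x = cnj g * gcoef1 a n t r"
    "G2 \<mu>1 \<mu>3 g x = g * gcoef2 a n t r"
    "G3 \<mu>1 \<mu>3 g x = g * gcoef2 (-a) (-n) t r"
    "G4 \<mu>1 \<mu>3 g x = g^3 * gcoef4 a n t r"
    "G5 \<mu>1 \<mu>3 g x = gcoef5 a n t r"
    "G6_cofactor \<mu>1 \<mu>3 g x = gcoef6 a n t r"
proof -
  \<comment> \<open>Writing \<open>x\<close> as a square makes every coefficient a rational function
    of \<open>S\<close>, \<open>T\<close> and the two constants.\<close>
  define S where "S = sqrt x"
  have x: "x = S^2" using assms(1) by (simp add: S_def)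
  define T where "T = (cmod g)^2"
  have c4: "(cmod g)^4 = T^2" by (simp add: T_def power_mult[symmetric])
  note unf = PP_poly BB_def QQ_def DD_def Let_def T_def[symmetric] c4 
  let ?T = "complex_of_real T" and ?M = "complex_of_real \<mu>1" and ?R = "complex_of_real \<mu>3" and ?S = "complex_of_real S"
  have j: "\<i>^2 = -1" by simp
  have sub: "t = ?T" "r = ?S" "a = \<i> * ?M" "n = \<i> * (?R - ?M)" using t r a n by (simp_all add: T_def S_def)
  note P = gauss_coefficients_poly[OF j, where T="?T" and S="?S" and M="?M" and R="?R"]
    and PQ = gauss_Q_poly[of ?M ?R ?T] and P2 = gauss_coefficients_poly2[OF j, where T="?T" and S="?S" and M="?M" and R="?R"]
  have Z: "0 * u = 0" "(u::complex) + 0 = u" "0 + u = u" "1 * u = u" for u :: complex by simp_all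
  show "G1 \<mu>1 \<mu>3 g x = cnj g * gcoef1 a n t r"
  proof -
    have "G1 \<mu>1 \<mu>3 g x = cnj g * ((2*((1+?T)^6*(?S^2)^2 + 2*(1+?T)^2*?S^2*((4*?T+2*?T^2+?T^3+?T^4)*?M^2 + (1+(-5)*?T+?T^2+3*?T^3)*?M*?R + (5*?T+3*?T^2)*?R^2)
       + 16*?T^2*(1+?T-2)*?M*?R^3) - 2*(?M*((1+6*?T-?T^2*(13+(-10)*?T+3*?T^2+?T^4))*?M^3
         - 2*(1+?T-2)*(-1+(-6)*?T+18*?T^2+2*?T^3+3*?T^4)*?M^2*?R - (2*?T+66*?T^2+(-18)*?T^3+14*?T^4)*?M*?R^2)))
       / ((1+?T)^3*((1+?T)^4*(?S^2)^2 + ?M^2*(?M + (4*?R-2*?M)*?T + ?M*?T^2)^2 +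
       2*?S^2*((1+6*?T^2+?T^4)*?M^2 + (4*?T+(-8)*?T^2+4*?T^3)*?M*?R + 8*?T^2*?R^2))))"
      unfolding G1_def unf x of_real_push Z mult_zero_left
      by (simp only: diff_divide_distrib right_diff_distrib times_divide_eq_right ac_simps)
    then show ?thesis unfolding P(1,2) unfolding gcoef1_def sub .
  qed
  show "G2 \<mu>1 \<mu>3 g x = g * gcoef2 a n t r"
  proof -
    have "G2 \<mu>1 \<mu>3 g x = g * ((2*\<i>*((1+?T-2)*(?R-?M))*((2*(1+?T)^4*(?S^2)^2 + (1+?T)^4*?S^2*?M^2) - \<i>*((1+?T)^2*?S*(?S^2+?M^2)*(?M+2*?R*?T+?M*?T^2)) - ?M^2*(?M + (4*?R-2*?M)*?T + ?M*?T^2)^2))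
      / ((1+?T)^3*?S*((?S^2+?M^2)*((1+?T)^4*?S^2+(?M + (4*?R-2*?M)*?T + ?M*?T^2)^2))))"
      unfolding G2_def unf x of_real_push Z mult_zero_left S_def[symmetric] real_sqrt_abs abs_of_nonneg
      using assms(1) by (simp add: S_def ac_simps)
    then show ?thesis unfolding P(3) unfolding PQ P2(1) unfolding gcoef2_def sub by (simp only: mult.assoc)
  qed
  show "G3 \<mu>1 \<mu>3 g x = g * gcoef2 (-a) (-n) t r"
  proof -
    have "G3 \<mu>1 \<mu>3 g x = g * ((2*\<i>*((1+?T-2)*(?M-?R))*((2*(1+?T)^4*(?S^2)^2 + (1+?T)^4*?S^2*?M^2) + \<i>*((1+?T)^2*?S*(?S^2+?M^2)*(?M+2*?R*?T+?M*?T^2)) - ?M^2*(?M + (4*?R-2*?M)*?T + ?M*?T^2)^2))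
      / ((1+?T)^3*?S*((?S^2+?M^2)*((1+?T)^4*?S^2+(?M + (4*?R-2*?M)*?T + ?M*?T^2)^2))))"
      unfolding G3_def unf x of_real_push Z mult_zero_left S_def[symmetric] real_sqrt_abs abs_of_nonneg
      using assms(1) by (simp add: S_def ac_simps)
    then show ?thesis unfolding P(4) unfolding PQ P2(2) unfolding gcoef2_def sub by (simp only: mult.assoc)
  qed
  show "G4 \<mu>1 \<mu>3 g x = g^3 * gcoef4 a n t r"
  proof -
    have "G4 \<mu>1 \<mu>3 g x = g^3 * (-(4*((1+?T-2)*(?M-?R)^2*(-3*(1+?T)^2*?S^2 + (?M^2 + (8*?M*?R-6*?M^2)*?T + ?M^2*?T^2)))))
      / ((1+?T)^3*((?S^2+?M^2)*((1+?T)^4*?S^2+(?M + (4*?R-2*?M)*?T + ?M*?T^2)^2)))"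
      unfolding G4_def unf x of_real_push Z mult_zero_left 
      by (simp add: ac_simps)
    then show ?thesis unfolding P(3) unfolding P2(3) unfolding gcoef4_def sub by (simp only: mult.assoc times_divide_eq_right)
  qed
  show "G5 \<mu>1 \<mu>3 g x = gcoef5 a n t r"
  proof -
    have "G5 \<mu>1 \<mu>3 g x = ((1+?T)^2*?S^2 + ?M*(?M + (4*?R-2*?M)*?T + ?M*?T^2))
      / (4*?S^2*(?S+\<i>*?M)*((1+?T)^2*?S + \<i>*(?M + (4*?R-2*?M)*?T + ?M*?T^2)))"
      unfolding G5_def unf S_def[symmetric] unfolding x of_real_push Z mult_zero_left ..
    then show ?thesis unfolding P(5) unfolding PQ P2(4) unfolding gcoef5_def sub .
  qed
  show "G6_cofactor \<mu>1 \<mu>3 g x = gcoef6 a n t r"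
  proof -
    have "G6_cofactor \<mu>1 \<mu>3 g x = (\<i>*(?R-?M))
      / (?S*(?S+\<i>*?M)*((1+?T)^2*?S + \<i>*(?M + (4*?R-2*?M)*?T + ?M*?T^2)))"
      unfolding G6_cofactor_def unf S_def[symmetric] unfolding of_real_push Z mult_zero_left
      by (rule arg_cong2[where f="(/)"]) (simp_all add: algebra_simps)
    then show ?thesis unfolding P(5) unfolding gcoef6_def sub .
  qed
qed

text \<open>Both sides are expanded in monomials of first derivatives, treated as independent
  variables. \<open>Z\<close> is the mixed derivative of g and \<open>R\<close> the right side of
  its equation; \<open>Z'\<close>, \<open>R'\<close>, \<open>A'\<close> are the conjugates of
  \<open>Z\<close>, \<open>R\<close>, \<open>A\<close>, while \<open>p'\<close> is the conjugate of
  \<open>q\<close>, \<open>q'\<close> that of \<open>p\<close>, and \<open>C\<close> that of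
  \<open>C'\<close>. \<open>k\<close> and \<open>k'\<close> are the derivatives of K, and
  \<open>\<rho>\<close> is \<open>1/(2*r)\<close>. Each coefficient of the difference is one of the
  identities assumed.\<close>

lemma gauss_system:
  fixes g h t B n Z Z' p q p' q' k k' \<rho> m m' l l' mt mt' lt lt' mr mr' lr lr' s1 s2 s2' s4 s5 s5' s6 s6' :: complex
  assumes t: "t = g*h"
    and id1: "B*(m+m')* s1 + B*t^2*(l+l')* s4 + (B*(mt+mt') - 2*n*(t-1)*t*(m*l'-m'*l)) = 0"
    and id4: "B*(m+m')* s4 + B*(l+l')* s1 + (B*(lt+lt') + 2*(l+l') - 2*n*(t-1)*(l*m'-l'*m)) = 0"
    and id2: "B*(m+m')* s2 + B*t*(l+l')* s2' + (B*(mt + 2*l' + t*lt') + 2*m - 2*n*(t-1)*(m*m' - t^2*l*l')) = 0"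
    and id3: "B*(m+m')* s2' + B*t*(l+l')* s2 + (B*(mt' + 2*l + t*lt) + 2*m' + 2*n*(t-1)*(m*m' - t^2*l*l')) = 0"
    and id5: "B*(m+m')* s5 + B*t^2*(l+l')* s6 + B*mr'*\<rho> = 0"
    and id5': "B*(m+m')* s5' + B*t^2*(l+l')* s6' + B*mr*\<rho> = 0"
    and id6: "B*(m+m')* s6 + B*(l+l')* s5 + B*lr'*\<rho> = 0"
    and id6': "B*(m+m')* s6' + B*(l+l')* s5' + B*lr*\<rho> = 0"
    and A: "A = m*p + g^2*l*p'" "A' = m'*q' + h^2*l'*q" "C = m*p' + h^2*l*p" "C' = m'*q + g^2*l'*q'"
    and Ab: "Ab = m*Z + (mt*(q*h+g*q') + mr*(\<rho>*k'))*p + g^2*l*Z' + (2*g*q*l + g^2*(lt*(q*h+g*q') + lr*(\<rho>*k')))*p'"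
    and Cz: "Cz = m'*Z + (mt'*(p*h+g*p') + mr'*(\<rho>*k))*q + g^2*l'*Z' + (2*g*p*l' + g^2*(lt'*(p*h+g*p') + lr'*(\<rho>*k)))*q'"
    and R: "R = h* s1*p*q + g* s2*p*q' + g* s2'*p'*q + g^3* s4*p'*q' + k*(s5*q + g^2* s6*q') + k'*(s5'*p + g^2* s6'*p')"
    and R': "R' = g* s1*q'*p' + h* s2'*q'*p + h* s2*q*p' + h^3* s4*q*p + k'*(s5'*p' + h^2* s6'*p) + k*(s5*q' + h^2* s6*q)"
  shows "B*(Ab+Cz) + 2*g*(p'*C'+q'*A) - 2*n*g*(t-1)*(A*A'-C*C') = B*(m+m')*(Z-R) + B*g^2*(l+l')*(Z'-R')"
proof -
  have "B*(Ab+Cz) + 2*g*(p'*C'+q'*A) - 2*n*g*(t-1)*(A*A'-C*C') - (B*(m+m')*(Z-R) + B*g^2*(l+l')*(Z'-R'))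
    = p*q*h*(B*(m+m')* s1 + B*t^2*(l+l')* s4 + (B*(mt+mt') - 2*n*(t-1)*t*(m*l'-m'*l)))
      + p'*q'*g^3*(B*(m+m')* s4 + B*(l+l')* s1 + (B*(lt+lt') + 2*(l+l') - 2*n*(t-1)*(l*m'-l'*m)))
      + p*q'*g*(B*(m+m')* s2 + B*t*(l+l')* s2' + (B*(mt + 2*l' + t*lt') + 2*m - 2*n*(t-1)*(m*m' - t^2*l*l')))
      + p'*q*g*(B*(m+m')* s2' + B*t*(l+l')* s2 + (B*(mt' + 2*l + t*lt) + 2*m' + 2*n*(t-1)*(m*m' - t^2*l*l')))
      + k*q*(B*(m+m')* s5 + B*t^2*(l+l')* s6 + B*mr'*\<rho>)
      + k'*p*(B*(m+m')* s5' + B*t^2*(l+l')* s6' + B*mr*\<rho>)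
      + k*q'*g^2*(B*(m+m')* s6 + B*(l+l')* s5 + B*lr'*\<rho>)
      + k'*p'*g^2*(B*(m+m')* s6' + B*(l+l')* s5' + B*lr*\<rho>)"
    unfolding R R' Ab Cz unfolding A unfolding t by algebra
  then show ?thesis unfolding id1 id2 id3 id4 id5 id5' id6 id6' by simp
qed

subsection \<open>Equivalence of integrability and the equation of the Gauss map\<close>

lemma stereographic_inverse:
  fixes v :: "real^3"
  assumes "norm v = 1" "v $ 3 \<noteq> 1"
  defines "g \<equiv> gauss_map v"
  shows "complex_of_real (v $ 1) = (g + cnj g) / (1 + g * cnj g)"
    "complex_of_real (v $ 2) = - \<i> * (g - cnj g) / (1 + g * cnj g)"
    "complex_of_real (v $ 3) = (g * cnj g - 1) / (1 + g * cnj g)"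
proof -
  \<comment> \<open>With \<open>c\<close> as the distance of the third coordinate from 1, the sphere
    becomes \<open>x^2 + y^2 = c * (2 - c)\<close>, so \<open>1 + g * cnj g\<close> is
    \<open>2 / c\<close>.\<close>
  define x y z c where defs: "x = complex_of_real (v $ 1)" "y = complex_of_real (v $ 2)" "z = complex_of_real (v $ 3)"
    "c = complex_of_real (1 - v $ 3)"
  have c: "c \<noteq> 0" "z = 1 - c" using assms(2) by (simp_all add: defs)
  have "(v $ 1)^2 + (v $ 2)^2 + (v $ 3)^2 = 1"
    using assms(1) by (simp add: norm_eq_1 inner_vec_def sum_3 power2_eq_square)
  then have "complex_of_real ((v $ 1)^2 + (v $ 2)^2 + (v $ 3)^2) = 1" by simp
  then have xy: "x^2 + y^2 = c * (2 - c)"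
    unfolding c by (simp add: defs power2_eq_square algebra_simps)
  have g: "g = (x + \<i> * y) / c" and g': "cnj g = (x - \<i> * y) / c"
    by (simp_all add: g_def gauss_map_def defs)
  have "g * cnj g = (x^2 + y^2) / (c * c)"
    unfolding g' unfolding g by (simp add: algebra_simps power2_eq_square)
  then have "g * cnj g = (2 - c) / c" using c(1) unfolding xy by simp
  then have gg: "g * cnj g = 2 / c - 1" using c(1) by (simp add: diff_divide_distrib)
  then have gg': "1 + g * cnj g = 2 / c" "g * cnj g - 1 = 2 / c - 2" by simp_all
  have 1: "x = (g + cnj g) / (2 / c)" "y = - \<i> * (g - cnj g) / (2 / c)"
    unfolding g' unfolding g using c(1) by (simp_all add: field_simps)
  have 2: "z = (2 / c - 2) / (2 / c)" unfolding c(2) using c(1) by (simp add: field_simps)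
  show "complex_of_real (v $ 1) = (g + cnj g) / (1 + g * cnj g)"
    unfolding gg' using 1(1) unfolding defs(1) .
  show "complex_of_real (v $ 2) = - \<i> * (g - cnj g) / (1 + g * cnj g)"
    unfolding gg' using 1(2) unfolding defs(2) .
  show "complex_of_real (v $ 3) = (g * cnj g - 1) / (1 + g * cnj g)"
    unfolding gg' using 2 unfolding defs(3) .
qed

lemma cvec_nth [simp]: "cvec v $ i = complex_of_real (v $ i)"
  by (simp add: cvec_def)

lemma ccross_nth [simp]:
  "ccross u v $ 1 = u $ 2 * v $ 3 - u $ 3 * v $ 2"
  "ccross u v $ 2 = u $ 3 * v $ 1 - u $ 1 * v $ 3"
  "ccross u v $ 3 = u $ 1 * v $ 2 - u $ 2 * v $ 1"
  by (simp_all add: ccross_def)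

text \<open>Rational functions with real coefficients commute with conjugation; since
  \<open>a\<close> and \<open>n\<close> will be imaginary and \<open>t\<close>, \<open>r\<close>
  real, conjugation then only negates \<open>a\<close> and \<open>n\<close>.\<close>

lemma cnj_coef [simp]:
  "cnj (coef_m a n t r) = coef_m (cnj a) (cnj n) (cnj t) (cnj r)"
  "cnj (coef_l a n t r) = coef_l (cnj a) (cnj n) (cnj t) (cnj r)"
  "cnj (gcoef1 a n t r) = gcoef1 (cnj a) (cnj n) (cnj t) (cnj r)"
  "cnj (gcoef2 a n t r) = gcoef2 (cnj a) (cnj n) (cnj t) (cnj r)"
  "cnj (gcoef4 a n t r) = gcoef4 (cnj a) (cnj n) (cnj t) (cnj r)"
  "cnj (gcoef5 a n t r) = gcoef5 (cnj a) (cnj n) (cnj t) (cnj r)"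
  "cnj (gcoef6 a n t r) = gcoef6 (cnj a) (cnj n) (cnj t) (cnj r)"
  by (simp_all add: coef_m_def coef_l_def gcoef1_def gcoef2_def gcoef4_def gcoef5_def gcoef6_def)

text \<open>The common ground of immersions and of data not known to be integrable: \<open>a\<close>
  is only required to satisfy the implicit equation, and the connection only to act as
  \<open>diag (\<mu>1, \<mu>1, \<mu>3)\<close> followed by a cross product. \<open>n3\<close> keeps
  g finite on the whole domain.\<close>

locale normal_data =
  fixes U :: "complex set" and n :: "complex \<Rightarrow> real^3" and k :: "complex \<Rightarrow> real" and a :: "complex \<Rightarrow> complex^3"
    and \<Gamma> :: "complex \<Rightarrow> 3 \<Rightarrow> 3 \<Rightarrow> real^3" and \<mu>1 \<mu>3 :: real
  assumes U: "open U" and Ck_n: "Ck_on 2 U n" and Ck_k: "Ck_on 1 U k"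
    and unit: "u \<in> U \<Longrightarrow> norm (n u) = 1" and k_pos: "u \<in> U \<Longrightarrow> k u > 0" and n3: "u \<in> U \<Longrightarrow> n u $ 3 \<noteq> 1"
    and a: "u \<in> U \<Longrightarrow> a u = (\<i> / complex_of_real (sqrt (k u))) *s
               ccross (cvec (n u)) (nabla_z \<Gamma> a (\<lambda>v. cvec (n v)) u)"
    and conn: "u \<in> U \<Longrightarrow> conn_term (\<Gamma> u) (x::complex^3) y
       = ccross (vector [of_real \<mu>1 * x $ 1, of_real \<mu>1 * x $ 2, of_real \<mu>3 * x $ 3]) y"
begin

definition "g u = gauss_map (n u)"
definition "r u = complex_of_real (sqrt (k u))"
definition "t u = g u * cnj (g u)"
definition "al = \<i> * complex_of_real \<mu>1"
definition "nu = \<i> * complex_of_real (\<mu>3 - \<mu>1)"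
definition "p = wirt g"
definition "q = wirt_bar g"

lemma t_real: "t u = complex_of_real ((cmod (g u))^2)"
  unfolding t_def complex_norm_square ..

lemma cnj_simps [simp]: "cnj al = - al" "cnj nu = - nu" "cnj (t u) = t u" "cnj (r u) = r u"
  by (simp_all add: al_def nu_def t_real r_def)

text \<open>\<open>al\<close> and \<open>nu * t u\<close> are imaginary, so the factors of the
  denominators have real parts \<open>sqrt (k u)\<close> or \<open>B^2 * sqrt (k u)\<close>.
  Positivity of K thus excludes every zero.\<close>

lemma coeffs:
  assumes "u \<in> U"
  shows "gauss_coeffs al nu (t u) (r u) (1 + t u) (r u - al) (r u + al)
     ((1 + t u)^2 * (r u - al) - 4*nu * t u) ((1 + t u)^2 * (r u + al) + 4*nu * t u)"
proof -
  define B where "B = 1 + (cmod (g u))^2"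
  have B: "B > 0" by (simp add: B_def add_pos_nonneg)
  have s: "sqrt (k u) > 0" using k_pos[OF assms] by simp
  have 1: "1 + t u = complex_of_real B" by (simp add: B_def t_real)
  have Re1: "Re (r u - al) = sqrt (k u)" "Re (r u + al) = sqrt (k u)" by (simp_all add: r_def al_def)
  have nut: "4*nu * t u = \<i> * complex_of_real (4 * (\<mu>3 - \<mu>1) * (cmod (g u))^2)" by (simp add: nu_def t_real)
  have Re2: "Re ((1 + t u)^2 * (r u - al) - 4*nu * t u) = B^2 * sqrt (k u)"
    "Re ((1 + t u)^2 * (r u + al) + 4*nu * t u) = B^2 * sqrt (k u)"
    unfolding 1 nut of_real_power[symmetric] by (simp_all add: r_def al_def)
  show ?thesis
  proof unfold_locales
    show "1 + t u \<noteq> 0" using B unfolding 1 by simp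
    show "r u - al \<noteq> 0" using Re1(1) s by (metis order_less_irrefl zero_complex.sel(1))
    show "r u + al \<noteq> 0" using Re1(2) s by (metis order_less_irrefl zero_complex.sel(1))
    show "(1 + t u)^2 * (r u - al) - 4*nu * t u \<noteq> 0" using Re2(1) s B by (metis mult_pos_pos order_less_irrefl zero_complex.sel(1) zero_less_power)
    show "(1 + t u)^2 * (r u + al) + 4*nu * t u \<noteq> 0" using Re2(2) s B by (metis mult_pos_pos order_less_irrefl zero_complex.sel(1) zero_less_power)
    show "r u \<noteq> 0" using s by (simp add: r_def)
  qed simp_all
qed

lemma nonzero:
  assumes "u \<in> U"
  shows "1 + t u \<noteq> 0" "r u \<noteq> 0" "r u - al \<noteq> 0" "r u + al \<noteq> 0"
    "(1 + t u)^2 * (r u - al) - 4*nu * t u \<noteq> 0" "(1 + t u)^2 * (r u + al) + 4*nu * t u \<noteq> 0"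
  using gauss_coeffs.nz[OF coeffs[OF assms]] by auto

lemma Ck_nth: "Ck_on 2 U (\<lambda>u. complex_of_real (n u $ i))"
  by (rule Ck_on_bounded_linear[OF U _ Ck_n])
    (intro bounded_linear_compose[OF bounded_linear_of_real] bounded_linear_vec_nth)

lemma Ck_g: "Ck_on 2 U g"
proof -
  have "Ck_on 2 U (\<lambda>u. (complex_of_real (n u $ 1) + \<i> * complex_of_real (n u $ 2)) * inverse (1 - complex_of_real (n u $ 3)))"
    by (intro Ck_on_mult Ck_on_add Ck_on_inverse Ck_on_diff Ck_on_const U Ck_nth)
      (use n3 in \<open>metis eq_iff_diff_eq_0 of_real_eq_1_iff\<close>)
  then show ?thesis
    by (rule Ck_on_cong[OF U, rotated]) (simp add: g_def gauss_map_def divide_inverse)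
qed

lemma has_wirt_g: "u \<in> U \<Longrightarrow> has_wirt g u (p u) (q u)"
  unfolding p_def q_def using Ck_g by (intro has_wirtI[OF Ck_on_Suc_D[where k=1]]) (simp_all add: numeral_2_eq_2)

lemmas has_wirt_cnj_g = has_wirt_cnj[OF has_wirt_g]

text \<open>By the symmetry of second derivatives \<open>p\<close> and \<open>q\<close> share the
  mixed derivative, so the integrability equation involves a single unknown of second order and its
  conjugate.\<close>

lemma has_wirt_pq:
  assumes "u \<in> U"
  shows "has_wirt p u (wirt p u) (wirt_bar p u)" "has_wirt q u (wirt_bar p u) (wirt_bar q u)"
proof -
  have "Ck_on (Suc 1) U g" using Ck_g by (simp add: numeral_2_eq_2)
  from Ck_on_wirt[OF U this] have C: "Ck_on (Suc 0) U p" "Ck_on (Suc 0) U q" by (simp_all add: p_def q_def)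
  show "has_wirt p u (wirt p u) (wirt_bar p u)" by (rule has_wirtI[OF Ck_on_Suc_D[OF C(1) assms]])
  have "wirt q u = wirt_bar p u" unfolding p_def q_def using wirt_bar_wirt_commute[OF U Ck_g assms] by simp
  then show "has_wirt q u (wirt_bar p u) (wirt_bar q u)" using has_wirtI[OF Ck_on_Suc_D[OF C(2) assms]] by simp
qed

lemma n_eq:
  assumes "u \<in> U"
  shows "complex_of_real (n u $ 1) = (g u + cnj (g u)) / (1 + t u)"
    "complex_of_real (n u $ 2) = - \<i> * (g u - cnj (g u)) / (1 + t u)"
    "complex_of_real (n u $ 3) = (t u - 1) / (1 + t u)"
  using stereographic_inverse[OF unit n3] assms by (simp_all add: g_def t_def)

lemma has_wirt_t: "u \<in> U \<Longrightarrow> has_wirt t u (p u * cnj (g u) + g u * cnj (q u)) (q u * cnj (g u) + g u * cnj (p u))"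
  unfolding t_def[abs_def] by (rule has_wirt_mult[OF has_wirt_g has_wirt_cnj_g])

text \<open>With \<open>x\<close> and \<open>y\<close> the derivatives of \<open>g\<close> and
  \<open>h\<close>, the numerators of the quotient rule collapse to combinations of the null vector
  and its conjugate.\<close>

lemma stereo_derivative:
  fixes B g h x y j :: complex
  assumes "B = 1 + g * h" "B \<noteq> 0" "j^2 = -1"
  shows "((x + y) * B - (g + h) * (x * h + g * y)) / B^2 = ((1 - h^2) * x + (1 - g^2) * y) / B^2"
    "((- j * (x - y)) * B - (- j * (g - h)) * (x * h + g * y)) / B^2 = (- j * (1 + h^2) * x + j * (1 + g^2) * y) / B^2"
    "((x * h + g * y) * B - (g * h - 1) * (x * h + g * y)) / B^2 = (2 * h * x + 2 * g * y) / B^2"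
  unfolding assms(1)
  subgoal apply (rule arg_cong2[where f="(/)"]) apply (rule right_minus_eq[THEN iffD1]) apply algebra by simp
  subgoal apply (rule arg_cong2[where f="(/)"]) apply (rule right_minus_eq[THEN iffD1]) apply algebra by simp
  subgoal apply (rule arg_cong2[where f="(/)"]) apply (rule right_minus_eq[THEN iffD1]) apply algebra by simp
  done

lemma has_wirt_n:
  assumes u: "u \<in> U"
  defines "h \<equiv> cnj (g u)"
  shows "has_wirt (\<lambda>v. complex_of_real (n v $ 1)) u
       (((1 - h^2) * p u + (1 - (g u)^2) * cnj (q u)) / (1 + t u)^2)
       (((1 - h^2) * q u + (1 - (g u)^2) * cnj (p u)) / (1 + t u)^2)"
    "has_wirt (\<lambda>v. complex_of_real (n v $ 2)) u
       ((- \<i> * (1 + h^2) * p u + \<i> * (1 + (g u)^2) * cnj (q u)) / (1 + t u)^2)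
       ((- \<i> * (1 + h^2) * q u + \<i> * (1 + (g u)^2) * cnj (p u)) / (1 + t u)^2)"
    "has_wirt (\<lambda>v. complex_of_real (n v $ 3)) u
       ((2 * h * p u + 2 * g u * cnj (q u)) / (1 + t u)^2)
       ((2 * h * q u + 2 * g u * cnj (p u)) / (1 + t u)^2)"
proof -
  note B = nonzero(1)[OF u]
  have j: "\<i>^2 = -1" by simp
  have t: "1 + t u = 1 + g u * h" by (simp add: t_def h_def)
  note sd = stereo_derivative[OF t B j]
  have dB: "has_wirt (\<lambda>v. 1 + t v) u (p u * h + g u * cnj (q u)) (q u * h + g u * cnj (p u))"
    using has_wirt_add[OF has_wirt_const has_wirt_t[OF u], of 1] unfolding h_def by simp
  have 1: "has_wirt (\<lambda>v. g v + cnj (g v)) u (p u + cnj (q u)) (q u + cnj (p u))"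
    by (rule has_wirt_add[OF has_wirt_g[OF u] has_wirt_cnj_g[OF u]])
  have 2: "has_wirt (\<lambda>v. - \<i> * (g v - cnj (g v))) u (- \<i> * (p u - cnj (q u))) (- \<i> * (q u - cnj (p u)))"
    by (rule has_wirt_cmult[OF has_wirt_diff[OF has_wirt_g[OF u] has_wirt_cnj_g[OF u]]])
  have 3: "has_wirt (\<lambda>v. t v - 1) u (p u * h + g u * cnj (q u)) (q u * h + g u * cnj (p u))"
    using has_wirt_diff[OF has_wirt_t[OF u] has_wirt_const, of 1] unfolding h_def by simp
  show "has_wirt (\<lambda>v. complex_of_real (n v $ 1)) u
       (((1 - h^2) * p u + (1 - (g u)^2) * cnj (q u)) / (1 + t u)^2)
       (((1 - h^2) * q u + (1 - (g u)^2) * cnj (p u)) / (1 + t u)^2)"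
    using has_wirt_divide[OF 1 dB B] unfolding h_def[symmetric] sd
    by (rule has_wirt_cong[OF _ U u]) (simp add: n_eq)
  show "has_wirt (\<lambda>v. complex_of_real (n v $ 2)) u
       ((- \<i> * (1 + h^2) * p u + \<i> * (1 + (g u)^2) * cnj (q u)) / (1 + t u)^2)
       ((- \<i> * (1 + h^2) * q u + \<i> * (1 + (g u)^2) * cnj (p u)) / (1 + t u)^2)"
    using has_wirt_divide[OF 2 dB B] unfolding h_def[symmetric] sd
    by (rule has_wirt_cong[OF _ U u]) (simp add: n_eq)
  have 4: "t u - 1 = g u * h - 1" by (simp add: t_def h_def)
  show "has_wirt (\<lambda>v. complex_of_real (n v $ 3)) u
       ((2 * h * p u + 2 * g u * cnj (q u)) / (1 + t u)^2)
       ((2 * h * q u + 2 * g u * cnj (p u)) / (1 + t u)^2)"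
    using has_wirt_divide[OF 3 dB B] unfolding h_def[symmetric] 4 sd
    by (rule has_wirt_cong[OF _ U u]) (simp add: n_eq)
qed

text \<open>\<open>A u\<close> and \<open>cnj (C' u)\<close> are the coefficients of the covariant
  derivative of N in \<open>z\<close>, divided by the square root of K, along the null vector and
  its conjugate. Naming \<open>C'\<close> rather than its conjugate lets \<open>C'\<close> and
  \<open>cnj (A u)\<close> play the same roles for the derivative in \<open>zbar\<close>.\<close>

definition "A u = coef_m al nu (t u) (r u) * p u + (g u)^2 * coef_l al nu (t u) (r u) * cnj (q u)"
definition "C' u = coef_m (-al) (-nu) (t u) (r u) * q u + (g u)^2 * coef_l (-al) (-nu) (t u) (r u) * cnj (p u)"

lemma frame_form:
  assumes u: "u \<in> U"
  defines "h \<equiv> cnj (g u)" and "C \<equiv> cnj (C' u)"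
  shows "a u $ 1 = A u * (1 - h^2) - C * (1 - (g u)^2)"
    "a u $ 2 = A u * (- \<i> * (1 + h^2)) - C * (\<i> * (1 + (g u)^2))"
    "a u $ 3 = A u * (2 * h) - C * (2 * g u)"
    "nabla_z \<Gamma> a (\<lambda>v. cvec (n v)) u $ 1 = r u * (A u * (1 - h^2) + C * (1 - (g u)^2))"
    "nabla_z \<Gamma> a (\<lambda>v. cvec (n v)) u $ 2 = r u * (A u * (- \<i> * (1 + h^2)) + C * (\<i> * (1 + (g u)^2)))"
    "nabla_z \<Gamma> a (\<lambda>v. cvec (n v)) u $ 3 = r u * (A u * (2 * h) + C * (2 * g u))"
proof -
  let ?N = "nabla_z \<Gamma> a (\<lambda>v. cvec (n v)) u" and ?M = "complex_of_real \<mu>1" and ?R = "complex_of_real \<mu>3"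
  have j: "\<i>^2 = -1" by simp
  have t: "1 + t u = 1 + g u * h" "t u = g u * h" by (simp_all add: t_def h_def)
  note nz = nonzero[OF u]
  note N = n_eq[OF u, folded h_def]
  have N3: "complex_of_real (n u $ 3) = (g u * h - 1) / (1 + t u)" using N(3) by (simp add: t(2))
  have a1: "a u $ 1 = \<i> / r u * (of_real (n u $ 2) * ?N $ 3 - of_real (n u $ 3) * ?N $ 2)"
    "a u $ 2 = \<i> / r u * (of_real (n u $ 3) * ?N $ 1 - of_real (n u $ 1) * ?N $ 3)"
    "a u $ 3 = \<i> / r u * (of_real (n u $ 1) * ?N $ 2 - of_real (n u $ 2) * ?N $ 1)"
    by (simp_all only: a[OF u] vector_smult_component ccross_nth cvec_nth r_def)
  have N1: "?N $ 1 = ((1-h^2)*p u+(1-(g u)^2)*cnj (q u))/(1+t u)^2 + (?M*a u $ 2 * of_real (n u $ 3) - ?R*a u $ 3 * of_real (n u $ 2))"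
    "?N $ 2 = (-\<i>*(1+h^2)*p u+\<i>*(1+(g u)^2)*cnj (q u))/(1+t u)^2 + (?R*a u $ 3 * of_real (n u $ 1) - ?M*a u $ 1 * of_real (n u $ 3))"
    "?N $ 3 = (2*h*p u+2*g u*cnj (q u))/(1+t u)^2 + (?M*a u $ 1 * of_real (n u $ 2) - ?M*a u $ 2 * of_real (n u $ 1))"
    using has_wirt_n[OF u, THEN has_wirtD(1)]
    by (simp_all add: nabla_z_def conn[OF u] h_def)
  obtain A1 C1 where AC: "a u $ 1 = A1*(1-h^2) - C1*(1-(g u)^2)" "a u $ 2 = A1*(-\<i>*(1+h^2)) - C1*(\<i>*(1+(g u)^2))"
      "a u $ 3 = A1*(2*h) - C1*(2*g u)"
    "?N $ 1 = r u*(A1*(1-h^2) + C1*(1-(g u)^2))" "?N $ 2 = r u*(A1*(-\<i>*(1+h^2)) + C1*(\<i>*(1+(g u)^2)))"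
    "?N $ 3 = r u*(A1*(2*h) + C1*(2*g u))"
    "p u = ((1+t u)^2*(r u-\<i>*?M) - 2*\<i>*(?R-?M)*(g u*h))*A1 + 2*\<i>*(?R-?M)*(g u)^2*C1"
    "cnj (q u) = ((1+t u)^2*(r u-\<i>*?M) - 2*\<i>*(?R-?M)*(g u*h))*C1 + 2*\<i>*(?R-?M)*h^2*A1"
    by (rule frame_solve[OF j t(1) nz(1,2) N(1,2) N3 N1 a1])
  have e: "\<i>*?M = al" "2*\<i>*(?R-?M) = 2*nu" by (simp_all add: al_def nu_def)
  have pq: "p u = ((1+t u)^2*(r u-al) - 2*nu*t u)*A1 + 2*nu*(g u)^2*C1"
    "cnj (q u) = ((1+t u)^2*(r u-al) - 2*nu*t u)*C1 + 2*nu*h^2*A1"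
    using AC(7,8) unfolding e t(2)[symmetric] by simp_all
  \<comment> \<open>The coefficients obtained from \<open>frame_solve\<close> are known only to
    exist; invertibility of the system identifies them with the explicit formulas.\<close>
  have "A1 = A u" unfolding A_def using gauss_coeffs.invert_system(1)[OF coeffs[OF u] t(2) pq] .
  moreover have "C1 = C" unfolding C_def C'_def
    using gauss_coeffs.invert_system(2)[OF coeffs[OF u] t(2) pq] by (simp add: h_def)
  ultimately show "a u $ 1 = A u * (1 - h^2) - C * (1 - (g u)^2)"
    "a u $ 2 = A u * (- \<i> * (1 + h^2)) - C * (\<i> * (1 + (g u)^2))"
    "a u $ 3 = A u * (2 * h) - C * (2 * g u)"
    "nabla_z \<Gamma> a (\<lambda>v. cvec (n v)) u $ 1 = r u * (A u * (1 - h^2) + C * (1 - (g u)^2))"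
    "nabla_z \<Gamma> a (\<lambda>v. cvec (n v)) u $ 2 = r u * (A u * (- \<i> * (1 + h^2)) + C * (\<i> * (1 + (g u)^2)))"
    "nabla_z \<Gamma> a (\<lambda>v. cvec (n v)) u $ 3 = r u * (A u * (2 * h) + C * (2 * g u))"
    using AC by simp_all
qed

end

text \<open>A vector is normal exactly if both null directions pair to zero with it. For a real
  vector the second pairing is the conjugate of the first, which is what the hypothesis
  \<open>F'\<close> encodes.\<close>

lemma cross_normal_zero_iff:
  fixes g h B j n1 n2 n3 V1 V2 V3 :: complex
  assumes j: "j^2 = -1" and B: "B = 1 + g*h" "B \<noteq> 0"
    and n: "n1 = (g+h)/B" "n2 = -j*(g-h)/B" "n3 = (g*h-1)/B"
  defines "F \<equiv> (1-g^2)*V1 + j*(1+g^2)*V2 + 2*g*V3" and "F' \<equiv> (1-h^2)*V1 - j*(1+h^2)*V2 + 2*h*V3"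
  assumes F': "F = 0 \<Longrightarrow> F' = 0"
  shows "n2*V3-n3*V2 = 0 \<and> n3*V1-n1*V3 = 0 \<and> n1*V2-n2*V1 = 0 \<longleftrightarrow> F = 0"
proof
  have k: "n1*B = g + h" "n2*B = -j*(g-h)" "n3*B = g*h-1" using n B(2) by simp_all
  have e: "B*(x*y-x'*y') = (x*B)*y-(x'*B)*y'" for x y x' y' by (simp add: algebra_simps)
  have jF: "-j*B*F = (1-g^2)*((n2*B)*V3-(n3*B)*V2) + j*(1+g^2)*((n3*B)*V1-(n1*B)*V3) + 2*g*((n1*B)*V2-(n2*B)*V1)"
    unfolding k unfolding F_def B(1) apply (rule right_minus_eq[THEN iffD1]) by (simp only: algebra_simps power2_eq_square power3_eq_cube square_minus_one_simps[OF j]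
       mult_minus_left mult_minus_right minus_minus mult_1_left mult_1_right; algebra)
  {
    assume "n2*V3-n3*V2 = 0 \<and> n3*V1-n1*V3 = 0 \<and> n1*V2-n2*V1 = 0"
    then have "-j*B*F = 0" unfolding jF e[symmetric] by simp
    moreover have "j \<noteq> 0" using j by auto
    ultimately show "F = 0" using B(2) by simp
  }
  {
    assume "F = 0"
    have "2*B*(B*(n2*V3-n3*V2)) = -j*F*(1-h^2) + j*F'*(1-g^2)"
      unfolding e unfolding k unfolding F_def F'_def B(1) apply (rule right_minus_eq[THEN iffD1]) by (simp only: algebra_simps power2_eq_square power3_eq_cube square_minus_one_simps[OF j]
       mult_minus_left mult_minus_right minus_minus mult_1_left mult_1_right; algebra)
    moreover have "2*B*(B*(n3*V1-n1*V3)) = -j*F*(-j*(1+h^2)) + j*F'*(j*(1+g^2))"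
      unfolding e unfolding k unfolding F_def F'_def B(1) apply (rule right_minus_eq[THEN iffD1]) by (simp only: algebra_simps power2_eq_square power3_eq_cube square_minus_one_simps[OF j]
       mult_minus_left mult_minus_right minus_minus mult_1_left mult_1_right; algebra)
    moreover have "2*B*(B*(n1*V2-n2*V1)) = -j*F*(2*h) + j*F'*(2*g)"
      unfolding e unfolding k unfolding F_def F'_def B(1) apply (rule right_minus_eq[THEN iffD1]) by (simp only: algebra_simps power2_eq_square power3_eq_cube square_minus_one_simps[OF j]
       mult_minus_left mult_minus_right minus_minus mult_1_left mult_1_right; algebra)
    ultimately show "n2*V3-n3*V2 = 0 \<and> n3*V1-n1*V3 = 0 \<and> n1*V2-n2*V1 = 0"
      using F'[OF \<open>F = 0\<close>] \<open>F = 0\<close> B(2) by simp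
  }
qed

section \<open>Conjugate identities and nondegeneracy\<close>

context gauss_coeffs
begin

lemma id3: "B*(coef_m a n t r + coef_m (-a) (-n) t r)*gcoef2 (-a) (-n) t r + B*t*(coef_l a n t r + coef_l (-a) (-n) t r)*gcoef2 a n t r
   + (B*(coef_m_t (-a) (-n) t r + 2*coef_l a n t r + t*coef_l_t a n t r) + 2*coef_m (-a) (-n) t r
      + 2*n*(t-1)*(coef_m a n t r * coef_m (-a) (-n) t r - t^2*coef_l a n t r * coef_l (-a) (-n) t r)) = 0"
  using gauss_coeffs.id2[OF conj_locale] by (simp add: algebra_simps)

lemma id5': "B*(coef_m a n t r + coef_m (-a) (-n) t r)*gcoef5 (-a) (-n) t r + B*t^2*(coef_l a n t r + coef_l (-a) (-n) t r)*gcoef6 (-a) (-n) t r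
   + B*coef_m_r a n t r*(1/(2*r)) = 0"
  using gauss_coeffs.id5[OF conj_locale] by (simp add: algebra_simps)

lemma id6': "B*(coef_m a n t r + coef_m (-a) (-n) t r)*gcoef6 (-a) (-n) t r + B*(coef_l a n t r + coef_l (-a) (-n) t r)*gcoef5 (-a) (-n) t r
   + B*coef_l_r a n t r*(1/(2*r)) = 0"
  using gauss_coeffs.id6[OF conj_locale] by (simp add: algebra_simps)

text \<open>Together with its conjugate this is a 2 by 2 linear system for \<open>X\<close> and
  \<open>cnj X\<close>. Its determinant is \<open>B^2\<close> times the product of the two fractions
  in \<open>coef_sums\<close>, hence nonzero.\<close>

lemma conj_linear_zero_iff:
  assumes t: "t = g * cnj g" and real: "cnj r = r" "cnj a = - a" "cnj n = - n"
  shows "B*(coef_m a n t r + coef_m (-a) (-n) t r)*X + B*g^2*(coef_l a n t r + coef_l (-a) (-n) t r)*cnj X = 0 \<longleftrightarrow> X = 0"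
    (is "B*?m*X + B*g^2*?l*cnj X = 0 \<longleftrightarrow> _")
proof
  assume eq: "B*?m*X + B*g^2*?l*cnj X = 0"
  have ct: "cnj t = t" by (simp add: t)
  then have cB: "cnj B = B" by (simp add: B[symmetric])
  have "cnj ?m = ?m" "cnj ?l = ?l" by (simp_all add: real ct)
  then have eq': "B*?m*cnj X + B*(cnj g)^2*?l*X = 0"
    using arg_cong[OF eq, of cnj] cB by simp
  have "B^2*((?m + t*?l)*(?m - t*?l))*X = B*?m*(B*?m*X + B*g^2*?l*cnj X) - B*g^2*?l*(B*?m*cnj X + B*(cnj g)^2*?l*X)"
    unfolding t by (simp add: algebra_simps power2_eq_square)
  also have "\<dots> = 0" unfolding eq eq' by simp
  finally show "X = 0" unfolding coef_sums using nz by simp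
qed simp

end

section \<open>Second covariant derivatives of the normal\<close>

context normal_data
begin

definition "kz = wirt (\<lambda>u. complex_of_real (k u))"
definition "kzb = wirt_bar (\<lambda>u. complex_of_real (k u))"

lemma has_wirt_k:
  assumes u: "u \<in> U"
  shows "has_wirt (\<lambda>u. complex_of_real (k u)) u (kz u) (kzb u)" "kzb u = cnj (kz u)"
proof -
  have "(k has_derivative frechet_derivative k (at u)) (at u)" using Ck_on_Suc_D[of 0 U k u] Ck_k u by simp
  then have "((\<lambda>u. complex_of_real (k u)) has_derivative (\<lambda>h. of_real (frechet_derivative k (at u) h))) (at u)"
    by (rule bounded_linear.has_derivative[OF bounded_linear_of_real])
  from has_wirtI[OF this] show *: "has_wirt (\<lambda>u. complex_of_real (k u)) u (kz u) (kzb u)"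
    by (simp add: kz_def kzb_def)
  from has_wirtD(2)[OF has_wirt_cnj[OF this]] show "kzb u = cnj (kz u)" by (simp add: kzb_def)
qed

lemma has_wirt_r:
  assumes u: "u \<in> U"
  shows "has_wirt r u (1/(2*r u) * kz u) (1/(2*r u) * kzb u)"
proof -
  have "(k has_derivative frechet_derivative k (at u)) (at u)" using Ck_on_Suc_D[of 0 U k u] Ck_k u by simp
  then have "((\<lambda>u. sqrt (k u)) has_derivative (\<lambda>h. frechet_derivative k (at u) h * (inverse (sqrt (k u)) / 2))) (at u)"
    using k_pos[OF u] by (auto intro!: derivative_eq_intros)
  from bounded_linear.has_derivative[OF bounded_linear_of_real this]
  have "((\<lambda>u. complex_of_real (sqrt (k u))) has_derivative
     (\<lambda>h. of_real (frechet_derivative k (at u) h * (inverse (sqrt (k u)) / 2)))) (at u)" .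
  then have "has_wirt r u (wirt r u) (wirt_bar r u)"
    unfolding r_def[abs_def] by (rule has_wirtI)
  \<comment> \<open>Differentiability of \<open>r\<close> being known, its Wirtinger derivatives are
    read off from \<open>r * r = k\<close>.\<close>
  from has_wirt_mult[OF this this]
  have "has_wirt (\<lambda>u. complex_of_real (k u)) u (wirt r u * r u + r u * wirt r u) (wirt_bar r u * r u + r u * wirt_bar r u)"
    by (rule has_wirt_cong[OF _ U u]) (simp add: r_def of_real_mult[symmetric] abs_of_pos[OF k_pos] del: of_real_mult)
  from has_wirtD[OF this] have "kz u = 2 * r u * wirt r u" "kzb u = 2 * r u * wirt_bar r u"
    by (simp_all add: kz_def kzb_def)
  with \<open>has_wirt r u (wirt r u) (wirt_bar r u)\<close> show ?thesis using nonzero(2)[OF u] by simp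
qed

lemma has_wirt_g2: "u \<in> U \<Longrightarrow> has_wirt (\<lambda>u. (g u)^2) u (2 * g u * p u) (2 * g u * q u)"
  using has_wirt_mult[OF has_wirt_g has_wirt_g] by (simp add: power2_eq_square mult.commute mult.left_commute)

text \<open>Up to conjugation, the integrability expression differentiates \<open>A\<close> only in
  \<open>zbar\<close> and \<open>C'\<close> only in \<open>z\<close>. In these directions the second
  derivatives of g that appear are the mixed one and its conjugate; the other derivatives, which
  involve the unmixed ones, stay unspecified.\<close>

lemma has_wirt_A:
  assumes u: "u \<in> U"
  obtains Az where "has_wirt A u Az
     (coef_m al nu (t u) (r u) * wirt_bar p u
      + (coef_m_t al nu (t u) (r u) * (q u * cnj (g u) + g u * cnj (p u)) + coef_m_r al nu (t u) (r u) * (1/(2*r u) * kzb u)) * p u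
      + (g u)^2 * coef_l al nu (t u) (r u) * cnj (wirt_bar p u)
      + (2 * g u * q u * coef_l al nu (t u) (r u) + (g u)^2 * (coef_l_t al nu (t u) (r u) * (q u * cnj (g u) + g u * cnj (p u))
           + coef_l_r al nu (t u) (r u) * (1/(2*r u) * kzb u))) * cnj (q u))"
proof -
  note nz = nonzero[OF u]
  note c = has_wirt_coef[OF has_wirt_t[OF u] has_wirt_r[OF u] nz(1,3,5)]
  note h = has_wirt_add[OF has_wirt_mult[OF c(1) has_wirt_pq(1)[OF u]]
     has_wirt_mult[OF has_wirt_mult[OF has_wirt_g2[OF u] c(2)] has_wirt_cnj[OF has_wirt_pq(2)[OF u]]]]
  show ?thesis
    apply (rule that)
    unfolding A_def[abs_def]
    apply (rule back_subst[of "\<lambda>x. has_wirt _ _ _ x", OF h])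
    by (simp add: algebra_simps)
qed

lemma has_wirt_C':
  assumes u: "u \<in> U"
  obtains Cb where "has_wirt C' u
     (coef_m (-al) (-nu) (t u) (r u) * wirt_bar p u
      + (coef_m_t (-al) (-nu) (t u) (r u) * (p u * cnj (g u) + g u * cnj (q u)) + coef_m_r (-al) (-nu) (t u) (r u) * (1/(2*r u) * kz u)) * q u
      + (g u)^2 * coef_l (-al) (-nu) (t u) (r u) * cnj (wirt_bar p u)
      + (2 * g u * p u * coef_l (-al) (-nu) (t u) (r u) + (g u)^2 * (coef_l_t (-al) (-nu) (t u) (r u) * (p u * cnj (g u) + g u * cnj (q u))
           + coef_l_r (-al) (-nu) (t u) (r u) * (1/(2*r u) * kz u))) * cnj (p u)) Cb"
proof -
  have nz: "1 + t u \<noteq> 0" "r u - - al \<noteq> 0" "(1 + t u)^2 * (r u - - al) - 4* - nu * t u \<noteq> 0" using nonzero[OF u] by simp_all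
  note c = has_wirt_coef[OF has_wirt_t[OF u] has_wirt_r[OF u] nz]
  note h = has_wirt_add[OF has_wirt_mult[OF c(1) has_wirt_pq(2)[OF u]]
     has_wirt_mult[OF has_wirt_mult[OF has_wirt_g2[OF u] c(2)] has_wirt_cnj[OF has_wirt_pq(1)[OF u]]]]
  show ?thesis
    apply (rule that)
    unfolding C'_def[abs_def]
    apply (rule back_subst[of "\<lambda>x. has_wirt _ _ x _", OF h])
    by (simp add: algebra_simps)
qed

lemma nabla_zbar_cnj:
  assumes u: "u \<in> U"
  shows "nabla_zbar \<Gamma> a (\<lambda>v. cvec (n v)) u $ i = cnj (nabla_z \<Gamma> a (\<lambda>v. cvec (n v)) u $ i)"
  using exhaust_3[of i] has_wirt_n[OF u, THEN has_wirtD(1)] has_wirt_n[OF u, THEN has_wirtD(2)]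
  by (auto simp: nabla_z_def nabla_zbar_def conn[OF u] algebra_simps)

lemma b_form:
  assumes u: "u \<in> U"
  defines "Y \<equiv> (1 / sqrt (k u)) *\<^sub>R nabla_z \<Gamma> a (\<lambda>v. cvec (n v)) u"
    and "Y' \<equiv> (1 / sqrt (k u)) *\<^sub>R nabla_zbar \<Gamma> a (\<lambda>v. cvec (n v)) u"
  shows "Y $ 1 = A u * (1 - (cnj (g u))^2) + cnj (C' u) * (1 - (g u)^2)"
    "Y $ 2 = A u * (- \<i> * (1 + (cnj (g u))^2)) + cnj (C' u) * (\<i> * (1 + (g u)^2))"
    "Y $ 3 = A u * (2 * cnj (g u)) + cnj (C' u) * (2 * g u)"
    "Y' $ 1 = C' u * (1 - (cnj (g u))^2) + cnj (A u) * (1 - (g u)^2)"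
    "Y' $ 2 = C' u * (- \<i> * (1 + (cnj (g u))^2)) + cnj (A u) * (\<i> * (1 + (g u)^2))"
    "Y' $ 3 = C' u * (2 * cnj (g u)) + cnj (A u) * (2 * g u)"
proof -
  have s: "(1 / sqrt (k u)) *\<^sub>R (r u * x) = x" for x
    using k_pos[OF u] by (simp add: r_def scaleR_conv_of_real)
  have s': "(1 / sqrt (k u)) *\<^sub>R cnj (r u * x) = cnj x" for x
    using k_pos[OF u] by (simp add: r_def scaleR_conv_of_real)
  show "Y $ 1 = A u * (1 - (cnj (g u))^2) + cnj (C' u) * (1 - (g u)^2)"
    "Y $ 2 = A u * (- \<i> * (1 + (cnj (g u))^2)) + cnj (C' u) * (\<i> * (1 + (g u)^2))"
    "Y $ 3 = A u * (2 * cnj (g u)) + cnj (C' u) * (2 * g u)"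
    unfolding Y_def vector_scaleR_component frame_form(4-6)[OF u] s by (rule refl)+
  show "Y' $ 1 = C' u * (1 - (cnj (g u))^2) + cnj (A u) * (1 - (g u)^2)"
    "Y' $ 2 = C' u * (- \<i> * (1 + (cnj (g u))^2)) + cnj (A u) * (\<i> * (1 + (g u)^2))"
    "Y' $ 3 = C' u * (2 * cnj (g u)) + cnj (A u) * (2 * g u)"
    unfolding Y'_def vector_scaleR_component nabla_zbar_cnj[OF u] frame_form(4-6)[OF u] s' by simp_all
qed

lemma has_wirt_frame:
  assumes u: "u \<in> U"
  shows "has_wirt (\<lambda>u. 1 - (cnj (g u))^2) u (- 2 * cnj (g u) * cnj (q u)) (- 2 * cnj (g u) * cnj (p u))"
    "has_wirt (\<lambda>u. - \<i> * (1 + (cnj (g u))^2)) u (- \<i> * (2 * cnj (g u) * cnj (q u))) (- \<i> * (2 * cnj (g u) * cnj (p u)))"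
    "has_wirt (\<lambda>u. 2 * cnj (g u)) u (2 * cnj (q u)) (2 * cnj (p u))"
    "has_wirt (\<lambda>u. 1 - (g u)^2) u (- 2 * g u * p u) (- 2 * g u * q u)"
    "has_wirt (\<lambda>u. \<i> * (1 + (g u)^2)) u (\<i> * (2 * g u * p u)) (\<i> * (2 * g u * q u))"
    "has_wirt (\<lambda>u. 2 * g u) u (2 * p u) (2 * q u)"
proof -
  have 1: "has_wirt (\<lambda>u. (cnj (g u))^2) u (2 * cnj (g u) * cnj (q u)) (2 * cnj (g u) * cnj (p u))"
    using has_wirt_cnj[OF has_wirt_g2[OF u]] by simp
  show "has_wirt (\<lambda>u. 1 - (cnj (g u))^2) u (- 2 * cnj (g u) * cnj (q u)) (- 2 * cnj (g u) * cnj (p u))"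
    using has_wirt_diff[OF has_wirt_const 1, of 1] by simp
  show "has_wirt (\<lambda>u. - \<i> * (1 + (cnj (g u))^2)) u (- \<i> * (2 * cnj (g u) * cnj (q u))) (- \<i> * (2 * cnj (g u) * cnj (p u)))"
    using has_wirt_cmult[OF has_wirt_add[OF has_wirt_const 1], of "-\<i>" 1] by simp
  show "has_wirt (\<lambda>u. 2 * cnj (g u)) u (2 * cnj (q u)) (2 * cnj (p u))"
    by (rule has_wirt_cmult[OF has_wirt_cnj_g[OF u]])
  show "has_wirt (\<lambda>u. 1 - (g u)^2) u (- 2 * g u * p u) (- 2 * g u * q u)"
    using has_wirt_diff[OF has_wirt_const has_wirt_g2[OF u], of 1] by simp
  show "has_wirt (\<lambda>u. \<i> * (1 + (g u)^2)) u (\<i> * (2 * g u * p u)) (\<i> * (2 * g u * q u))"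
    using has_wirt_cmult[OF has_wirt_add[OF has_wirt_const has_wirt_g2[OF u]], of "\<i>" 1] by simp
  show "has_wirt (\<lambda>u. 2 * g u) u (2 * p u) (2 * q u)"
    by (rule has_wirt_cmult[OF has_wirt_g[OF u]])
qed

lemma integrability_iff_gauss:
  assumes w: "w \<in> U"
  shows "integrability_equation \<Gamma> a n k w \<longleftrightarrow> gauss_equation \<mu>1 \<mu>3 g k w"
proof -
  let ?Y = "\<lambda>u. (1 / sqrt (k u)) *\<^sub>R nabla_z \<Gamma> a (\<lambda>v. cvec (n v)) u"
  let ?Y' = "\<lambda>u. (1 / sqrt (k u)) *\<^sub>R nabla_zbar \<Gamma> a (\<lambda>v. cvec (n v)) u"
  \<comment> \<open>The vector that integrability requires to be normal. Its two summands are
    conjugate to each other, so it is real; see \<open>cV\<close>.\<close>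
  define V where "V = nabla_z \<Gamma> a ?Y' w + nabla_zbar \<Gamma> a ?Y w"
  define G where "G = g w"
  define H where "H = cnj (g w)"
  define B where "B = 1 + t w"
  have t: "t w = G * H" by (simp add: t_def G_def H_def)
  note nz = nonzero[OF w]
  obtain Az Ab where A: "has_wirt A w Az Ab"
    and Ab: "Ab = coef_m al nu (t w) (r w) * wirt_bar p w
      + (coef_m_t al nu (t w) (r w) * (q w * cnj (g w) + g w * cnj (p w)) + coef_m_r al nu (t w) (r w) * (1/(2*r w) * kzb w)) * p w
      + (g w)^2 * coef_l al nu (t w) (r w) * cnj (wirt_bar p w)
      + (2 * g w * q w * coef_l al nu (t w) (r w) + (g w)^2 * (coef_l_t al nu (t w) (r w) * (q w * cnj (g w) + g w * cnj (p w))
           + coef_l_r al nu (t w) (r w) * (1/(2*r w) * kzb w))) * cnj (q w)"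
    using has_wirt_A[OF w] by metis
  obtain Cz Cb where C: "has_wirt C' w Cz Cb"
    and Cz: "Cz = coef_m (-al) (-nu) (t w) (r w) * wirt_bar p w
      + (coef_m_t (-al) (-nu) (t w) (r w) * (p w * cnj (g w) + g w * cnj (q w)) + coef_m_r (-al) (-nu) (t w) (r w) * (1/(2*r w) * kz w)) * q w
      + (g w)^2 * coef_l (-al) (-nu) (t w) (r w) * cnj (wirt_bar p w)
      + (2 * g w * p w * coef_l (-al) (-nu) (t w) (r w) + (g w)^2 * (coef_l_t (-al) (-nu) (t w) (r w) * (p w * cnj (g w) + g w * cnj (q w))
           + coef_l_r (-al) (-nu) (t w) (r w) * (1/(2*r w) * kz w))) * cnj (p w)"
    using has_wirt_C'[OF w] by metis
  have wirt_Y: "wirt_bar (\<lambda>u. ?Y u $ i) w = Ab * e w + A w * eq + (cnj Cz * f w + cnj (C' w) * fq)"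
    if "\<And>u. u \<in> U \<Longrightarrow> ?Y u $ i = A u * e u + cnj (C' u) * f u" "has_wirt e w ep eq" "has_wirt f w fp fq" for i e f ep eq fp fq
    using has_wirt_cong[OF has_wirt_add[OF has_wirt_mult[OF A that(2)] has_wirt_mult[OF has_wirt_cnj[OF C] that(3)]] U w that(1)[symmetric]]
    by (rule has_wirtD(2))
  have wirt_Y': "wirt (\<lambda>u. ?Y' u $ i) w = Cz * e w + C' w * ep + (cnj Ab * f w + cnj (A w) * fp)"
    if "\<And>u. u \<in> U \<Longrightarrow> ?Y' u $ i = C' u * e u + cnj (A u) * f u" "has_wirt e w ep eq" "has_wirt f w fp fq" for i e f ep eq fp fq
    using has_wirt_cong[OF has_wirt_add[OF has_wirt_mult[OF C that(2)] has_wirt_mult[OF has_wirt_cnj[OF A] that(3)]] U w that(1)[symmetric]]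
    by (rule has_wirtD(1))
  note fr = has_wirt_frame[OF w, folded G_def H_def]
  let ?M = "complex_of_real \<mu>1" and ?R = "complex_of_real \<mu>3"
  have V1: "V $ 1 = (Cz * (1-H^2) + C' w * (-2*H*cnj (q w)) + (cnj Ab * (1-G^2) + cnj (A w) * (-2*G*p w)) + (?M*a w $ 2 * ?Y' w $ 3 - ?R*a w $ 3 * ?Y' w $ 2))
        + (Ab*(1-H^2) + A w * (-2*H*cnj (p w)) + (cnj Cz*(1-G^2) + cnj (C' w) *(-2*G*q w)) + (?M*cnj (a w $ 2) * ?Y w $ 3 - ?R*cnj (a w $ 3) * ?Y w $ 2))"
    unfolding V_def nabla_z_def[of _ _ ?Y'] nabla_zbar_def[of _ _ ?Y]
    using wirt_Y[OF b_form(1) fr(1,4)] wirt_Y'[OF b_form(4) fr(1,4)]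
    by (simp add: conn[OF w] G_def H_def)
  have V2: "V $ 2 = (Cz * (-\<i>*(1+H^2)) + C' w * (-\<i>*(2*H*cnj (q w))) + (cnj Ab * (\<i>*(1+G^2)) + cnj (A w) * (\<i>*(2*G*p w))) + (?R*a w $ 3 * ?Y' w $ 1 - ?M*a w $ 1 * ?Y' w $ 3))
        + (Ab*(-\<i>*(1+H^2)) + A w * (-\<i>*(2*H*cnj (p w))) + (cnj Cz*(\<i>*(1+G^2)) + cnj (C' w) *(\<i>*(2*G*q w))) + (?R*cnj (a w $ 3) * ?Y w $ 1 - ?M*cnj (a w $ 1) * ?Y w $ 3))"
    unfolding V_def nabla_z_def[of _ _ ?Y'] nabla_zbar_def[of _ _ ?Y]
    using wirt_Y[OF b_form(2) fr(2,5)] wirt_Y'[OF b_form(5) fr(2,5)]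
    by (simp add: conn[OF w] G_def H_def)
  have V3: "V $ 3 = (Cz * (2*H) + C' w * (2*cnj (q w)) + (cnj Ab * (2*G) + cnj (A w) * (2*p w)) + (?M*a w $ 1 * ?Y' w $ 2 - ?M*a w $ 2 * ?Y' w $ 1))
        + (Ab*(2*H) + A w * (2*cnj (p w)) + (cnj Cz*(2*G) + cnj (C' w) *(2*q w)) + (?M*cnj (a w $ 1) * ?Y w $ 2 - ?M*cnj (a w $ 2) * ?Y w $ 1))"
    unfolding V_def nabla_z_def[of _ _ ?Y'] nabla_zbar_def[of _ _ ?Y]
    using wirt_Y[OF b_form(3) fr(3,6)] wirt_Y'[OF b_form(6) fr(3,6)]
    by (simp add: conn[OF w] G_def H_def)
  have j: "\<i>^2 = -1" by simp
  have BGH: "B = 1 + G * H" by (simp add: B_def t)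
  have cG: "cnj G = H" "cnj H = G" by (simp_all add: G_def H_def)
  note ff = frame_form(1-3)[OF w, folded G_def H_def]
  have cff: "cnj (a w $ 1) = cnj (A w) * (1 - G^2) - C' w * (1 - H^2)"
    "cnj (a w $ 2) = cnj (A w) * (\<i> * (1 + G^2)) - C' w * (- \<i> * (1 + H^2))"
    "cnj (a w $ 3) = cnj (A w) * (2 * G) - C' w * (2 * H)"
    unfolding ff by (simp_all add: cG)
  note bf = b_form[OF w, folded G_def H_def]
  let ?m = "coef_m al nu (t w) (r w)" and ?m' = "coef_m (-al) (-nu) (t w) (r w)"
  let ?l = "coef_l al nu (t w) (r w)" and ?l' = "coef_l (-al) (-nu) (t w) (r w)"
  \<comment> \<open>The right side of the equation of the Gauss map in the rational coefficients,
    grouped as \<open>gauss_system\<close> expects it.\<close>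
  define R where "R = H * gcoef1 al nu (t w) (r w) * p w * q w + G * gcoef2 al nu (t w) (r w) * p w * cnj (p w)
    + G * gcoef2 (-al) (-nu) (t w) (r w) * cnj (q w) * q w + G^3 * gcoef4 al nu (t w) (r w) * cnj (q w) * cnj (p w)
    + kz w * (gcoef5 al nu (t w) (r w) * q w + G^2 * gcoef6 al nu (t w) (r w) * cnj (p w))
    + kzb w * (gcoef5 (-al) (-nu) (t w) (r w) * p w + G^2 * gcoef6 (-al) (-nu) (t w) (r w) * cnj (q w))"
  interpret gc: gauss_coeffs al nu "t w" "r w" B "r w - al" "r w + al"
     "B^2 * (r w - al) - 4*nu * t w" "B^2 * (r w + al) + 4*nu * t w"
    using coeffs[OF w] unfolding B_def .
  have cR: "cnj R = G * gcoef1 al nu (t w) (r w) * cnj (p w) * cnj (q w) + H * gcoef2 (-al) (-nu) (t w) (r w) * cnj (p w) * p w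
    + H * gcoef2 al nu (t w) (r w) * q w * cnj (q w) + H^3 * gcoef4 al nu (t w) (r w) * q w * p w
    + kzb w * (gcoef5 (-al) (-nu) (t w) (r w) * cnj (q w) + H^2 * gcoef6 (-al) (-nu) (t w) (r w) * p w)
    + kz w * (gcoef5 al nu (t w) (r w) * cnj (p w) + H^2 * gcoef6 al nu (t w) (r w) * q w)"
    unfolding R_def has_wirt_k(2)[OF w] by (simp add: cG gc.sols_even' ac_simps)
  have id5: "B*(?m+?m')*gcoef5 al nu (t w) (r w) + B*(t w)^2*(?l+?l')*gcoef6 al nu (t w) (r w)
      + B*coef_m_r (-al) (-nu) (t w) (r w)*(1/(2*r w)) = 0"
    using gc.id5 by simp
  have id6: "B*(?m+?m')*gcoef6 al nu (t w) (r w) + B*(?l+?l')*gcoef5 al nu (t w) (r w)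
      + B*coef_l_r (-al) (-nu) (t w) (r w)*(1/(2*r w)) = 0"
    using gc.id6 by simp
  have cA: "A w = ?m * p w + G^2 * ?l * cnj (q w)" "cnj (A w) = ?m' * cnj (p w) + H^2 * ?l' * q w"
    "cnj (C' w) = ?m * cnj (q w) + H^2 * ?l * p w" "C' w = ?m' * q w + G^2 * ?l' * cnj (p w)"
    by (simp_all add: A_def C'_def G_def H_def)
  have F: "(1-G^2) * V $ 1 + \<i>*(1+G^2) * V $ 2 + 2*G * V $ 3
     = 2*B*(B*(Ab+Cz) + 2*G*(cnj (q w) * C' w + cnj (p w) * A w)
         - 2*\<i>*(?R-?M)*G*(G*H-1)*(A w * cnj (A w) - cnj (C' w) * C' w))"
    by (rule frame_pairing[OF j BGH ff bf(1-3) cff bf(4-6) V1 V2 V3])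
  also have "B*(Ab+Cz) + 2*G*(cnj (q w) * C' w + cnj (p w) * A w)
         - 2*\<i>*(?R-?M)*G*(G*H-1)*(A w * cnj (A w) - cnj (C' w) * C' w)
      = B*(Ab+Cz) + 2*G*(cnj (q w) * C' w + cnj (p w) * A w)
         - 2*nu*G*(t w-1)*(A w * cnj (A w) - cnj (C' w) * C' w)"
    by (simp add: nu_def t)
  also have "\<dots> = B*(?m+?m')*(wirt_bar p w - R) + B*G^2*(?l+?l')*(cnj (wirt_bar p w) - cnj R)"
    by (rule gauss_system[OF t gc.id1 gc.id4 gc.id2 gc.id3 id5 gc.id5' id6 gc.id6' cA
       Ab[folded G_def H_def] Cz[folded G_def H_def] R_def cR])
  finally have F: "(1-G^2) * V $ 1 + \<i>*(1+G^2) * V $ 2 + 2*G * V $ 3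
     = 2*B*(B*(?m+?m')*(wirt_bar p w - R) + B*G^2*(?l+?l')*cnj (wirt_bar p w - R))" by simp
  have cV: "cnj (V $ 1) = V $ 1" "cnj (V $ 2) = V $ 2" "cnj (V $ 3) = V $ 3"
    unfolding V1 V2 V3 bf by (simp_all add: cG algebra_simps)
  have F': "(1-H^2) * V $ 1 - \<i>*(1+H^2) * V $ 2 + 2*H * V $ 3 = 0" 
    if "(1-G^2) * V $ 1 + \<i>*(1+G^2) * V $ 2 + 2*G * V $ 3 = 0"
    using arg_cong[OF that, of cnj] by (simp add: cG cV)
  have "integrability_equation \<Gamma> a n k w \<longleftrightarrow> ccross (cvec (n w)) V = 0"
    by (simp add: integrability_equation_def V_def)
  also have "\<dots> \<longleftrightarrow> of_real (n w $ 2) * V $ 3 - of_real (n w $ 3) * V $ 2 = 0 \<and>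
     of_real (n w $ 3) * V $ 1 - of_real (n w $ 1) * V $ 3 = 0 \<and> of_real (n w $ 1) * V $ 2 - of_real (n w $ 2) * V $ 1 = 0"
    by (simp add: vec_eq_iff forall_3)
  also have "\<dots> \<longleftrightarrow> (1-G^2) * V $ 1 + \<i>*(1+G^2) * V $ 2 + 2*G * V $ 3 = 0"
    by (rule cross_normal_zero_iff[OF j BGH gc.nz(1) n_eq(1,2)[OF w, folded G_def H_def B_def]
         n_eq(3)[OF w, folded B_def, unfolded t] F'])
  \<comment> \<open>The pairing is conjugate linear plus linear in this difference, with
    coefficients of different modulus.\<close>
  also have "\<dots> \<longleftrightarrow> wirt_bar p w - R = 0"
    unfolding F using gc.nz(1) gc.conj_linear_zero_iff[of G "wirt_bar p w - R"] t cG
    by simp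
  also have "\<dots> \<longleftrightarrow> gauss_equation \<mu>1 \<mu>3 g k w"
  proof -
    have cg: "wirt (\<lambda>u. cnj (g u)) w = cnj (q w)" "wirt_bar (\<lambda>u. cnj (g u)) w = cnj (p w)"
      using has_wirtD[OF has_wirt_cnj_g[OF w]] by simp_all
    note GG = G_eq_gcoef[OF k_pos[OF w] t_real r_def al_def nu_def]
    have "gauss_equation \<mu>1 \<mu>3 g k w \<longleftrightarrow> wirt_bar p w = R"
      unfolding gauss_equation_def Let_def G6_def G7_def G8_def GG cg p_def[symmetric] q_def[symmetric]
        kz_def[symmetric] kzb_def[symmetric] fun_cong[OF kz_def[symmetric]] fun_cong[OF kzb_def[symmetric]] R_def G_def H_def
      by (simp add: algebra_simps)
    then show ?thesis by simp
  qed
  finally show ?thesis .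
qed

end

subsection \<open>Smooth functions and tangent vectors on manifolds\<close>

text \<open>Differentiability classes are local. This allows a different target chart, or a
  different system of functions, around each point.\<close>

lemma Ck_on_local:
  assumes "\<And>x. x \<in> S \<Longrightarrow> \<exists>T. open T \<and> x \<in> T \<and> Ck_on k T f"
  shows "Ck_on k S f"
  using assms
proof (induction k arbitrary: f)
  case 0
  have "isCont f x" if x: "x \<in> S" for x
  proof -
    obtain T where "open T" "x \<in> T" "continuous_on T f" using 0[OF x] by auto
    then show ?thesis using continuous_on_eq_continuous_at by blast
  qed
  then have "continuous_on S f" by (intro continuous_at_imp_continuous_on) blast
  then show ?case by simp
next
  case (Suc k)
  show ?case unfolding Ck_on.simps
  proof (intro conjI ballI allI)
    fix x assume "x \<in> S"
    obtain T where "x \<in> T" "Ck_on (Suc k) T f" using Suc.prems[OF \<open>x \<in> S\<close>] by blast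
    then show "f differentiable (at x)" by simp
  next
    fix v
    show "Ck_on k S (\<lambda>x. frechet_derivative f (at x) v)"
    proof (rule Suc.IH)
      fix x assume "x \<in> S"
      obtain T where "open T" "x \<in> T" "Ck_on (Suc k) T f" using Suc.prems[OF \<open>x \<in> S\<close>] by blast
      then show "\<exists>T. open T \<and> x \<in> T \<and> Ck_on k T (\<lambda>x. frechet_derivative f (at x) v)" by auto
    qed
  qed
qed

lemma smooth_on_Ck: "smooth_on S f \<Longrightarrow> Ck_on k S f"
  by (simp add: smooth_on_def)

locale atlas =
  fixes \<A> :: "('m::topological_space, 'e::euclidean_space) atlas"
  assumes smooth_atlas: "smooth_atlas \<A>"
begin

lemma chart:
  assumes "(U, \<kappa>) \<in> \<A>"
  shows "open U" "open (\<kappa> ` U)" "homeomorphism U (\<kappa> ` U) \<kappa> (inv_into U \<kappa>)"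
  using smooth_atlas assms by (auto simp: smooth_atlas_def)

lemma chart_inv: "(U, \<kappa>) \<in> \<A> \<Longrightarrow> r \<in> U \<Longrightarrow> inv_into U \<kappa> (\<kappa> r) = r"
  using chart(3) homeomorphism_apply1 by blast

lemma chart_at: obtains U \<kappa> where "(U, \<kappa>) \<in> \<A>" "r \<in> U"
  using smooth_atlas by (force simp: smooth_atlas_def)

lemma chart_image_open:
  assumes "(U, \<kappa>) \<in> \<A>" "open W"
  shows "open (\<kappa> ` (U \<inter> W))"
proof -
  have "openin (top_of_set (\<kappa> ` U)) (\<kappa> ` (U \<inter> W))"
    using homeomorphism_imp_open_map[OF chart(3)[OF assms(1)]] assms(2) by (simp add: openin_open_Int)
  then show ?thesis using chart(2)[OF assms(1)] openin_open_eq by blast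
qed

lemma smooth_funD: "smooth_fun \<A> f \<Longrightarrow> (U, \<kappa>) \<in> \<A> \<Longrightarrow> Ck_on k (\<kappa> ` U) (\<lambda>x. f (inv_into U \<kappa> x))"
  by (auto simp: smooth_fun_def smooth_on_def o_def)

lemma smooth_funI:
  "(\<And>U \<kappa> k. (U, \<kappa>) \<in> \<A> \<Longrightarrow> Ck_on k (\<kappa> ` U) (\<lambda>x. f (inv_into U \<kappa> x))) \<Longrightarrow> smooth_fun \<A> f"
  by (auto simp: smooth_fun_def smooth_on_def o_def)

lemma smooth_fun_const: "smooth_fun \<A> (\<lambda>r. c)"
  by (rule smooth_funI) (simp add: Ck_on_const chart)

lemma smooth_fun_add: "smooth_fun \<A> f \<Longrightarrow> smooth_fun \<A> g \<Longrightarrow> smooth_fun \<A> (\<lambda>r. f r + g r)"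
  by (rule smooth_funI) (intro Ck_on_add smooth_funD chart)

lemma smooth_fun_mult: "smooth_fun \<A> f \<Longrightarrow> smooth_fun \<A> g \<Longrightarrow> smooth_fun \<A> (\<lambda>r. f r * g r)"
  by (rule smooth_funI) (intro Ck_on_mult smooth_funD chart)

lemma smooth_fun_compose:
  assumes "smooth_map \<A> \<B> \<phi>" "smooth_atlas \<B>" "smooth_fun \<B> f"
  shows "smooth_fun \<A> (\<lambda>r. f (\<phi> r))"
proof (rule smooth_funI, rule Ck_on_local)
  fix U \<kappa> k x assume U: "(U, \<kappa>) \<in> \<A>" and "x \<in> \<kappa> ` U"
  interpret B: atlas \<B> by unfold_locales fact
  let ?r = "inv_into U \<kappa>"
  have r: "?r x \<in> U" "\<kappa> (?r x) = x" using \<open>x \<in> \<kappa> ` U\<close> by (auto simp: inv_into_into f_inv_into_f)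
  obtain V \<eta> where V: "(V, \<eta>) \<in> \<B>" "\<phi> (?r x) \<in> V" using B.chart_at .
  let ?O = "\<kappa> ` (U \<inter> \<phi> -` V)"
  have "open (\<phi> -` V)"
    using assms(1) B.chart(1)[OF V(1)] by (auto simp: smooth_map_def continuous_on_open_vimage[OF open_UNIV])
  then have "open ?O" by (rule chart_image_open[OF U])
  moreover have "x \<in> ?O" using r V(2) by force
  moreover have "Ck_on k ?O (\<lambda>y. f (\<phi> (?r y)))"
  \<comment> \<open>Near \<open>x\<close> the function factors through the chart of the target as a
    composition of two smooth coordinate expressions.\<close>
  proof (rule Ck_on_cong[OF \<open>open ?O\<close>])
    have "Ck_on k ?O (\<lambda>y. \<eta> (\<phi> (?r y)))"
      using assms(1) U V(1) by (fastforce simp: smooth_map_def smooth_on_def o_def)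
    moreover have "(\<lambda>y. \<eta> (\<phi> (?r y))) ` ?O \<subseteq> \<eta> ` V" using chart_inv[OF U] by auto
    ultimately show "Ck_on k ?O (\<lambda>y. f (inv_into V \<eta> (\<eta> (\<phi> (?r y)))))"
      using Ck_on_compose[OF \<open>open ?O\<close> _ B.smooth_funD[OF assms(3) V(1)]] by blast
    show "f (inv_into V \<eta> (\<eta> (\<phi> (?r y)))) = f (\<phi> (?r y))" if "y \<in> ?O" for y
      using that chart_inv[OF U] B.chart_inv[OF V(1)] by auto
  qed
  ultimately show "\<exists>T. open T \<and> x \<in> T \<and> Ck_on k T (\<lambda>y. f (\<phi> (?r y)))" by blast
qed

text \<open>The conformal parameter is compatible with the atlas but need not belong to it. The
  identity is a smooth map from the enlarged atlas to the original one, so composing with it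
  transfers smoothness to the new chart.\<close>

lemma smooth_fun_insert_chart:
  assumes "smooth_atlas (insert (V, \<zeta>) \<A>)" "smooth_fun \<A> f"
  shows "Ck_on k (\<zeta> ` V) (\<lambda>w. f (inv_into V \<zeta> w))"
proof -
  interpret I: atlas "insert (V, \<zeta>) \<A>" by unfold_locales fact
  have "smooth_map (insert (V, \<zeta>) \<A>) \<A> (\<lambda>r. r)"
    using assms(1) by (fastforce simp: smooth_map_def smooth_atlas_def o_def)
  from I.smooth_funD[OF I.smooth_fun_compose[OF this smooth_atlas assms(2)]] show ?thesis by simp
qed

section \<open>Tangent vectors as derivations\<close>

lemma tangentD:
  assumes "v \<in> tangent_space \<A> q"
  shows "\<not> smooth_fun \<A> f \<Longrightarrow> v f = 0"
    "smooth_fun \<A> f \<Longrightarrow> smooth_fun \<A> g \<Longrightarrow> v (\<lambda>r. f r + g r) = v f + v g"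
    "smooth_fun \<A> f \<Longrightarrow> v (\<lambda>r. c * f r) = c * v f"
    "smooth_fun \<A> f \<Longrightarrow> smooth_fun \<A> g \<Longrightarrow> v (\<lambda>r. f r * g r) = f q * v g + g q * v f"
  using assms by (auto simp: tangent_space_def)

lemma tangentI:
  assumes "\<And>f. \<not> smooth_fun \<A> f \<Longrightarrow> v f = 0"
    "\<And>f g. smooth_fun \<A> f \<Longrightarrow> smooth_fun \<A> g \<Longrightarrow> v (\<lambda>r. f r + g r) = v f + v g"
    "\<And>c f. smooth_fun \<A> f \<Longrightarrow> v (\<lambda>r. c * f r) = c * v f"
    "\<And>f g. smooth_fun \<A> f \<Longrightarrow> smooth_fun \<A> g \<Longrightarrow> v (\<lambda>r. f r * g r) = f q * v g + g q * v f"
  shows "v \<in> tangent_space \<A> q"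
  using assms by (auto simp: tangent_space_def)

lemma tangent_const:
  assumes "v \<in> tangent_space \<A> q"
  shows "v (\<lambda>r. c) = 0"
proof -
  have "v (\<lambda>r. 1 * 1) = 1 * v (\<lambda>r. 1) + 1 * v (\<lambda>r. 1)"
    using tangentD(4)[OF assms smooth_fun_const smooth_fun_const, of 1 1] .
  then have "v (\<lambda>r. 1) = 0" by simp
  then show ?thesis using tangentD(3)[OF assms smooth_fun_const, of c 1] by simp
qed

lemma tangent_add: "u \<in> tangent_space \<A> q \<Longrightarrow> v \<in> tangent_space \<A> q \<Longrightarrow> (\<lambda>f. u f + v f) \<in> tangent_space \<A> q"
  by (simp add: tangent_space_def algebra_simps)

lemma tangent_scale: "u \<in> tangent_space \<A> q \<Longrightarrow> (\<lambda>f. c * u f) \<in> tangent_space \<A> q"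
  by (simp add: tangent_space_def algebra_simps)

lemma tangent_zero: "(\<lambda>f. 0) \<in> tangent_space \<A> q"
  by (simp add: tangent_space_def)

lemma tangent_sum:
  assumes "finite I" "\<And>i. i \<in> I \<Longrightarrow> u i \<in> tangent_space \<A> q"
  shows "(\<lambda>f. \<Sum>i\<in>I. c i * u i f) \<in> tangent_space \<A> q"
  using assms
proof (induction I rule: finite_induct)
  case (insert i I)
  then show ?case using tangent_add[OF tangent_scale[of "u i" q "c i"]] by simp
qed (simp add: tangent_zero)

lemma pushforward_tangent:
  assumes "smooth_map \<A> \<B> \<phi>" "smooth_atlas \<B>" "v \<in> tangent_space \<A> q"
  shows "pushforward \<B> \<phi> v \<in> tangent_space \<B> (\<phi> q)"
proof -
  interpret B: atlas \<B> by unfold_locales fact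
  note c = smooth_fun_compose[OF assms(1,2)]
  show ?thesis
  proof (rule B.tangentI)
    show "pushforward \<B> \<phi> v f = 0" if "\<not> smooth_fun \<B> f" for f
      using that by (simp add: pushforward_def)
    show "pushforward \<B> \<phi> v (\<lambda>r. f r + g r) = pushforward \<B> \<phi> v f + pushforward \<B> \<phi> v g"
      if "smooth_fun \<B> f" "smooth_fun \<B> g" for f g
      using tangentD(2)[OF assms(3) c[OF that(1)] c[OF that(2)]] that B.smooth_fun_add[OF that]
      by (simp add: pushforward_def o_def)
    show "pushforward \<B> \<phi> v (\<lambda>r. c * f r) = c * pushforward \<B> \<phi> v f" if "smooth_fun \<B> f" for c f
      using tangentD(3)[OF assms(3) smooth_fun_compose[OF assms(1,2) that]] that B.smooth_fun_mult[OF B.smooth_fun_const that]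
      by (simp add: pushforward_def o_def)
    show "pushforward \<B> \<phi> v (\<lambda>r. f r * g r) = f (\<phi> q) * pushforward \<B> \<phi> v g + g (\<phi> q) * pushforward \<B> \<phi> v f"
      if "smooth_fun \<B> f" "smooth_fun \<B> g" for f g
      using tangentD(4)[OF assms(3) c[OF that(1)] c[OF that(2)]] that B.smooth_fun_mult[OF that]
      by (simp add: pushforward_def o_def)
  qed
qed

end

lemma coord_vector_tangent:
  assumes \<A>: "smooth_atlas \<A>" and "smooth_atlas (insert (V, \<zeta>) \<A>)" "p \<in> V"
  shows "coord_vector \<A> V \<zeta> p v \<in> tangent_space \<A> p"
proof -
  interpret atlas \<A> by unfold_locales fact
  interpret I: atlas "insert (V, \<zeta>) \<A>" by unfold_locales fact
  have p: "inv_into V \<zeta> (\<zeta> p) = p" using I.chart_inv assms(3) by blast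
  have d: "((\<lambda>w. f (inv_into V \<zeta> w)) has_derivative frechet_derivative (\<lambda>w. f (inv_into V \<zeta> w)) (at (\<zeta> p))) (at (\<zeta> p))"
    if "smooth_fun \<A> f" for f
    using Ck_on_Suc_D[OF smooth_fun_insert_chart[OF assms(2) that]] assms(3) by blast
  have 1: "frechet_derivative (\<lambda>w. f (inv_into V \<zeta> w) + g (inv_into V \<zeta> w)) (at (\<zeta> p)) =
     (\<lambda>h. frechet_derivative (\<lambda>w. f (inv_into V \<zeta> w)) (at (\<zeta> p)) h + frechet_derivative (\<lambda>w. g (inv_into V \<zeta> w)) (at (\<zeta> p)) h)"
    if "smooth_fun \<A> f" "smooth_fun \<A> g" for f g
    by (rule frechet_derivative_eqI[OF has_derivative_add[OF d[OF that(1)] d[OF that(2)]]])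
  have 2: "frechet_derivative (\<lambda>w. f (inv_into V \<zeta> w) * g (inv_into V \<zeta> w)) (at (\<zeta> p)) =
     (\<lambda>h. f p * frechet_derivative (\<lambda>w. g (inv_into V \<zeta> w)) (at (\<zeta> p)) h + frechet_derivative (\<lambda>w. f (inv_into V \<zeta> w)) (at (\<zeta> p)) h * g p)"
    if "smooth_fun \<A> f" "smooth_fun \<A> g" for f g
    using frechet_derivative_eqI[OF has_derivative_mult[OF d[OF that(1)] d[OF that(2)]]] unfolding p .
  have 3: "frechet_derivative (\<lambda>w. c * f (inv_into V \<zeta> w)) (at (\<zeta> p)) =
     (\<lambda>h. c * frechet_derivative (\<lambda>w. f (inv_into V \<zeta> w)) (at (\<zeta> p)) h)"
    if "smooth_fun \<A> f" for f c
    by (rule frechet_derivative_eqI[OF has_derivative_mult_right[OF d[OF that]]])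
  show ?thesis
  proof (rule tangentI)
    show "coord_vector \<A> V \<zeta> p v f = 0" if "\<not> smooth_fun \<A> f" for f
      using that by (simp add: coord_vector_def)
    show "coord_vector \<A> V \<zeta> p v (\<lambda>r. f r + g r) = coord_vector \<A> V \<zeta> p v f + coord_vector \<A> V \<zeta> p v g"
      if "smooth_fun \<A> f" "smooth_fun \<A> g" for f g
      using that smooth_fun_add[OF that] fun_cong[OF 1[OF that], of v] by (simp add: coord_vector_def o_def)
    show "coord_vector \<A> V \<zeta> p v (\<lambda>r. c * f r) = c * coord_vector \<A> V \<zeta> p v f" if "smooth_fun \<A> f" for c f
      using that smooth_fun_mult[OF smooth_fun_const that] fun_cong[OF 3[OF that], of c v]
      by (simp add: coord_vector_def o_def)
    show "coord_vector \<A> V \<zeta> p v (\<lambda>r. f r * g r) = f p * coord_vector \<A> V \<zeta> p v g + g p * coord_vector \<A> V \<zeta> p v f"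
      if "smooth_fun \<A> f" "smooth_fun \<A> g" for f g
      using that smooth_fun_mult[OF that] fun_cong[OF 2[OF that], of v]
      by (simp add: coord_vector_def o_def mult.commute)
  qed
qed

subsection \<open>Left invariant frames\<close>

locale left_invariant_frame =
  fixes \<A> :: "('m::{t2_space, second_countable_topology}, real^3) atlas"
    and G :: "'m monoid" and ip :: "'m metric" and E :: "3 \<Rightarrow> 'm vfield"
  assumes lie_group: "lie_group \<A> G"
    and metric: "left_invariant_metric \<A> G ip"
    and frame: "orthonormal_frame \<A> G ip E"
begin

sublocale group G using lie_group by (simp add: lie_group_def)
sublocale atlas \<A> using lie_group by unfold_locales (simp add: lie_group_def)

lemma carrier [simp]: "carrier G = UNIV" using lie_group by (simp add: lie_group_def)

lemma E_smooth: "E i \<in> smooth_vector_fields \<A>"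
  using frame by (auto simp: orthonormal_frame_def lie_algebra_def)

lemma E_tangent: "E i q \<in> tangent_space \<A> q"
  using E_smooth by (auto simp: smooth_vector_fields_def)

lemma E_smooth_fun: "smooth_fun \<A> f \<Longrightarrow> smooth_fun \<A> (\<lambda>q. E i q f)"
  using E_smooth by (auto simp: smooth_vector_fields_def)

lemma E_left: "pushforward \<A> (\<lambda>r. a \<otimes>\<^bsub>G\<^esub> r) (E i q) = E i (a \<otimes>\<^bsub>G\<^esub> q)"
  using frame by (auto simp: orthonormal_frame_def lie_algebra_def)

lemma E_orthonormal: "ip q (E i q) (E j q) = (if i = j then 1 else 0)"
proof -
  have "ip (q \<otimes>\<^bsub>G\<^esub> \<one>\<^bsub>G\<^esub>) (pushforward \<A> (\<lambda>r. q \<otimes>\<^bsub>G\<^esub> r) (E i \<one>\<^bsub>G\<^esub>)) (pushforward \<A> (\<lambda>r. q \<otimes>\<^bsub>G\<^esub> r) (E j \<one>\<^bsub>G\<^esub>))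
     = ip \<one>\<^bsub>G\<^esub> (E i \<one>\<^bsub>G\<^esub>) (E j \<one>\<^bsub>G\<^esub>)"
    using metric E_tangent unfolding left_invariant_metric_def by blast
  then show ?thesis
    unfolding E_left using frame by (simp add: orthonormal_frame_def)
qed

text \<open>A left translation is the multiplication restricted to the slice through
  \<open>a\<close>. In a product chart around it, the slice is an affine map, so smoothness is
  inherited from that of the multiplication.\<close>

lemma left_translation_smooth: "smooth_map \<A> \<A> (\<lambda>r. a \<otimes>\<^bsub>G\<^esub> r)"
proof -
  have mult: "smooth_map (prod_atlas \<A> \<A>) \<A> (\<lambda>(a, b). a \<otimes>\<^bsub>G\<^esub> b)"
    using lie_group by (simp add: lie_group_def)
  then have "continuous_on UNIV (\<lambda>(a, b). a \<otimes>\<^bsub>G\<^esub> b)" by (simp add: smooth_map_def)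
  from continuous_on_compose2[OF this, of UNIV "\<lambda>r. (a, r)"]
  have cont: "continuous_on UNIV (\<lambda>r. a \<otimes>\<^bsub>G\<^esub> r)" by (simp add: continuous_on_Pair)
  have "smooth_on (\<kappa> ` (U \<inter> (\<lambda>r. a \<otimes>\<^bsub>G\<^esub> r) -` V)) (\<eta> \<circ> (\<lambda>r. a \<otimes>\<^bsub>G\<^esub> r) \<circ> inv_into U \<kappa>)"
    if U: "(U, \<kappa>) \<in> \<A>" and V: "(V, \<eta>) \<in> \<A>" for U \<kappa> V \<eta>
  proof -
  obtain W \<theta> where W: "(W, \<theta>) \<in> \<A>" "a \<in> W" using chart_at .
  have "open ((\<lambda>r. a \<otimes>\<^bsub>G\<^esub> r) -` V)"
    using cont chart(1)[OF V] by (auto simp: continuous_on_open_vimage[OF open_UNIV])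
  then have O: "open (\<kappa> ` (U \<inter> (\<lambda>r. a \<otimes>\<^bsub>G\<^esub> r) -` V))" (is "open ?O") by (rule chart_image_open[OF U])
  let ?T = "map_prod \<theta> \<kappa> ` ((W \<times> U) \<inter> (\<lambda>(a, b). a \<otimes>\<^bsub>G\<^esub> b) -` V)"
  have inj: "inj_on (map_prod \<theta> \<kappa>) (W \<times> U)"
    using chart_inv[OF W(1)] chart_inv[OF U] by (intro map_prod_inj_on) (metis inj_onI)+
  have inv: "inv_into (W \<times> U) (map_prod \<theta> \<kappa>) (\<theta> a, \<kappa> r) = (a, r)" if "r \<in> U" for r
    using inv_into_f_f[OF inj, of "(a, r)"] W(2) that by simp
  show "smooth_on ?O (\<eta> \<circ> (\<lambda>r. a \<otimes>\<^bsub>G\<^esub> r) \<circ> inv_into U \<kappa>)"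
    unfolding smooth_on_def
  proof (rule allI, rule Ck_on_cong[OF O])
    fix k
    have "(W \<times> U, map_prod \<theta> \<kappa>) \<in> prod_atlas \<A> \<A>"
      using W(1) U by (auto simp: prod_atlas_def)
    then have 1: "Ck_on k ?T (\<eta> \<circ> (\<lambda>(a, b). a \<otimes>\<^bsub>G\<^esub> b) \<circ> inv_into (W \<times> U) (map_prod \<theta> \<kappa>))"
      using mult V unfolding smooth_map_def smooth_on_def by blast
    \<comment> \<open>The inclusion of the slice, written as a linear map plus a constant.\<close>
    have 2: "Ck_on k ?O (\<lambda>y. (\<theta> a, y))"
    proof -
      have "Ck_on k ?O (\<lambda>y. (0, y) + (\<theta> a, 0))"
        by (intro Ck_on_add O Ck_on_const Ck_on_linear bounded_linear_Pair bounded_linear_zero bounded_linear_ident)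
      then show ?thesis by simp
    qed
    have 3: "(\<lambda>y. (\<theta> a, y)) ` ?O \<subseteq> ?T" using W(2) by force
    show "Ck_on k ?O (\<lambda>y. (\<eta> \<circ> (\<lambda>(a, b). a \<otimes>\<^bsub>G\<^esub> b) \<circ> inv_into (W \<times> U) (map_prod \<theta> \<kappa>)) (\<theta> a, y))"
      by (rule Ck_on_compose[OF O 3 1 2])
    show "(\<eta> \<circ> (\<lambda>(a, b). a \<otimes>\<^bsub>G\<^esub> b) \<circ> inv_into (W \<times> U) (map_prod \<theta> \<kappa>)) (\<theta> a, y)
        = (\<eta> \<circ> (\<lambda>r. a \<otimes>\<^bsub>G\<^esub> r) \<circ> inv_into U \<kappa>) y" if "y \<in> ?O" for y
      using that inv chart_inv[OF U] by auto
  qed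
  qed
  then show ?thesis using cont unfolding smooth_map_def by blast
qed

lemma ip_add:
  "u \<in> tangent_space \<A> q \<Longrightarrow> v \<in> tangent_space \<A> q \<Longrightarrow> w \<in> tangent_space \<A> q \<Longrightarrow>
    ip q (\<lambda>f. u f + v f) w = ip q u w + ip q v w"
  using metric by (simp add: left_invariant_metric_def riemannian_metric_def)

lemma ip_scale:
  "u \<in> tangent_space \<A> q \<Longrightarrow> w \<in> tangent_space \<A> q \<Longrightarrow> ip q (\<lambda>f. c * u f) w = c * ip q u w"
  using metric by (simp add: left_invariant_metric_def riemannian_metric_def)

lemma ip_sym: "u \<in> tangent_space \<A> q \<Longrightarrow> v \<in> tangent_space \<A> q \<Longrightarrow> ip q u v = ip q v u"
  using metric by (simp add: left_invariant_metric_def riemannian_metric_def)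

lemma ip_sum:
  assumes "finite I" "\<And>i. i \<in> I \<Longrightarrow> u i \<in> tangent_space \<A> q" "w \<in> tangent_space \<A> q"
  shows "ip q (\<lambda>f. \<Sum>i\<in>I. c i * u i f) w = (\<Sum>i\<in>I. c i * ip q (u i) w)"
  using assms
proof (induction I rule: finite_induct)
  case empty
  then show ?case using ip_scale[OF tangent_zero, of w q 0] by simp
next
  case (insert i I)
  then show ?case
    using ip_add[OF tangent_scale[of "u i" q "c i"] tangent_sum[of I u q c]] ip_scale[of "u i" q w "c i"] by simp
qed

lemma comps_sum:
  assumes "finite I" "\<And>i. i \<in> I \<Longrightarrow> u i \<in> tangent_space \<A> q"
  shows "comps ip E q (\<lambda>f. \<Sum>i\<in>I. c i * u i f) = (\<Sum>i\<in>I. c i *\<^sub>R comps ip E q (u i))"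
  using assms by (simp add: comps_def vec_eq_iff ip_sum E_tangent)

text \<open>The frame is known to span only at the identity. The vector is moved there by the
  inverse left translation, expanded, and moved back with the left invariance of the frame;
  orthonormality then identifies the coefficients.\<close>

lemma frame_expansion:
  assumes v: "v \<in> tangent_space \<A> q"
  shows "v = (\<lambda>f. \<Sum>i\<in>UNIV. comps ip E q v $ i * E i q f)"
proof -
  let ?a = "inv\<^bsub>G\<^esub> q"
  let ?v = "pushforward \<A> (\<lambda>r. ?a \<otimes>\<^bsub>G\<^esub> r) v"
  note sm = smooth_fun_compose[OF left_translation_smooth smooth_atlas]
  have "?v \<in> tangent_space \<A> (?a \<otimes>\<^bsub>G\<^esub> q)"
    by (rule pushforward_tangent[OF left_translation_smooth smooth_atlas v])
  then have "?v \<in> tangent_space \<A> \<one>\<^bsub>G\<^esub>" by simp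
  then obtain c :: "real^3" where c: "?v = (\<lambda>f. \<Sum>i\<in>UNIV. c $ i * E i \<one>\<^bsub>G\<^esub> f)"
    using frame by (auto simp: orthonormal_frame_def)
  have exp: "v = (\<lambda>f. \<Sum>i\<in>UNIV. c $ i * E i q f)"
  proof
    fix f
    show "v f = (\<Sum>i\<in>UNIV. c $ i * E i q f)"
    proof (cases "smooth_fun \<A> f")
      case True
      have "v f = ?v (\<lambda>r. f (q \<otimes>\<^bsub>G\<^esub> r))"
        using sm[OF True] by (simp add: pushforward_def o_def m_assoc[symmetric])
      also have "\<dots> = (\<Sum>i\<in>UNIV. c $ i * E i \<one>\<^bsub>G\<^esub> (\<lambda>r. f (q \<otimes>\<^bsub>G\<^esub> r)))" by (simp add: c)
      also have "\<dots> = (\<Sum>i\<in>UNIV. c $ i * E i q f)"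
        using fun_cong[OF E_left[of q _ "\<one>\<^bsub>G\<^esub>"], where x=f] True by (simp add: pushforward_def o_def)
      finally show ?thesis .
    next
      case False
      then show ?thesis using tangentD(1)[OF v] tangentD(1)[OF E_tangent] by simp
    qed
  qed
  have "comps ip E q v $ j = c $ j" for j
  proof -
    have "comps ip E q v = (\<Sum>i\<in>UNIV. c $ i *\<^sub>R comps ip E q (E i q))"
      by (subst exp) (rule comps_sum, simp_all add: E_tangent)
    then have "comps ip E q v $ j = (\<Sum>i\<in>UNIV. c $ i * ip q (E i q) (E j q))"
      by (simp add: comps_def)
    then show ?thesis by (simp add: E_orthonormal if_distrib cong: if_cong)
  qed
  then show ?thesis using exp by simp
qed

lemma ip_comps:
  assumes "u \<in> tangent_space \<A> q" "v \<in> tangent_space \<A> q"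
  shows "ip q u v = comps ip E q u \<bullet> comps ip E q v"
proof -
  have "ip q u v = (\<Sum>i\<in>UNIV. comps ip E q u $ i * ip q (E i q) v)"
    by (subst frame_expansion[OF assms(1)]) (rule ip_sum, simp_all add: E_tangent assms)
  also have "\<dots> = comps ip E q u \<bullet> comps ip E q v"
    using ip_sym[OF E_tangent assms(2)] by (simp add: inner_vec_def comps_def)
  finally show ?thesis .
qed

text \<open>
  These functions replace local coordinates: no bump functions are needed to differentiate components.
\<close>

lemma dual_functions:
  "\<exists>F. (\<forall>i. smooth_fun \<A> (F i)) \<and> (\<forall>i j. E i q (F j) = (if i = j then 1 else 0))"
proof -
  define S where "S = {(\<chi> i. E i q f) :: real^3 |f. smooth_fun \<A> f}"
  have "subspace S"
    unfolding subspace_def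
  proof (intro conjI ballI allI)
    show "0 \<in> S"
      using smooth_fun_const[of 0] tangent_const[OF E_tangent, of _ q 0] by (force simp: S_def vec_eq_iff)
  next
    fix x y assume "x \<in> S" "y \<in> S"
    then obtain f g where f: "smooth_fun \<A> f" "x = (\<chi> i. E i q f)" and g: "smooth_fun \<A> g" "y = (\<chi> i. E i q g)"
      by (auto simp: S_def)
    have "x + y = (\<chi> i. E i q (\<lambda>r. f r + g r))"
      using tangentD(2)[OF E_tangent f(1) g(1)] by (simp add: f(2) g(2) vec_eq_iff)
    then show "x + y \<in> S" using smooth_fun_add[OF f(1) g(1)] by (auto simp: S_def)
  next
    fix c x assume "x \<in> S"
    then obtain f where f: "smooth_fun \<A> f" "x = (\<chi> i. E i q f)" by (auto simp: S_def)
    have "c *\<^sub>R x = (\<chi> i. E i q (\<lambda>r. c * f r))"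
      using tangentD(3)[OF E_tangent f(1)] by (simp add: f(2) vec_eq_iff)
    then show "c *\<^sub>R x \<in> S" using smooth_fun_mult[OF smooth_fun_const f(1)] by (auto simp: S_def)
  qed
  \<comment> \<open>A nonzero vector orthogonal to all these triples of values would be a linear
    relation between the frame vectors at \<open>q\<close>, contradicting orthonormality.\<close>
  have "span S = UNIV"
  proof (rule ccontr)
    assume "span S \<noteq> UNIV"
    then obtain c where c: "c \<noteq> 0" "\<And>y. y \<in> span S \<Longrightarrow> orthogonal c y"
      using orthogonal_to_subspace_exists_gen[of S UNIV] by (auto simp: span_UNIV)
    \<comment> \<open>The zero vector is written as a multiple of \<open>E 1 q\<close> so that
      homogeneity of the metric evaluates it.\<close>
    have zero: "(\<lambda>f. \<Sum>i\<in>UNIV. c $ i * E i q f) = (\<lambda>f. 0 * E 1 q f)"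
    proof
      fix f
      show "(\<Sum>i\<in>UNIV. c $ i * E i q f) = 0 * E 1 q f"
      proof (cases "smooth_fun \<A> f")
        case True
        then have "(\<chi> i. E i q f) \<in> span S" by (auto simp: S_def intro: span_base)
        from c(2)[OF this] show ?thesis by (simp add: orthogonal_def inner_vec_def)
      next
        case False
        then show ?thesis using tangentD(1)[OF E_tangent] by simp
      qed
    qed
    have "c $ j = 0" for j
    proof -
      have "(\<Sum>i\<in>UNIV. c $ i * ip q (E i q) (E j q)) = ip q (\<lambda>f. \<Sum>i\<in>UNIV. c $ i * E i q f) (E j q)"
        by (rule ip_sum[symmetric]) (simp_all add: E_tangent)
      also have "\<dots> = 0 * ip q (E 1 q) (E j q)" unfolding zero by (rule ip_scale) (rule E_tangent)+
      finally show ?thesis by (simp add: E_orthonormal if_distrib cong: if_cong)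
    qed
    then show False using c(1) by (simp add: vec_eq_iff)
  qed
  then have "S = UNIV" using span_eq_iff[THEN iffD2, OF \<open>subspace S\<close>] by simp
  then have "\<forall>j. \<exists>f. smooth_fun \<A> f \<and> axis j 1 = (\<chi> i. E i q f)" by (auto simp: S_def)
  then obtain F where F: "\<And>j. smooth_fun \<A> (F j)" "\<And>j. axis j 1 = ((\<chi> i. E i q (F j)) :: real^3)" by metis
  have "E i q (F j) = (if i = j then 1 else 0)" for i j
    using arg_cong[OF F(2)[of j], of "\<lambda>x. x $ i"] by (auto simp: axis_def)
  then show ?thesis using F(1) by blast
qed

end

lemma cross_expansion:
  fixes a b c v :: "real^3"
  assumes "v = x *\<^sub>R a + y *\<^sub>R b + z *\<^sub>R c" "a \<bullet> cross3 b c \<noteq> 0"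
  shows "x = (v \<bullet> cross3 b c) / (a \<bullet> cross3 b c)"
    "y = (v \<bullet> cross3 c a) / (a \<bullet> cross3 b c)"
    "z = (v \<bullet> cross3 a b) / (a \<bullet> cross3 b c)"
proof -
  have "v \<bullet> cross3 b c = x * (a \<bullet> cross3 b c)" "v \<bullet> cross3 c a = y * (a \<bullet> cross3 b c)" "v \<bullet> cross3 a b = z * (a \<bullet> cross3 b c)"
    unfolding assms(1) by (simp_all add: cross3_simps)
  then show "x = (v \<bullet> cross3 b c) / (a \<bullet> cross3 b c)"
    "y = (v \<bullet> cross3 c a) / (a \<bullet> cross3 b c)"
    "z = (v \<bullet> cross3 a b) / (a \<bullet> cross3 b c)" using assms(2) by simp_all
qed

section \<open>Connection coefficients of a unimodular frame\<close>

locale unimodular_frame = left_invariant_frame +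
  fixes nab :: "('m::{t2_space, second_countable_topology}) vfield \<Rightarrow> 'm vfield \<Rightarrow> 'm vfield" and c1 c2 c3 \<mu>1 \<mu>2 \<mu>3 :: real
  assumes levi_civita: "levi_civita \<A> ip nab"
    and bracket: "lie_bracket (E 2) (E 3) = (\<lambda>q f. c1 * E 1 q f)"
      "lie_bracket (E 3) (E 1) = (\<lambda>q f. c2 * E 2 q f)" "lie_bracket (E 1) (E 2) = (\<lambda>q f. c3 * E 3 q f)"
    and \<mu>: "\<mu>1 = (- c1 + c2 + c3) / 2" "\<mu>2 = (c1 - c2 + c3) / 2" "\<mu>3 = (c1 + c2 - c3) / 2"
begin

lemmas nab = levi_civita[unfolded levi_civita_def, THEN bspec, OF E_smooth, THEN bspec, OF E_smooth]

lemma nab_smooth: "nab (E j) (E i) \<in> smooth_vector_fields \<A>"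
  by (rule nab[THEN conjunct1])

lemma nab_tangent: "nab (E j) (E i) q \<in> tangent_space \<A> q"
  using nab_smooth by (auto simp: smooth_vector_fields_def)

lemma nab_skew: "ip q (nab (E j) (E i) q) (E k q) + ip q (nab (E j) (E k) q) (E i q) = 0"
proof -
  have "E j q (\<lambda>r. ip r (E i r) (E k r)) = ip q (nab (E j) (E i) q) (E k q) + ip q (E i q) (nab (E j) (E k) q)"
    by (rule nab[THEN conjunct2, THEN conjunct2, THEN conjunct2, THEN conjunct2, THEN bspec, OF E_smooth, THEN spec])
  moreover have "E j q (\<lambda>r. ip r (E i r) (E k r)) = 0"
    unfolding E_orthonormal by (rule tangent_const[OF E_tangent])
  ultimately show ?thesis using ip_sym[OF E_tangent nab_tangent] by simp
qed

lemma nab_torsion: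
  "ip q (nab (E j) (E i) q) (E k q) - ip q (nab (E i) (E j) q) (E k q) = ip q (lie_bracket (E j) (E i) q) (E k q)"
proof -
  have "lie_bracket (E j) (E i) = (\<lambda>q f. nab (E j) (E i) q f - nab (E i) (E j) q f)"
    by (rule nab[THEN conjunct2, THEN conjunct2, THEN conjunct2, THEN conjunct1, symmetric])
  then have "lie_bracket (E j) (E i) q = (\<lambda>f. nab (E j) (E i) q f + (-1) * nab (E i) (E j) q f)" by simp
  then show ?thesis
    using ip_add[OF nab_tangent tangent_scale[OF nab_tangent, where c="-1"] E_tangent, of q j i i j k]
      ip_scale[OF nab_tangent E_tangent, where c="-1", of q i j k] by simp
qed

text \<open>The metric has constant coefficients in the frame, so the components are skew in the
  last two indices; vanishing torsion relates the first two to the brackets. Together these kill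
  every component with a repeated index and leave three independent ones.\<close>

lemma nab_comps:
  shows
  "ip q (nab (E 1) (E 1) q) (E 1 q) = 0"
  "ip q (nab (E 1) (E 1) q) (E 2 q) = 0"
  "ip q (nab (E 1) (E 1) q) (E 3 q) = 0"
  "ip q (nab (E 1) (E 2) q) (E 1 q) = 0"
  "ip q (nab (E 1) (E 2) q) (E 2 q) = 0"
  "ip q (nab (E 1) (E 2) q) (E 3 q) = \<mu>1"
  "ip q (nab (E 1) (E 3) q) (E 1 q) = 0"
  "ip q (nab (E 1) (E 3) q) (E 2 q) = - \<mu>1"
  "ip q (nab (E 1) (E 3) q) (E 3 q) = 0"
  "ip q (nab (E 2) (E 1) q) (E 1 q) = 0"
  "ip q (nab (E 2) (E 1) q) (E 2 q) = 0"
  "ip q (nab (E 2) (E 1) q) (E 3 q) = - \<mu>2"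
  "ip q (nab (E 2) (E 2) q) (E 1 q) = 0"
  "ip q (nab (E 2) (E 2) q) (E 2 q) = 0"
  "ip q (nab (E 2) (E 2) q) (E 3 q) = 0"
  "ip q (nab (E 2) (E 3) q) (E 1 q) = \<mu>2"
  "ip q (nab (E 2) (E 3) q) (E 2 q) = 0"
  "ip q (nab (E 2) (E 3) q) (E 3 q) = 0"
  "ip q (nab (E 3) (E 1) q) (E 1 q) = 0"
  "ip q (nab (E 3) (E 1) q) (E 2 q) = \<mu>3"
  "ip q (nab (E 3) (E 1) q) (E 3 q) = 0"
  "ip q (nab (E 3) (E 2) q) (E 1 q) = - \<mu>3"
  "ip q (nab (E 3) (E 2) q) (E 2 q) = 0"
  "ip q (nab (E 3) (E 2) q) (E 3 q) = 0"
  "ip q (nab (E 3) (E 3) q) (E 1 q) = 0"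
  "ip q (nab (E 3) (E 3) q) (E 2 q) = 0"
  "ip q (nab (E 3) (E 3) q) (E 3 q) = 0"
proof -
  define \<gamma> where "\<gamma> j i k = ip q (nab (E j) (E i) q) (E k q)" for j i k
  have sk: "\<gamma> j i k = - \<gamma> j k i" for i j k unfolding \<gamma>_def using nab_skew[of q j i k] by simp
  have sk0: "\<gamma> j i i = 0" for i j using sk[of j i i] by simp
  have tor0: "\<gamma> 2 3 k - \<gamma> 3 2 k = (if k = 1 then c1 else 0)" "\<gamma> 3 1 k - \<gamma> 1 3 k = (if k = 2 then c2 else 0)"
    "\<gamma> 1 2 k - \<gamma> 2 1 k = (if k = 3 then c3 else 0)" for k
    unfolding \<gamma>_def nab_torsion bracket by (simp_all add: ip_scale[OF E_tangent E_tangent] E_orthonormal)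
  have tor: "\<gamma> 2 3 k = \<gamma> 3 2 k + (if k = 1 then c1 else 0)" "\<gamma> 3 1 k = \<gamma> 1 3 k + (if k = 2 then c2 else 0)"
    "\<gamma> 1 2 k = \<gamma> 2 1 k + (if k = 3 then c3 else 0)" for k
    using tor0[of k] by linarith+
  have z: "\<gamma> 1 2 1 = 0" "\<gamma> 1 3 1 = 0" "\<gamma> 2 1 2 = 0" "\<gamma> 2 3 2 = 0" "\<gamma> 3 1 3 = 0" "\<gamma> 3 2 3 = 0"
    using tor(3)[of 1] tor(2)[of 1] tor(3)[of 2] tor(1)[of 2] tor(2)[of 3] tor(1)[of 3] sk0 by simp_all
  have z': "\<gamma> 1 1 2 = 0" "\<gamma> 1 1 3 = 0" "\<gamma> 2 2 1 = 0" "\<gamma> 2 2 3 = 0" "\<gamma> 3 3 1 = 0" "\<gamma> 3 3 2 = 0"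
    using z sk[of 1 1 2] sk[of 1 1 3] sk[of 2 2 1] sk[of 2 2 3] sk[of 3 3 1] sk[of 3 3 2] by simp_all
  have e: "\<gamma> 2 3 1 = \<gamma> 3 2 1 + c1" "\<gamma> 3 1 2 = \<gamma> 1 3 2 + c2" "\<gamma> 1 2 3 = \<gamma> 2 1 3 + c3"
    using tor(1)[of 1] tor(2)[of 2] tor(3)[of 3] by simp_all
  have e': "\<gamma> 1 3 2 = - \<gamma> 1 2 3" "\<gamma> 2 1 3 = - \<gamma> 2 3 1" "\<gamma> 3 2 1 = - \<gamma> 3 1 2" by (rule sk)+
  \<comment> \<open>The three remaining components satisfy a linear system with right sides
    \<open>c1\<close>, \<open>c2\<close>, \<open>c3\<close>; its solution is the definition of the
    \<mu> constants.\<close>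
  have lin: "x = (- c1 + c2 + c3) / 2 \<and> y = (c1 - c2 + c3) / 2 \<and> z = (c1 + c2 - c3) / 2"
    if "y = - z + c1" "z = - x + c2" "x = - y + c3" for x y z :: real
    using that by (simp add: field_simps)
  have m: "\<gamma> 1 2 3 = \<mu>1" "\<gamma> 2 3 1 = \<mu>2" "\<gamma> 3 1 2 = \<mu>3"
    using lin[OF e[unfolded e']] unfolding \<mu> by blast+
  note v = m e'[unfolded m] z z' sk0
  show
  "ip q (nab (E 1) (E 1) q) (E 1 q) = 0"
  "ip q (nab (E 1) (E 1) q) (E 2 q) = 0"
  "ip q (nab (E 1) (E 1) q) (E 3 q) = 0"
  "ip q (nab (E 1) (E 2) q) (E 1 q) = 0"
  "ip q (nab (E 1) (E 2) q) (E 2 q) = 0"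
  "ip q (nab (E 1) (E 2) q) (E 3 q) = \<mu>1"
  "ip q (nab (E 1) (E 3) q) (E 1 q) = 0"
  "ip q (nab (E 1) (E 3) q) (E 2 q) = - \<mu>1"
  "ip q (nab (E 1) (E 3) q) (E 3 q) = 0"
  "ip q (nab (E 2) (E 1) q) (E 1 q) = 0"
  "ip q (nab (E 2) (E 1) q) (E 2 q) = 0"
  "ip q (nab (E 2) (E 1) q) (E 3 q) = - \<mu>2"
  "ip q (nab (E 2) (E 2) q) (E 1 q) = 0"
  "ip q (nab (E 2) (E 2) q) (E 2 q) = 0"
  "ip q (nab (E 2) (E 2) q) (E 3 q) = 0"
  "ip q (nab (E 2) (E 3) q) (E 1 q) = \<mu>2"
  "ip q (nab (E 2) (E 3) q) (E 2 q) = 0"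
  "ip q (nab (E 2) (E 3) q) (E 3 q) = 0"
  "ip q (nab (E 3) (E 1) q) (E 1 q) = 0"
  "ip q (nab (E 3) (E 1) q) (E 2 q) = \<mu>3"
  "ip q (nab (E 3) (E 1) q) (E 3 q) = 0"
  "ip q (nab (E 3) (E 2) q) (E 1 q) = - \<mu>3"
  "ip q (nab (E 3) (E 2) q) (E 2 q) = 0"
  "ip q (nab (E 3) (E 2) q) (E 3 q) = 0"
  "ip q (nab (E 3) (E 3) q) (E 1 q) = 0"
  "ip q (nab (E 3) (E 3) q) (E 2 q) = 0"
  "ip q (nab (E 3) (E 3) q) (E 3 q) = 0"
    unfolding \<gamma>_def[symmetric] by (simp_all only: v)
qed

lemma conn_term_nth:
  "conn_term (conn_coeff ip E nab q) x y $ 1 = of_real \<mu>2 * x $ 2 * y $ 3 - of_real \<mu>3 * x $ 3 * y $ 2"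
  "conn_term (conn_coeff ip E nab q) x y $ 2 = of_real \<mu>3 * x $ 3 * y $ 1 - of_real \<mu>1 * x $ 1 * y $ 3"
  "conn_term (conn_coeff ip E nab q) x y $ 3 = of_real \<mu>1 * x $ 1 * y $ 2 - of_real \<mu>2 * x $ 2 * y $ 1"
  by (simp_all add: conn_term_def conn_coeff_def comps_def nab_comps sum_3 algebra_simps)

end

section \<open>Smoothness of components in the frame\<close>

lemma Ck_on_mono: "j \<le> k \<Longrightarrow> Ck_on k S f \<Longrightarrow> Ck_on j S f"
proof (induction j rule: inc_induct)
  case (step n)
  then show ?case using Ck_on_Suc_imp by blast
qed

lemma Ck_on_vec_lambda:
  fixes h :: "'n::finite \<Rightarrow> 'a::euclidean_space \<Rightarrow> real"
  assumes "open S" "\<And>j. Ck_on k S (h j)"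
  shows "Ck_on k S (\<lambda>w. \<chi> j. h j w)"
proof -
  have "(\<chi> j. h j w) = (\<Sum>j\<in>UNIV. h j w *\<^sub>R axis j 1)" for w
    by (simp add: vec_eq_iff axis_def if_distrib cong: if_cong)
  moreover have "Ck_on k S (\<lambda>w. \<Sum>j\<in>UNIV. h j w *\<^sub>R (axis j 1 :: real^'n))"
    by (intro Ck_on_sum Ck_on_scaleR Ck_on_const assms)
  ultimately show ?thesis by simp
qed

lemma Ck_on_nth: "open S \<Longrightarrow> Ck_on k S f \<Longrightarrow> Ck_on k S (\<lambda>w. f w $ i)"
  by (rule Ck_on_bounded_linear[OF _ bounded_linear_vec_nth])

lemma bounded_bilinear_cross3: "bounded_bilinear cross3"
  by (simp add: bilinear_conv_bounded_bilinear[symmetric] bilinear_cross)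

context left_invariant_frame
begin

text \<open>
  The components solve a linear system whose coefficients are smooth (Cramer's rule).
\<close>

lemma comps_smooth:
  fixes \<Phi> :: "'a::euclidean_space \<Rightarrow> 'm"
  assumes W: "open W"
    and \<Phi>: "\<And>f. smooth_fun \<A> f \<Longrightarrow> Ck_on k W (\<lambda>w. f (\<Phi> w))"
    and tan: "\<And>w. w \<in> W \<Longrightarrow> X w \<in> tangent_space \<A> (\<Phi> w)"
    and X: "\<And>f. smooth_fun \<A> f \<Longrightarrow> Ck_on k W (\<lambda>w. X w f)"
  shows "Ck_on k W (\<lambda>w. comps ip E (\<Phi> w) (X w))"
proof (rule Ck_on_local)
  fix w0 assume w0: "w0 \<in> W"
  obtain F where F: "\<And>i. smooth_fun \<A> (F i)" "\<And>i j. E i (\<Phi> w0) (F j) = (if i = j then 1 else 0 :: real)"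
    using dual_functions[of "\<Phi> w0"] by blast
  define m where "m i w = ((\<chi> j. E i (\<Phi> w) (F j)) :: real^3)" for i w
  define b where "b w = ((\<chi> j. X w (F j)) :: real^3)" for w
  \<comment> \<open>The determinant of the system. It is 1 at \<open>w0\<close>, where the functions
    are dual to the frame, and hence nonzero on the neighbourhood where the solution formula is
    used.\<close>
  define d where "d w = m 1 w \<bullet> cross3 (m 2 w) (m 3 w)" for w
  have Cm: "Ck_on k W (m i)" for i
    unfolding m_def[abs_def] by (intro Ck_on_vec_lambda W \<Phi> E_smooth_fun F)
  have Cb: "Ck_on k W b" unfolding b_def[abs_def] by (intro Ck_on_vec_lambda W X F)
  note inner = Ck_on_bilinear[OF _ bounded_bilinear_inner] and cross = Ck_on_bilinear[OF _ bounded_bilinear_cross3]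
  have Cd: "Ck_on k W d" unfolding d_def[abs_def] by (intro inner cross W Cm)
  then have "continuous_on W d" using Ck_on_mono[of 0 k W d] by simp
  then have O: "open {w \<in> W. d w \<noteq> 0}" (is "open ?O")
  proof -
    have "open (W \<inter> d -` (- {0}))"
      by (rule continuous_open_preimage[OF \<open>continuous_on W d\<close> W]) auto
    moreover have "W \<inter> d -` (- {0}) = ?O" by auto
    ultimately show ?thesis by simp
  qed
  have "d w0 = 1"
    by (simp add: d_def m_def F(2) inner_vec_def sum_3 cross3_def)
  then have "w0 \<in> ?O" using w0 by simp
  moreover have "Ck_on k ?O (\<lambda>w. comps ip E (\<Phi> w) (X w))"
  proof (rule Ck_on_cong[OF O])
    note sub = Ck_on_subset[of k W _ ?O]
    have Cm': "Ck_on k ?O (m i)" and Cb': "Ck_on k ?O b" and Cd': "Ck_on k ?O d" for i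
      using Cm Cb Cd by (auto intro!: sub)
    show "Ck_on k ?O (\<lambda>w. (b w \<bullet> cross3 (m 2 w) (m 3 w) * inverse (d w)) *\<^sub>R axis 1 1
       + (b w \<bullet> cross3 (m 3 w) (m 1 w) * inverse (d w)) *\<^sub>R axis 2 1
       + (b w \<bullet> cross3 (m 1 w) (m 2 w) * inverse (d w)) *\<^sub>R (axis 3 1 :: real^3))"
      by (intro Ck_on_add Ck_on_scaleR Ck_on_mult Ck_on_inverse Ck_on_const inner cross O Cm' Cb' Cd') auto
    fix w assume w: "w \<in> ?O"
    let ?c = "comps ip E (\<Phi> w) (X w)"
    have bw: "b w = (?c $ 1) *\<^sub>R m 1 w + (?c $ 2) *\<^sub>R m 2 w + (?c $ 3) *\<^sub>R m 3 w"
    proof -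
      have "X w f = (\<Sum>i\<in>UNIV. ?c $ i * E i (\<Phi> w) f)" for f
        using fun_cong[OF frame_expansion[OF tan], of w f] w by simp
      then show ?thesis by (simp add: b_def m_def vec_eq_iff sum_3)
    qed
    have "m 1 w \<bullet> cross3 (m 2 w) (m 3 w) \<noteq> 0" using w by (simp add: d_def)
    note c = cross_expansion[OF bw this, folded d_def]
    show "(b w \<bullet> cross3 (m 2 w) (m 3 w) * inverse (d w)) *\<^sub>R axis 1 1
       + (b w \<bullet> cross3 (m 3 w) (m 1 w) * inverse (d w)) *\<^sub>R axis 2 1
       + (b w \<bullet> cross3 (m 1 w) (m 2 w) * inverse (d w)) *\<^sub>R axis 3 1 = ?c"
      by (simp add: vec_eq_iff forall_3 axis_def c divide_inverse)
  qed
  ultimately show "\<exists>T. open T \<and> w0 \<in> T \<and> Ck_on k T (\<lambda>w. comps ip E (\<Phi> w) (X w))" using O by blast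
qed

end

subsection \<open>Immersed surfaces\<close>

text \<open>The cross products are, up to the triple product, the dual basis of \<open>x\<close>,
  \<open>y\<close>, \<open>n\<close>. Multiplying out keeps the identity free of a nondegeneracy
  condition.\<close>

lemma reciprocal_basis:
  fixes x y n z :: "real^3"
  shows "(n \<bullet> cross3 x y) *\<^sub>R z = (z \<bullet> x) *\<^sub>R cross3 y n + (z \<bullet> y) *\<^sub>R cross3 n x + (z \<bullet> n) *\<^sub>R cross3 x y"
  by (simp add: vec_eq_iff forall_3 cross3_def inner_vec_def sum_3 algebra_simps)

text \<open>Conformality fixes the products of \<open>X\<close> and \<open>Y\<close> with
  \<open>x\<close>, \<open>y\<close>, \<open>n\<close>, so the dual basis gives them up to the
  common factor \<open>2 * \<rho> * t\<close>. The curvature, read off from their cross product,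
  determines that factor.\<close>

lemma conformal_normal_derivatives:
  fixes x y n X Y :: "real^3" and t \<rho> k :: real
  assumes n: "n = t *\<^sub>R cross3 x y" "n \<bullet> n = 1" and pos: "t > 0" "\<rho> > 0" "k > 0"
    and X: "X \<bullet> n = 0" "X \<bullet> x = - 2 * \<rho>" "X \<bullet> y = 0"
    and Y: "Y \<bullet> n = 0" "Y \<bullet> x = 0" "Y \<bullet> y = - 2 * \<rho>"
    and XY: "cross3 X Y = k *\<^sub>R cross3 x y"
  shows "X = sqrt k *\<^sub>R cross3 n y" "Y = - (sqrt k *\<^sub>R cross3 n x)"
proof -
  have d: "n \<bullet> cross3 x y = 1 / t" using n pos(1) by (simp add: field_simps)
  have "(1 / t) *\<^sub>R X = (- 2 * \<rho>) *\<^sub>R cross3 y n"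
    using reciprocal_basis[of n x y X] unfolding d X by simp
  then have "t *\<^sub>R ((1 / t) *\<^sub>R X) = t *\<^sub>R ((- 2 * \<rho>) *\<^sub>R cross3 y n)" by simp
  then have X': "X = (2 * \<rho> * t) *\<^sub>R cross3 n y"
    using pos(1) cross_skew[of y n] by (simp add: mult.commute mult.left_commute)
  have "(1 / t) *\<^sub>R Y = (- 2 * \<rho>) *\<^sub>R cross3 n x"
    using reciprocal_basis[of n x y Y] unfolding d Y by simp
  then have "t *\<^sub>R ((1 / t) *\<^sub>R Y) = t *\<^sub>R ((- 2 * \<rho>) *\<^sub>R cross3 n x)" by simp
  then have Y': "Y = - ((2 * \<rho> * t) *\<^sub>R cross3 n x)"
    using pos(1) by (simp add: mult.commute mult.left_commute)
  have c: "cross3 (cross3 n y) (cross3 n x) = - ((n \<bullet> cross3 x y) *\<^sub>R n)"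
    by (simp add: vec_eq_iff forall_3 cross3_def inner_vec_def sum_3 algebra_simps)
  have 1: "cross3 X Y = ((2 * \<rho> * t)^2 / t) *\<^sub>R n"
    unfolding X' Y' by (simp add: cross_mult_left cross_mult_right cross_minus_right c d power2_eq_square)
  have 2: "cross3 x y = (1 / t) *\<^sub>R n" using n(1) pos(1) by simp
  have "((2 * \<rho> * t)^2 / t) *\<^sub>R n = (k / t) *\<^sub>R n"
    using XY unfolding 1 2 by (simp only: scaleR_scaleR times_divide_eq_right mult_1_right)
  moreover have "n \<noteq> 0" using n(2) by auto
  \<comment> \<open>Only the square is determined; the positive root is selected by the positivity
    of \<open>\<rho>\<close> and the choice of orientation, \<open>t > 0\<close>.\<close>
  ultimately have "(2 * \<rho> * t)^2 = k" using pos(1) by auto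
  then have "2 * \<rho> * t = sqrt k" using pos by (metis real_sqrt_unique less_imp_le mult_pos_pos zero_less_numeral)
  then show "X = sqrt k *\<^sub>R cross3 n y" "Y = - (sqrt k *\<^sub>R cross3 n x)" using X' Y' by simp_all
qed

locale immersed_surface = unimodular_frame +
  fixes \<S> :: "('s::topological_space, complex) atlas" and h :: "'s metric" and \<phi> :: "'s \<Rightarrow> ('m::{t2_space, second_countable_topology})"
    and N :: "'s \<Rightarrow> 'm tangent" and K :: "'s \<Rightarrow> real" and V :: "'s set" and \<zeta> :: "'s \<Rightarrow> complex"
  assumes surface_atlas: "smooth_atlas \<S>"
    and immersion: "isometric_immersion \<S> h \<A> ip \<phi>"
    and normal: "unit_normal \<S> \<A> ip \<phi> N"
    and curvature: "has_extrinsic_curvature \<S> \<A> ip E nab \<phi> N p (K p)"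
    and K_pos: "K p > 0"
    and conformal: "conformal_parameter \<S> \<A> ip E nab \<phi> N V \<zeta>"
begin

text \<open>The geometry transported to the parameter domain. For \<open>v\<close> equal to
  \<open>1\<close> or \<open>\<i>\<close>, \<open>x v\<close> holds the components of the coordinate
  derivative of the immersion, and \<open>C v\<close> those of the covariant derivative of the
  normal in that direction.\<close>

definition "W = \<zeta> ` V"
definition "P w = inv_into V \<zeta> w"
definition "D v w = coord_vector \<S> V \<zeta> (P w) v"
definition "T v w = pushforward \<A> \<phi> (D v w)"
definition "x v w = comps ip E (\<phi> (P w)) (T v w)"
definition "n w = comps ip E (\<phi> (P w)) (N (P w))"
definition "\<Gamma> w = conn_coeff ip E nab (\<phi> (P w))"
definition "C v w = cov_deriv_along \<A> ip E nab \<phi> N (P w) (D v w)"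

lemma phi_smooth: "smooth_map \<S> \<A> \<phi>"
  using immersion by (simp add: isometric_immersion_def)

lemma insert_atlas: "smooth_atlas (insert (V, \<zeta>) \<S>)"
  using conformal by (simp add: conformal_parameter_def)

sublocale S: atlas \<S> by unfold_locales (rule surface_atlas)
sublocale SI: atlas "insert (V, \<zeta>) \<S>" by unfold_locales (rule insert_atlas)

lemma open_W: "open W"
  unfolding W_def by (rule SI.chart(2)) simp

lemma P: "w \<in> W \<Longrightarrow> P w \<in> V" "w \<in> W \<Longrightarrow> \<zeta> (P w) = w"
  by (auto simp: W_def P_def inv_into_into f_inv_into_f)

lemma smooth_W: "smooth_fun \<S> f \<Longrightarrow> Ck_on k W (\<lambda>w. f (P w))"
  unfolding W_def P_def by (rule S.smooth_fun_insert_chart[OF insert_atlas])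

lemma phi_smooth_fun: "smooth_fun \<A> f \<Longrightarrow> smooth_fun \<S> (\<lambda>p. f (\<phi> p))"
  by (rule S.smooth_fun_compose[OF phi_smooth smooth_atlas])

lemma smooth_phi_W: "smooth_fun \<A> f \<Longrightarrow> Ck_on k W (\<lambda>w. f (\<phi> (P w)))"
  by (rule smooth_W[OF phi_smooth_fun])

lemma D_tangent: "w \<in> W \<Longrightarrow> D v w \<in> tangent_space \<S> (P w)"
  unfolding D_def by (rule coord_vector_tangent[OF surface_atlas insert_atlas P(1)])

lemma D_apply: "w \<in> W \<Longrightarrow> smooth_fun \<S> f \<Longrightarrow> D v w f = frechet_derivative (\<lambda>u. f (P u)) (at w) v"
  by (simp add: D_def coord_vector_def P o_def P_def[symmetric, abs_def])

lemma push_tangent: "X \<in> tangent_space \<S> p \<Longrightarrow> pushforward \<A> \<phi> X \<in> tangent_space \<A> (\<phi> p)"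
  by (rule S.pushforward_tangent[OF phi_smooth smooth_atlas])

lemma T_tangent: "w \<in> W \<Longrightarrow> T v w \<in> tangent_space \<A> (\<phi> (P w))"
  unfolding T_def by (rule push_tangent[OF D_tangent])

lemma T_apply:
  "w \<in> W \<Longrightarrow> smooth_fun \<A> f \<Longrightarrow> T v w f = frechet_derivative (\<lambda>u. f (\<phi> (P u))) (at w) v"
  by (simp add: T_def pushforward_def o_def D_apply phi_smooth_fun)

lemma T_expansion: "w \<in> W \<Longrightarrow> T v w f = (\<Sum>i\<in>UNIV. x v w $ i * E i (\<phi> (P w)) f)"
  unfolding x_def by (rule fun_cong[OF frame_expansion[OF T_tangent]])

lemma x_smooth: "Ck_on k W (x v)"
  unfolding x_def[abs_def]
proof (rule comps_smooth[where \<Phi>="\<lambda>w. \<phi> (P w)" and X="T v", OF open_W smooth_phi_W T_tangent])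
  fix f assume f: "smooth_fun \<A> f"
  show "Ck_on k W (\<lambda>w. T v w f)"
  proof (rule Ck_on_cong[OF open_W])
    show "Ck_on k W (\<lambda>w. frechet_derivative (\<lambda>u. f (\<phi> (P u))) (at w) v)"
      using smooth_phi_W[OF f, of "Suc k"] by simp
  qed (simp add: T_apply f)
qed

lemma normal_tangent: "N p \<in> tangent_space \<A> (\<phi> p)"
  using normal by (simp add: unit_normal_def)

lemma normal_smooth: "smooth_fun \<A> f \<Longrightarrow> smooth_fun \<S> (\<lambda>p. N p f)"
  using normal by (simp add: unit_normal_def)

text \<open>Tangent vectors are set to zero on functions that are not smooth. Without this fact the
  derivative of the components inside \<open>cov_deriv_along\<close> could be that default value
  instead of a genuine derivative.\<close>

lemma normal_comps_smooth: "smooth_fun \<S> (\<lambda>p. comps ip E (\<phi> p) (N p) $ i)"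
proof (rule S.smooth_funI)
  fix U \<kappa> k assume U: "(U, \<kappa>) \<in> \<S>"
  show "Ck_on k (\<kappa> ` U) (\<lambda>y. comps ip E (\<phi> (inv_into U \<kappa> y)) (N (inv_into U \<kappa> y)) $ i)"
    by (intro Ck_on_nth comps_smooth S.chart[OF U] S.smooth_funD[OF phi_smooth_fun U] normal_tangent
        S.smooth_funD[OF normal_smooth U])
qed

lemma n_smooth: "Ck_on k W n"
  unfolding n_def[abs_def] by (intro comps_smooth open_W smooth_phi_W normal_tangent smooth_W normal_smooth)

lemma dn: "w \<in> W \<Longrightarrow> (n has_derivative frechet_derivative n (at w)) (at w)"
  by (rule Ck_on_Suc_D[OF n_smooth[of "Suc 0"]])

lemma dx: "w \<in> W \<Longrightarrow> (x v has_derivative frechet_derivative (x v) (at w)) (at w)"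
  by (rule Ck_on_Suc_D[OF x_smooth[of "Suc 0"]])

lemma dnth:
  "(f has_derivative frechet_derivative f (at w)) (at w) \<Longrightarrow> frechet_derivative (\<lambda>u. f u $ i) (at w) v = frechet_derivative f (at w) v $ i"
  using frechet_derivative_eqI[OF bounded_linear.has_derivative[OF bounded_linear_vec_nth]] by metis

lemma C_eq:
  assumes w: "w \<in> W"
  shows "C v w = frechet_derivative n (at w) v + conn_term (\<Gamma> w) (x v w) (n w)"
proof -
  have "(\<chi> i. D v w (\<lambda>s. comps ip E (\<phi> s) (N s) $ i)) = frechet_derivative n (at w) v"
    using dnth[OF dn[OF w]] by (simp add: vec_eq_iff D_apply[OF w normal_comps_smooth] n_def[symmetric])
  then show ?thesis by (simp add: C_def cov_deriv_along_def \<Gamma>_def x_def T_def n_def)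
qed

lemma n_unit: "n w \<bullet> n w = 1"
  using normal ip_comps[OF normal_tangent normal_tangent] by (simp add: unit_normal_def n_def)

lemma n_orthogonal:
  "X \<in> tangent_space \<S> (P w) \<Longrightarrow> n w \<bullet> comps ip E (\<phi> (P w)) (pushforward \<A> \<phi> X) = 0"
  using normal ip_comps[OF normal_tangent push_tangent] by (simp add: unit_normal_def n_def)

lemma n_x: "w \<in> W \<Longrightarrow> n w \<bullet> x v w = 0"
  unfolding x_def T_def by (rule n_orthogonal[OF D_tangent])

text \<open>The covariant form of the symmetry of mixed partial derivatives. That symmetry is
  applied to functions dual to the frame at the point, composed with the immersion; the frame itself
  is differentiated too, which produces the brackets.\<close>

lemma torsion_free:
  assumes w: "w \<in> W"
  shows "frechet_derivative (x v) (at w) u + conn_term (\<Gamma> w) (x u w) (x v w)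
       = frechet_derivative (x u) (at w) v + conn_term (\<Gamma> w) (x v w) (x u w)"
proof -
  let ?q = "\<phi> (P w)"
  obtain F where F: "\<And>i. smooth_fun \<A> (F i)" "\<And>i j. E i ?q (F j) = (if i = j then 1 else 0)"
    using dual_functions[of ?q] by blast
  define EE where "EE l i j = E l ?q (\<lambda>r. E i r (F j))" for l i j
  \<comment> \<open>The first derivative is expanded in the frame before differentiating again. At
    \<open>w\<close> duality extracts the component \<open>j\<close>, and what remains are iterated
    frame derivatives of \<open>F j\<close>.\<close>
  have second: "frechet_derivative (\<lambda>z. frechet_derivative (\<lambda>z. F j (\<phi> (P z))) (at z) v) (at w) u
     = frechet_derivative (x v) (at w) u $ j + (\<Sum>i\<in>UNIV. x v w $ i * (\<Sum>l\<in>UNIV. x u w $ l * EE l i j))" for u v j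
  proof -
    let ?e = "\<lambda>i z. E i (\<phi> (P z)) (F j)"
    have de: "(?e i has_derivative frechet_derivative (?e i) (at w)) (at w)" for i
      by (rule Ck_on_Suc_D[OF smooth_phi_W[OF E_smooth_fun[OF F(1)], of "Suc 0"] w])
    have de': "frechet_derivative (?e i) (at w) u = (\<Sum>l\<in>UNIV. x u w $ l * EE l i j)" for i
      using T_apply[OF w E_smooth_fun[OF F(1)]] T_expansion[OF w] by (simp add: EE_def)
    have "((\<lambda>z. \<Sum>i\<in>UNIV. x v z $ i * ?e i z) has_derivative
      (\<lambda>h. \<Sum>i\<in>UNIV. x v w $ i * frechet_derivative (?e i) (at w) h + frechet_derivative (x v) (at w) h $ i * ?e i w)) (at w)"
      by (intro has_derivative_sum has_derivative_mult de bounded_linear.has_derivative[OF bounded_linear_vec_nth dx[OF w]])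
    then have "((\<lambda>z. frechet_derivative (\<lambda>z. F j (\<phi> (P z))) (at z) v) has_derivative
      (\<lambda>h. \<Sum>i\<in>UNIV. x v w $ i * frechet_derivative (?e i) (at w) h + frechet_derivative (x v) (at w) h $ i * ?e i w)) (at w)"
      by (rule has_derivative_transform_within_open[OF _ open_W w]) (use T_apply[OF _ F(1)] T_expansion in metis)
    from fun_cong[OF frechet_derivative_eqI[OF this], of u] show ?thesis
      unfolding de' F(2) sum.distrib by (simp add: if_distrib cong: if_cong)
  qed
  have C2: "Ck_on 2 W (\<lambda>z. F j (\<phi> (P z)))" for j by (rule smooth_phi_W[OF F(1)])
  have eq: "frechet_derivative (x v) (at w) u $ j + (\<Sum>i\<in>UNIV. x v w $ i * (\<Sum>l\<in>UNIV. x u w $ l * EE l i j))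
    = frechet_derivative (x u) (at w) v $ j + (\<Sum>i\<in>UNIV. x u w $ i * (\<Sum>l\<in>UNIV. x v w $ l * EE l i j))" for j
    using second_derivative_symmetric[OF open_W C2 w, of j v u] unfolding second .
  have br: "EE 2 3 j - EE 3 2 j = c1 * (if 1 = j then 1 else 0)" "EE 3 1 j - EE 1 3 j = c2 * (if 2 = j then 1 else 0)"
    "EE 1 2 j - EE 2 1 j = c3 * (if 3 = j then 1 else 0)" for j
    using bracket[THEN fun_cong, of ?q, THEN fun_cong, of "F j"] by (simp_all add: lie_bracket_def EE_def F(2))
  \<comment> \<open>After antisymmetrisation the iterated frame derivatives combine into brackets,
    weighted by the entries of the cross product of \<open>x u w\<close> and
    \<open>x v w\<close>.\<close>
  have eq': "frechet_derivative (x v) (at w) u $ j - frechet_derivative (x u) (at w) v $ j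
     + (x u w $ 2 * x v w $ 3 - x u w $ 3 * x v w $ 2) * (EE 2 3 j - EE 3 2 j)
     + (x u w $ 3 * x v w $ 1 - x u w $ 1 * x v w $ 3) * (EE 3 1 j - EE 1 3 j)
     + (x u w $ 1 * x v w $ 2 - x u w $ 2 * x v w $ 1) * (EE 1 2 j - EE 2 1 j) = 0" for j
    using eq[of j] unfolding sum_3 by (simp add: algebra_simps)
  \<comment> \<open>Each structure constant is the sum of two \<mu> constants, which is exactly the
    skew part of the connection term.\<close>
  have c: "c1 = \<mu>2 + \<mu>3" "c2 = \<mu>3 + \<mu>1" "c3 = \<mu>1 + \<mu>2" using \<mu> by (simp_all add: field_simps)
  show ?thesis
    using eq'[of 1] eq'[of 2] eq'[of 3] unfolding br c
    by (simp add: vec_eq_iff forall_3 \<Gamma>_def conn_term_nth algebra_simps)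
qed

end

section \<open>Shape operator, curvature and conformality\<close>

context immersed_surface
begin

lemma push_sum:
  "pushforward \<A> \<phi> (\<lambda>f. \<Sum>i\<in>I. c i * b i f) = (\<lambda>f. \<Sum>i\<in>I. c i * pushforward \<A> \<phi> (b i) f)"
  by (auto simp: pushforward_def)

lemma cross_combination:
  fixes a b :: "real^3"
  shows "cross3 (p1 *\<^sub>R a + p2 *\<^sub>R b) (q1 *\<^sub>R a + q2 *\<^sub>R b) = (p1 * q2 - p2 * q1) *\<^sub>R cross3 a b"
  by (simp add: vec_eq_iff forall_3 cross3_def algebra_simps)

text \<open>The covariant derivative of the normal is minus the shape operator. A linear map of a
  plane multiplies cross products by its determinant, and the two signs cancel.\<close>

lemma C_curvature:
  assumes w: "w \<in> W"
  shows "cross3 (C u w) (C v w) = K (P w) *\<^sub>R cross3 (x u w) (x v w)" "C v w \<bullet> n w = 0"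
proof -
  let ?p = "P w"
  obtain L b A where *: "(\<forall>X\<in>tangent_space \<S> ?p. L X \<in> tangent_space \<S> ?p \<and>
           comps ip E (\<phi> ?p) (pushforward \<A> \<phi> (L X)) = - cov_deriv_along \<A> ip E nab \<phi> N ?p X) \<and>
        (\<forall>i. b i \<in> tangent_space \<S> ?p) \<and>
        (\<forall>c::real^2. (\<forall>f. (\<Sum>i\<in>UNIV. c $ i * b i f) = 0) \<longrightarrow> c = 0) \<and>
        (\<forall>X\<in>tangent_space \<S> ?p. \<exists>c::real^2. X = (\<lambda>f. \<Sum>i\<in>UNIV. c $ i * b i f)) \<and>
        (\<forall>j. L (b j) = (\<lambda>f. \<Sum>i\<in>UNIV. A $ i $ j * b i f)) \<and>
        K ?p = det (A :: real^2^2)"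
    using curvature[of ?p] unfolding has_extrinsic_curvature_def by (elim exE) (rule that)
  have L: "comps ip E (\<phi> ?p) (pushforward \<A> \<phi> (L X)) = - cov_deriv_along \<A> ip E nab \<phi> N ?p X"
    if "X \<in> tangent_space \<S> ?p" for X
    using *[THEN conjunct1, THEN bspec, OF that] by (rule conjunct2)
  note b = *[THEN conjunct2, THEN conjunct1, THEN spec]
  note span = *[THEN conjunct2, THEN conjunct2, THEN conjunct2, THEN conjunct1, THEN bspec]
  note A = *[THEN conjunct2, THEN conjunct2, THEN conjunct2, THEN conjunct2, THEN conjunct1, THEN spec]
    *[THEN conjunct2, THEN conjunct2, THEN conjunct2, THEN conjunct2, THEN conjunct2]
  define y where "y i = comps ip E (\<phi> ?p) (pushforward \<A> \<phi> (b i))" for i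
  define M where "M i = cov_deriv_along \<A> ip E nab \<phi> N ?p (b i)" for i
  have comb: "comps ip E (\<phi> ?p) (pushforward \<A> \<phi> (\<lambda>f. \<Sum>i\<in>UNIV. c i * b i f)) = (\<Sum>i\<in>UNIV. c i *\<^sub>R y i)" for c
    unfolding push_sum y_def by (rule comps_sum[OF finite push_tangent[OF b]])
  have M: "M j = - (\<Sum>i\<in>UNIV. A $ i $ j *\<^sub>R y i)" for j
    using L[OF b, of j] unfolding A(1) comb M_def by simp
  have xC: "\<exists>c::real^2. x v w = (\<Sum>i\<in>UNIV. c $ i *\<^sub>R y i) \<and> C v w = (\<Sum>i\<in>UNIV. c $ i *\<^sub>R M i)" for v
  proof -
    obtain c :: "real^2" where c: "D v w = (\<lambda>f. \<Sum>i\<in>UNIV. c $ i * b i f)" using span[OF D_tangent[OF w]] by (rule exE)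
    have "x v w = (\<Sum>i\<in>UNIV. c $ i *\<^sub>R y i)" unfolding x_def T_def c by (rule comb)
    moreover have "C v w = (\<Sum>i\<in>UNIV. c $ i *\<^sub>R M i)"
      unfolding C_def c cov_deriv_along_def comb M_def y_def[symmetric]
      by (simp add: vec_eq_iff forall_3 conn_term_nth sum_2 algebra_simps)
    ultimately show ?thesis by blast
  qed
  obtain c d :: "real^2" where c: "x u w = (\<Sum>i\<in>UNIV. c $ i *\<^sub>R y i)" "C u w = (\<Sum>i\<in>UNIV. c $ i *\<^sub>R M i)"
    and d: "x v w = (\<Sum>i\<in>UNIV. d $ i *\<^sub>R y i)" "C v w = (\<Sum>i\<in>UNIV. d $ i *\<^sub>R M i)"
    using xC[of u] xC[of v] by (elim exE conjE) (rule that)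
  have C: "C u w = (- (A $ 1 $ 1 * c $ 1 + A $ 1 $ 2 * c $ 2)) *\<^sub>R y 1 + (- (A $ 2 $ 1 * c $ 1 + A $ 2 $ 2 * c $ 2)) *\<^sub>R y 2"
     "C v w = (- (A $ 1 $ 1 * d $ 1 + A $ 1 $ 2 * d $ 2)) *\<^sub>R y 1 + (- (A $ 2 $ 1 * d $ 1 + A $ 2 $ 2 * d $ 2)) *\<^sub>R y 2"
    unfolding c(2) d(2) M sum_2 by (simp_all add: vec_eq_iff algebra_simps)
  have xx: "x u w = c $ 1 *\<^sub>R y 1 + c $ 2 *\<^sub>R y 2" "x v w = d $ 1 *\<^sub>R y 1 + d $ 2 *\<^sub>R y 2"
    using c(1) d(1) by (simp_all add: sum_2)
  show "cross3 (C u w) (C v w) = K (P w) *\<^sub>R cross3 (x u w) (x v w)"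
    unfolding C xx cross_combination A(2) det_2 scaleR_scaleR
    by (rule arg_cong2[where f=scaleR]) (simp_all add: algebra_simps)
  have ny: "n w \<bullet> y i = 0" for i unfolding y_def by (rule n_orthogonal[OF b])
  show "C v w \<bullet> n w = 0" unfolding C by (simp add: inner_add_left inner_commute[of "y _" "n w"] ny)
qed

lemma C_form:
  assumes w: "w \<in> W"
  shows "C 1 w = sqrt (K (P w)) *\<^sub>R cross3 (n w) (x \<i> w)"
    "C \<i> w = - (sqrt (K (P w)) *\<^sub>R cross3 (n w) (x 1 w))"
    "cross3 (x 1 w) (x \<i> w) \<noteq> 0"
proof -
  note c = conformal[unfolded conformal_parameter_def Let_def, THEN conjunct2, THEN bspec, OF P(1)[OF w],
      folded D_def, unfolded second_form_def, folded C_def T_def, folded x_def n_def]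
  obtain \<rho> where \<rho>: "\<rho> > 0" "- (C 1 w \<bullet> x 1 w) = 2 * \<rho>" "- (C \<i> w \<bullet> x \<i> w) = 2 * \<rho>"
      "- (C 1 w \<bullet> x \<i> w) = 0" "- (C \<i> w \<bullet> x 1 w) = 0"
    using c[THEN conjunct1] by (elim exE conjE) (rule that)
  obtain t where t: "t > 0" "n w = t *\<^sub>R cross3 (x 1 w) (x \<i> w)"
    using c[THEN conjunct2] by (elim exE conjE) (rule that)
  have h: "C 1 w \<bullet> x 1 w = - 2 * \<rho>" "C 1 w \<bullet> x \<i> w = 0" "C \<i> w \<bullet> x 1 w = 0" "C \<i> w \<bullet> x \<i> w = - 2 * \<rho>"
    using \<rho> by linarith+
  note c = conformal_normal_derivatives[OF t(2) n_unit t(1) \<rho>(1) K_pos C_curvature(2)[OF w] h(1,2) C_curvature(2)[OF w] h(3,4) C_curvature(1)[OF w]]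
  show "C 1 w = sqrt (K (P w)) *\<^sub>R cross3 (n w) (x \<i> w)" "C \<i> w = - (sqrt (K (P w)) *\<^sub>R cross3 (n w) (x 1 w))"
    by (rule c)+
  show "cross3 (x 1 w) (x \<i> w) \<noteq> 0" using t n_unit[of w] by auto
qed

lemma conn_smooth: "Ck_on k W (\<lambda>w. conn_term (\<Gamma> w) (x v w) (n w))"
proof -
  have "Ck_on k W (\<lambda>w. conn_term (\<Gamma> w) (x v w) (n w) $ i)" for i
    using exhaust_3[of i]
    by (elim disjE) (simp_all add: \<Gamma>_def conn_term_nth Ck_on_diff Ck_on_mult Ck_on_const Ck_on_nth open_W x_smooth n_smooth)
  from Ck_on_vec_lambda[where h="\<lambda>i w. conn_term (\<Gamma> w) (x v w) (n w) $ i", OF open_W this] show ?thesis by simp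
qed

text \<open>K is prescribed point by point as a determinant. Its regularity comes from solving
  \<open>C_curvature\<close> for it: the coordinate vectors have a nonzero cross product, so K is a
  quotient of smooth functions.\<close>

lemma K_smooth: "Ck_on k W (\<lambda>w. K (P w))"
proof (rule Ck_on_cong[OF open_W])
  note inner = Ck_on_bilinear[OF _ bounded_bilinear_inner] and cross = Ck_on_bilinear[OF _ bounded_bilinear_cross3]
  let ?C = "\<lambda>v w. frechet_derivative n (at w) v + conn_term (\<Gamma> w) (x v w) (n w)"
  have C: "Ck_on k W (?C v)" for v
    using n_smooth[of "Suc k"] by (intro Ck_on_add open_W conn_smooth) simp
  show "Ck_on k W (\<lambda>w. (cross3 (?C 1 w) (?C \<i> w) \<bullet> cross3 (x 1 w) (x \<i> w)) * inverse (cross3 (x 1 w) (x \<i> w) \<bullet> cross3 (x 1 w) (x \<i> w)))"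
    by (intro Ck_on_mult Ck_on_inverse inner cross open_W C x_smooth) (simp add: C_form(3))
  show "(cross3 (?C 1 w) (?C \<i> w) \<bullet> cross3 (x 1 w) (x \<i> w)) * inverse (cross3 (x 1 w) (x \<i> w) \<bullet> cross3 (x 1 w) (x \<i> w)) = K (P w)"
    if "w \<in> W" for w
    unfolding C_eq[OF that, symmetric] C_curvature(1)[OF that] using C_form(3)[OF that] by simp
qed

definition "a = phi_z \<S> \<A> ip E \<phi> V \<zeta>"

lemma a_nth: "a w $ k = (complex_of_real (x 1 w $ k) - \<i> * complex_of_real (x \<i> w $ k)) / 2"
  by (simp add: a_def phi_z_def Let_def x_def T_def D_def P_def)

end

section \<open>Complexified covariant derivatives along the immersion\<close>

lemma has_wirt_of_real:
  assumes "(f has_derivative f') (at w)"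
  shows "has_wirt (\<lambda>u. complex_of_real (f u)) w
    ((complex_of_real (f' 1) - \<i> * complex_of_real (f' \<i>)) / 2) ((complex_of_real (f' 1) + \<i> * complex_of_real (f' \<i>)) / 2)"
proof -
  have "((\<lambda>u. complex_of_real (f u)) has_derivative (\<lambda>h. complex_of_real (f' h))) (at w)"
    by (rule bounded_linear.has_derivative[OF bounded_linear_of_real assms])
  from has_wirtI[OF this] show ?thesis
    unfolding wirt_def wirt_bar_def frechet_derivative_eqI[OF \<open>((\<lambda>u. complex_of_real (f u)) has_derivative _) _\<close>] .
qed

context immersed_surface
begin

text \<open>Splits the complexified operators, half of the derivative in x minus or plus
  \<open>\<i>\<close> times that in y, into real covariant derivatives of the real part
  \<open>Z\<close> and the imaginary part \<open>Z'\<close>. This links them to the real identities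
  \<open>C_form\<close> and \<open>torsion_free\<close>.\<close>

lemma nabla_real:
  fixes Z Z' :: "complex \<Rightarrow> real^3" and Y :: "complex \<Rightarrow> complex^3"
  assumes w: "w \<in> W" and Z: "(Z has_derivative dZ) (at w)" "(Z' has_derivative dZ') (at w)"
    and Y: "\<And>u k. u \<in> W \<Longrightarrow> Y u $ k = complex_of_real (Z u $ k) + \<i> * complex_of_real (Z' u $ k)"
  defines "R \<equiv> \<lambda>v. dZ v + conn_term (\<Gamma> w) (x v w) (Z w)" and "R' \<equiv> \<lambda>v. dZ' v + conn_term (\<Gamma> w) (x v w) (Z' w)"
  shows "nabla_z \<Gamma> a Y w $ k = (complex_of_real (R 1 $ k) + complex_of_real (R' \<i> $ k)
       + \<i> * (complex_of_real (R' 1 $ k) - complex_of_real (R \<i> $ k))) / 2"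
    and "nabla_zbar \<Gamma> a Y w $ k = (complex_of_real (R 1 $ k) - complex_of_real (R' \<i> $ k)
       + \<i> * (complex_of_real (R' 1 $ k) + complex_of_real (R \<i> $ k))) / 2"
proof -
  have 1: "has_wirt (\<lambda>u. complex_of_real (Z u $ k)) w
    ((complex_of_real (dZ 1 $ k) - \<i> * complex_of_real (dZ \<i> $ k)) / 2) ((complex_of_real (dZ 1 $ k) + \<i> * complex_of_real (dZ \<i> $ k)) / 2)"
    by (rule has_wirt_of_real[OF bounded_linear.has_derivative[OF bounded_linear_vec_nth Z(1)]])
  have 2: "has_wirt (\<lambda>u. complex_of_real (Z' u $ k)) w
    ((complex_of_real (dZ' 1 $ k) - \<i> * complex_of_real (dZ' \<i> $ k)) / 2) ((complex_of_real (dZ' 1 $ k) + \<i> * complex_of_real (dZ' \<i> $ k)) / 2)"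
    by (rule has_wirt_of_real[OF bounded_linear.has_derivative[OF bounded_linear_vec_nth Z(2)]])
  have h: "has_wirt (\<lambda>u. Y u $ k) w
     ((complex_of_real (dZ 1 $ k) - \<i> * complex_of_real (dZ \<i> $ k)) / 2 + \<i> * ((complex_of_real (dZ' 1 $ k) - \<i> * complex_of_real (dZ' \<i> $ k)) / 2))
     ((complex_of_real (dZ 1 $ k) + \<i> * complex_of_real (dZ \<i> $ k)) / 2 + \<i> * ((complex_of_real (dZ' 1 $ k) + \<i> * complex_of_real (dZ' \<i> $ k)) / 2))"
    by (rule has_wirt_cong[OF has_wirt_add[OF 1 has_wirt_cmult[OF 2, of \<i>]] open_W w]) (simp add: Y)
  have c: "conn_term (\<Gamma> w) (a w) (Y w) $ k = (complex_of_real (conn_term (\<Gamma> w) (x 1 w) (Z w) $ k) - \<i> * complex_of_real (conn_term (\<Gamma> w) (x \<i> w) (Z w) $ k)) / 2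
     + \<i> * ((complex_of_real (conn_term (\<Gamma> w) (x 1 w) (Z' w) $ k) - \<i> * complex_of_real (conn_term (\<Gamma> w) (x \<i> w) (Z' w) $ k)) / 2)"
    using exhaust_3[of k] unfolding \<Gamma>_def
    by (elim disjE) (simp_all add: conn_term_nth a_nth Y[OF w] field_simps)
  have c': "conn_term (\<Gamma> w) (\<chi> k. cnj (a w $ k)) (Y w) $ k = (complex_of_real (conn_term (\<Gamma> w) (x 1 w) (Z w) $ k) + \<i> * complex_of_real (conn_term (\<Gamma> w) (x \<i> w) (Z w) $ k)) / 2
     + \<i> * ((complex_of_real (conn_term (\<Gamma> w) (x 1 w) (Z' w) $ k) + \<i> * complex_of_real (conn_term (\<Gamma> w) (x \<i> w) (Z' w) $ k)) / 2)"
    using exhaust_3[of k] unfolding \<Gamma>_def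
    by (elim disjE) (simp_all add: conn_term_nth a_nth Y[OF w] field_simps)
  show "nabla_z \<Gamma> a Y w $ k = (complex_of_real (R 1 $ k) + complex_of_real (R' \<i> $ k)
       + \<i> * (complex_of_real (R' 1 $ k) - complex_of_real (R \<i> $ k))) / 2"
    unfolding nabla_z_def vector_add_component vec_lambda_beta has_wirtD(1)[OF h] c R_def R'_def
    by (simp add: field_simps)
  show "nabla_zbar \<Gamma> a Y w $ k = (complex_of_real (R 1 $ k) - complex_of_real (R' \<i> $ k)
       + \<i> * (complex_of_real (R' 1 $ k) + complex_of_real (R \<i> $ k))) / 2"
    unfolding nabla_zbar_def vector_add_component vec_lambda_beta has_wirtD(2)[OF h] c' R_def R'_def
    by (simp add: field_simps)
qed

lemma conn_term_zero: "conn_term (\<Gamma> w) y 0 = (0 :: real^3)"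
  by (simp add: conn_term_def vec_eq_iff)

lemma nabla_n:
  assumes w: "w \<in> W"
  shows "nabla_z \<Gamma> a (\<lambda>u. cvec (n u)) w $ k = (complex_of_real (C 1 w $ k) - \<i> * complex_of_real (C \<i> w $ k)) / 2"
    "nabla_zbar \<Gamma> a (\<lambda>u. cvec (n u)) w $ k = (complex_of_real (C 1 w $ k) + \<i> * complex_of_real (C \<i> w $ k)) / 2"
  using nabla_real[OF w dn[OF w] has_derivative_const[of "0 :: real^3"], of "\<lambda>u. cvec (n u)"]
  by (simp_all add: conn_term_zero C_eq[OF w] algebra_simps)

lemma cross_cross:
  fixes n y :: "real^3"
  shows "cross3 n (cross3 n y) = (n \<bullet> y) *\<^sub>R n - (n \<bullet> n) *\<^sub>R y" "cross3 (cross3 n y) y = (n \<bullet> y) *\<^sub>R y - (y \<bullet> y) *\<^sub>R n"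
  by (simp_all add: vec_eq_iff forall_3 cross3_def inner_vec_def sum_3 algebra_simps)

lemma cross3_nth:
  "cross3 u v $ 1 = u $ 2 * v $ 3 - u $ 3 * v $ 2"
  "cross3 u v $ 2 = u $ 3 * v $ 1 - u $ 1 * v $ 3"
  "cross3 u v $ 3 = u $ 1 * v $ 2 - u $ 2 * v $ 1"
  by (simp_all add: cross3_def)

lemma ccross_cvec:
  assumes "\<And>k. z $ k = (complex_of_real (X $ k) - \<i> * complex_of_real (Y $ k)) / 2"
  shows "ccross (cvec u) z $ k = (complex_of_real (cross3 u X $ k) - \<i> * complex_of_real (cross3 u Y $ k)) / 2"
  using exhaust_3[of k] by (elim disjE) (simp_all add: assms cross3_nth field_simps)

lemma a_formula:
  assumes w: "w \<in> W"
  shows "a w = (\<i> / complex_of_real (sqrt (K (P w)))) *s ccross (cvec (n w)) (nabla_z \<Gamma> a (\<lambda>u. cvec (n u)) w)"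
proof -
  define s where "s = sqrt (K (P w))"
  have s: "s > 0" using K_pos by (simp add: s_def)
  \<comment> \<open>Rotating twice by the normal is minus the identity on tangent vectors.\<close>
  have 1: "cross3 (n w) (C 1 w) = (- s) *\<^sub>R x \<i> w" "cross3 (n w) (C \<i> w) = s *\<^sub>R x 1 w"
    unfolding C_form(1,2)[OF w] s_def[symmetric]
    by (simp_all add: cross_mult_right cross_minus_right cross_cross n_x[OF w] n_unit)
  show ?thesis
    unfolding vec_eq_iff vector_smult_component ccross_cvec[OF nabla_n(1)[OF w]] 1 a_nth s_def[symmetric]
    using s by (simp add: field_simps)
qed

text \<open>The connection term is a cross product with a fixed vector, hence a derivation of the
  cross product by the Jacobi identity; this is the product rule for covariant derivatives.\<close>

lemma normal_conn_cross:
  "conn_term (\<Gamma> w) y (cross3 u v) = cross3 (conn_term (\<Gamma> w) y u) v + cross3 u (conn_term (\<Gamma> w) y v)" for y :: "real^3"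
  unfolding \<Gamma>_def by (simp add: vec_eq_iff forall_3 conn_term_nth cross3_nth algebra_simps)

lemma integrable:
  assumes w: "w \<in> W"
  shows "integrability_equation \<Gamma> a n (\<lambda>w. K (P w)) w"
proof -
  \<comment> \<open>By \<open>C_form\<close> the covariant derivatives of the normal divided by the
    square root of K are rotated coordinate vectors, so K is gone before the second
    differentiation.\<close>
  define Z where "Z v u = cross3 (n u) (x v u)" for v u
  define dZ where "dZ v h = cross3 (n w) (frechet_derivative (x v) (at w) h) + cross3 (frechet_derivative n (at w) h) (x v w)" for v h
  have Z: "(Z v has_derivative dZ v) (at w)" for v
    unfolding Z_def[abs_def] dZ_def[abs_def]
    by (rule bounded_bilinear.FDERIV[OF bounded_bilinear_cross3 dn[OF w] dx[OF w]])
  have mZ: "((\<lambda>u. - Z v u) has_derivative (\<lambda>h. - dZ v h)) (at w)" for v by (rule has_derivative_minus[OF Z])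
  have hZ: "((\<lambda>u. (1/2) *\<^sub>R Z v u) has_derivative (\<lambda>h. (1/2) *\<^sub>R dZ v h)) (at w)"
    "((\<lambda>u. (-1/2) *\<^sub>R Z v u) has_derivative (\<lambda>h. (-1/2) *\<^sub>R dZ v h)) (at w)" for v
    by (rule has_derivative_scaleR_right[OF Z])+
  let ?Y = "\<lambda>u. (1 / sqrt (K (P u))) *\<^sub>R nabla_z \<Gamma> a (\<lambda>s. cvec (n s)) u"
  let ?Y' = "\<lambda>u. (1 / sqrt (K (P u))) *\<^sub>R nabla_zbar \<Gamma> a (\<lambda>s. cvec (n s)) u"
  have Y: "?Y u $ k = complex_of_real (((1/2) *\<^sub>R Z \<i> u) $ k) + \<i> * complex_of_real (((1/2) *\<^sub>R Z 1 u) $ k)"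
    and Y': "?Y' u $ k = complex_of_real (((1/2) *\<^sub>R Z \<i> u) $ k) + \<i> * complex_of_real (((-1/2) *\<^sub>R Z 1 u) $ k)" if "u \<in> W" for u k
  proof -
    define s where "s = sqrt (K (P u))"
    have s: "s > 0" using K_pos by (simp add: s_def)
    show "?Y u $ k = complex_of_real (((1/2) *\<^sub>R Z \<i> u) $ k) + \<i> * complex_of_real (((1/2) *\<^sub>R Z 1 u) $ k)"
      "?Y' u $ k = complex_of_real (((1/2) *\<^sub>R Z \<i> u) $ k) + \<i> * complex_of_real (((-1/2) *\<^sub>R Z 1 u) $ k)"
      unfolding vector_scaleR_component vector_uminus_component nabla_n[OF that] C_form(1,2)[OF that] s_def[symmetric] Z_def
      using s by (simp_all add: scaleR_conv_of_real field_simps)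
  qed
  define R where "R v v' = dZ v v' + conn_term (\<Gamma> w) (x v' w) (Z v w)" for v v'
  have lin: "conn_term (\<Gamma> w) y (c *\<^sub>R z) = c *\<^sub>R conn_term (\<Gamma> w) y z" for y z :: "real^3" and c
    unfolding \<Gamma>_def by (simp add: vec_eq_iff forall_3 conn_term_nth algebra_simps)
  have half: "(c *\<^sub>R dZ v v' + conn_term (\<Gamma> w) (x v' w) (c *\<^sub>R Z v w)) = c *\<^sub>R R v v'" for v v' c
    by (simp add: R_def lin scaleR_add_right)
  \<comment> \<open>In the sum the imaginary parts cancel. What remains is half of the x-derivative
    of the rotated \<open>x \<i>\<close> minus the y-derivative of the rotated
    \<open>x 1\<close>.\<close>
  define S where "S = R \<i> 1 - R 1 \<i>"
  have sum: "(nabla_z \<Gamma> a ?Y' w + nabla_zbar \<Gamma> a ?Y w) = cvec ((1/2) *\<^sub>R S)"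
  proof (subst vec_eq_iff, rule allI)
    fix k
    note n1 = nabla_real(1)[where Y="?Y'" and k=k, OF w hZ(1)[of \<i>] hZ(2)[of 1] Y', unfolded half]
      and n2 = nabla_real(2)[where Y="?Y" and k=k, OF w hZ(1)[of \<i>] hZ(1)[of 1] Y, unfolded half]
    show "(nabla_z \<Gamma> a ?Y' w + nabla_zbar \<Gamma> a ?Y w) $ k = cvec ((1/2) *\<^sub>R S) $ k"
      unfolding vector_add_component
      apply (subst n1, assumption)
      apply (subst n2, assumption)
      by (simp add: S_def field_simps)
  qed
  have RR: "R v v' = cross3 (C v' w) (x v w) + cross3 (n w) (frechet_derivative (x v) (at w) v' + conn_term (\<Gamma> w) (x v' w) (x v w))" for v v'
    unfolding R_def dZ_def Z_def normal_conn_cross C_eq[OF w] by (simp add: cross_add_left cross_add_right)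
  define s where "s = sqrt (K (P w))"
  \<comment> \<open>Vanishing torsion cancels the derivatives of the coordinate vectors. The
    remaining products of derivatives of the normal with coordinate vectors are multiples of the
    normal.\<close>
  have "S = cross3 (C 1 w) (x \<i> w) - cross3 (C \<i> w) (x 1 w)"
    unfolding S_def RR torsion_free[OF w, of \<i> 1] by simp
  also have "\<dots> = (- s * (x \<i> w \<bullet> x \<i> w + x 1 w \<bullet> x 1 w)) *\<^sub>R n w"
    unfolding C_form(1,2)[OF w] s_def[symmetric]
    by (simp add: cross_mult_left cross_minus_left cross_cross n_x[OF w] algebra_simps)
  finally have "cross3 (n w) ((1/2) *\<^sub>R S) = 0" by (simp add: cross_mult_right)
  then have "ccross (cvec (n w)) (cvec ((1/2) *\<^sub>R S)) = 0"
    by (simp add: vec_eq_iff forall_3 cross3_nth of_real_mult[symmetric] of_real_diff[symmetric] del: of_real_mult of_real_diff)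
  then show ?thesis unfolding integrability_equation_def sum .
qed

end

section \<open>The equivalence at a point and the theorem\<close>

lemma integrability_iff_gauss_equation:
  assumes U: "open U" and n: "Ck_on 2 U n" and k: "Ck_on 1 U k"
    and data: "\<And>u. u \<in> U \<Longrightarrow> norm (n u) = 1 \<and> k u > 0 \<and> a u = (\<i> / complex_of_real (sqrt (k u))) *s
               ccross (cvec (n u)) (nabla_z \<Gamma> a (\<lambda>v. cvec (n v)) u)"
    and conn: "\<And>u (x::complex^3) y. conn_term (\<Gamma> u) x y
       = ccross (vector [of_real \<mu>1 * x $ 1, of_real \<mu>1 * x $ 2, of_real \<mu>3 * x $ 3]) y"
    and w: "w \<in> U" "n w $ 3 \<noteq> 1"
  shows "integrability_equation \<Gamma> a n k w \<longleftrightarrow> gauss_equation \<mu>1 \<mu>3 (\<lambda>w. gauss_map (n w)) k w"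
proof -
  \<comment> \<open>Restriction to the open set where g is finite; this reduces the condition at one
    point to the standing condition of \<open>normal_data\<close>.\<close>
  let ?U = "U \<inter> (\<lambda>u. n u $ 3) -` (- {1})"
  have "continuous_on U (\<lambda>u. n u $ 3)" using Ck_on_mono[of 0 2, OF _ Ck_on_nth[OF U n]] by simp
  then have op: "open ?U" by (rule continuous_open_preimage[OF _ U]) auto
  interpret normal_data ?U n k a \<Gamma> \<mu>1 \<mu>3
    using op Ck_on_subset[OF n] Ck_on_subset[OF k] data conn by unfold_locales auto
  have "g = (\<lambda>w. gauss_map (n w))" by (rule ext) (rule g_def)
  with integrability_iff_gauss[of w] w show ?thesis by simp
qed

text \<open>Along an immersion both equations hold. The second conjunct states the equivalence for
  data \<open>n\<close>, \<open>k\<close>, \<open>a\<close> that need not come from an immersion,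
  where it relates two genuine conditions; the connection coefficients are those at the
  identity.\<close>

theorem theorem3p5:
  fixes \<A> :: "('m::{t2_space, second_countable_topology}, real^3) atlas"
    and G :: "'m monoid"
    and ip :: "'m metric"
    and E :: "3 \<Rightarrow> 'm vfield"
    and nab :: "'m vfield \<Rightarrow> 'm vfield \<Rightarrow> 'm vfield"
    and c1 c2 c3 \<mu>1 \<mu>2 \<mu>3 :: real
    and \<S> :: "('s::{t2_space, second_countable_topology}, complex) atlas"
    and h :: "'s metric"
    and \<phi> :: "'s \<Rightarrow> 'm"
    and N :: "'s \<Rightarrow> 'm tangent"
    and K :: "'s \<Rightarrow> real"
    and V :: "'s set"
    and \<zeta> :: "'s \<Rightarrow> complex"
  assumes "lie_group \<A> G" and "unimodular G"
    and "left_invariant_metric \<A> G ip" and "levi_civita \<A> ip nab"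
    and "orthonormal_frame \<A> G ip E"
    and "lie_bracket (E 2) (E 3) = (\<lambda>q f. c1 * E 1 q f)"
    and "lie_bracket (E 3) (E 1) = (\<lambda>q f. c2 * E 2 q f)"
    and "lie_bracket (E 1) (E 2) = (\<lambda>q f. c3 * E 3 q f)"
    and "\<mu>1 = (- c1 + c2 + c3) / 2" and "\<mu>2 = (c1 - c2 + c3) / 2" and "\<mu>3 = (c1 + c2 - c3) / 2"
    and "smooth_atlas \<S>" and "riemannian_metric \<S> h"
    and "isometric_immersion \<S> h \<A> ip \<phi>"
    and "unit_normal \<S> \<A> ip \<phi> N"
    and "\<And>p. has_extrinsic_curvature \<S> \<A> ip E nab \<phi> N p (K p)"
    and "\<And>p. K p > 0"
    and "\<And>p X. X \<in> tangent_space \<S> p \<Longrightarrow> X \<noteq> (\<lambda>f. 0) \<Longrightarrow> second_form \<A> ip E nab \<phi> N p X X > 0"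
    and "conformal_parameter \<S> \<A> ip E nab \<phi> N V \<zeta>"
    and "\<mu>1 = \<mu>2"
  shows
    "(let n = (\<lambda>w. comps ip E (\<phi> (inv_into V \<zeta> w)) (N (inv_into V \<zeta> w)));
          k = (\<lambda>w. K (inv_into V \<zeta> w));
          \<Gamma> = (\<lambda>w. conn_coeff ip E nab (\<phi> (inv_into V \<zeta> w)));
          a = phi_z \<S> \<A> ip E \<phi> V \<zeta>;
          g = (\<lambda>w. gauss_map (n w))
      in \<forall>w\<in>\<zeta> ` V. n w $ 3 \<noteq> 1 \<longrightarrow>
           gauss_equation \<mu>1 \<mu>3 g k w \<and>
           (integrability_equation \<Gamma> a n k w \<longleftrightarrow> gauss_equation \<mu>1 \<mu>3 g k w)) \<and>
     (\<forall>(U :: complex set) (n :: complex \<Rightarrow> real^3) (k :: complex \<Rightarrow> real) (a :: complex \<Rightarrow> complex^3).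
        let \<Gamma> = (\<lambda>w. conn_coeff ip E nab \<one>\<^bsub>G\<^esub>);
            g = (\<lambda>w. gauss_map (n w))
        in open U \<and> smooth_on U n \<and> smooth_on U k \<and>
           (\<forall>w\<in>U. norm (n w) = 1 \<and> k w > 0 \<and>
              a w = (\<i> / complex_of_real (sqrt (k w))) *s
                      ccross (cvec (n w)) (nabla_z \<Gamma> a (\<lambda>u. cvec (n u)) w)) \<longrightarrow>
           (\<forall>w\<in>U. n w $ 3 \<noteq> 1 \<longrightarrow>
              (integrability_equation \<Gamma> a n k w \<longleftrightarrow> gauss_equation \<mu>1 \<mu>3 g k w)))"
proof -
  interpret sf: immersed_surface \<A> G ip E nab c1 c2 c3 \<mu>1 \<mu>2 \<mu>3 \<S> h \<phi> N K V \<zeta>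
    using assms by unfold_locales
  \<comment> \<open>This is where \<open>\<mu>1 = \<mu>2\<close> enters. The connection term does
    not depend on \<open>q\<close>, so one fact serves both the points of the immersion and the
    identity.\<close>
  have conn: "conn_term (conn_coeff ip E nab q) (x::complex^3) y
       = ccross (vector [of_real \<mu>1 * x $ 1, of_real \<mu>1 * x $ 2, of_real \<mu>3 * x $ 3]) y" for q x y
    using \<open>\<mu>1 = \<mu>2\<close> by (simp add: vec_eq_iff forall_3 sf.conn_term_nth)
  have eqs: "sf.n = (\<lambda>w. comps ip E (\<phi> (inv_into V \<zeta> w)) (N (inv_into V \<zeta> w)))"
    "sf.\<Gamma> = (\<lambda>w. conn_coeff ip E nab (\<phi> (inv_into V \<zeta> w)))" "(\<lambda>w. K (sf.P w)) = (\<lambda>w. K (inv_into V \<zeta> w))"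
    by (rule ext, simp add: sf.n_def sf.\<Gamma>_def sf.P_def)+
  have iff: "integrability_equation sf.\<Gamma> sf.a sf.n (\<lambda>w. K (sf.P w)) w
      \<longleftrightarrow> gauss_equation \<mu>1 \<mu>3 (\<lambda>w. gauss_map (sf.n w)) (\<lambda>w. K (sf.P w)) w"
    if "w \<in> sf.W" "sf.n w $ 3 \<noteq> 1" for w
  proof (rule integrability_iff_gauss_equation[OF sf.open_W sf.n_smooth sf.K_smooth _ _ that])
    show "norm (sf.n u) = 1 \<and> K (sf.P u) > 0 \<and> sf.a u = (\<i> / complex_of_real (sqrt (K (sf.P u)))) *s
        ccross (cvec (sf.n u)) (nabla_z sf.\<Gamma> sf.a (\<lambda>v. cvec (sf.n v)) u)" if "u \<in> sf.W" for u
      using sf.n_unit[of u] sf.K_pos sf.a_formula[OF that] by (simp add: norm_eq_1)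
    show "conn_term (sf.\<Gamma> u) (x::complex^3) y
       = ccross (vector [of_real \<mu>1 * x $ 1, of_real \<mu>1 * x $ 2, of_real \<mu>3 * x $ 3]) y" for u x y
      unfolding sf.\<Gamma>_def by (rule conn)
  qed
  show ?thesis
  proof
    show "let n = (\<lambda>w. comps ip E (\<phi> (inv_into V \<zeta> w)) (N (inv_into V \<zeta> w)));
          k = (\<lambda>w. K (inv_into V \<zeta> w));
          \<Gamma> = (\<lambda>w. conn_coeff ip E nab (\<phi> (inv_into V \<zeta> w)));
          a = phi_z \<S> \<A> ip E \<phi> V \<zeta>;
          g = (\<lambda>w. gauss_map (n w))
      in \<forall>w\<in>\<zeta> ` V. n w $ 3 \<noteq> 1 \<longrightarrow>
           gauss_equation \<mu>1 \<mu>3 g k w \<and>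
           (integrability_equation \<Gamma> a n k w \<longleftrightarrow> gauss_equation \<mu>1 \<mu>3 g k w)"
      unfolding Let_def eqs[symmetric] sf.a_def[symmetric] sf.W_def[symmetric]
      using iff sf.integrable by blast
    show "\<forall>(U :: complex set) (n :: complex \<Rightarrow> real^3) (k :: complex \<Rightarrow> real) (a :: complex \<Rightarrow> complex^3).
        let \<Gamma> = (\<lambda>w. conn_coeff ip E nab \<one>\<^bsub>G\<^esub>);
            g = (\<lambda>w. gauss_map (n w))
        in open U \<and> smooth_on U n \<and> smooth_on U k \<and>
           (\<forall>w\<in>U. norm (n w) = 1 \<and> k w > 0 \<and>
              a w = (\<i> / complex_of_real (sqrt (k w))) *s
                      ccross (cvec (n w)) (nabla_z \<Gamma> a (\<lambda>u. cvec (n u)) w)) \<longrightarrow>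
           (\<forall>w\<in>U. n w $ 3 \<noteq> 1 \<longrightarrow>
              (integrability_equation \<Gamma> a n k w \<longleftrightarrow> gauss_equation \<mu>1 \<mu>3 g k w))"
      unfolding Let_def
    proof (intro allI impI ballI, elim conjE)
      fix U :: "complex set" and n :: "complex \<Rightarrow> real^3" and k :: "complex \<Rightarrow> real" and a :: "complex \<Rightarrow> complex^3" and w
      assume "w \<in> U" "n w $ 3 \<noteq> 1" "open U" "smooth_on U n" "smooth_on U k"
        and d: "\<forall>w\<in>U. norm (n w) = 1 \<and> k w > 0 \<and>
              a w = (\<i> / complex_of_real (sqrt (k w))) *s
                      ccross (cvec (n w)) (nabla_z (\<lambda>w. conn_coeff ip E nab \<one>\<^bsub>G\<^esub>) a (\<lambda>u. cvec (n u)) w)"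
      show "integrability_equation (\<lambda>w. conn_coeff ip E nab \<one>\<^bsub>G\<^esub>) a n k w
          \<longleftrightarrow> gauss_equation \<mu>1 \<mu>3 (\<lambda>w. gauss_map (n w)) k w"
        by (rule integrability_iff_gauss_equation[OF \<open>open U\<close> smooth_on_Ck[OF \<open>smooth_on U n\<close>]
              smooth_on_Ck[OF \<open>smooth_on U k\<close>] d[THEN bspec] conn \<open>w \<in> U\<close> \<open>n w $ 3 \<noteq> 1\<close>])
    qed
  qed
qed

end
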